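(* Let $0<\alpha<1$. Consider on $\mathbb T^2=[-\pi,\pi)^2$ (i.e. for functions on $\mathbb R^2$ that are $2\pi$-periodic in each variable) the modified SQG equation $$\partial_t\omega+(u\cdot\nabla)\omega=0,\qquad u=\nabla^\perp(-\Delta)^{-1+\alpha}\omega,\qquad \omega(x,0)=\omega_0(x).$$ Then there exist smooth periodic initial data $\omega_0$ and a constant $\gamma>0$ (which may depend on $\omega_0$ and $\alpha$) such that for all $T>0$ the corresponding solution $\omega$ satisfies $$\sup_{t\le T}\|\nabla^2\omega(\cdot,t)\|_{L^\infty}\ \ge\ \exp(\gamma T).$$ Moreover, $\gamma$ can be made arbitrarily large by choosing $\omega_0$ appropriately: for every $\Gamma>0$ there are smooth periodic initial data $\omega_0$ and a constant $\gamma\ge\Gamma$ such that the corresponding solution $\omega$ satisfies $\sup_{t\le T}\|\nabla^2\omega(\cdot,t)\|_{L^\infty}\ge\exp(\gamma T)$ for all $T>0$.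
   Context: Here $\nabla^\perp=(-\partial_{x_2},\partial_{x_1})$, and $(-\Delta)^{-1+\alpha}$ is the Fourier multiplier with symbol $|k|^{-2+2\alpha}$ on mean-zero periodic functions (the data are mean-zero). The case $\alpha=1/2$ is the SQG equation. For smooth initial data a unique smooth solution exists locally in time. Global regularity is not asserted: solutions that lose smoothness (blow up) in finite time are regarded as satisfying the estimate, i.e. the left-hand side is understood to be $+\infty$ if the solution does not remain smooth on $[0,T]$; as long as the solution is smooth on $[0,T]$ the supremum is over $t\in[0,T]$. *)

theory Defs
  imports "HOL-Analysis.Analysis" "HOL-Probability.Essential_Supremum"
begin

type_synonym plane = "real^2"

definition torus :: "plane set" where
  "torus = {x. \<forall>i. - pi \<le> x $ i \<and> x $ i < pi}"

text \<open>Functions on the torus are represented by their periodic lifts to the plane.\<close>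

definition periodic :: "(plane \<Rightarrow> 'b) \<Rightarrow> bool" where
  "periodic f \<longleftrightarrow> (\<forall>x i. f (x + (2 * pi) *\<^sub>R axis i 1) = f x)"

definition mean_zero :: "(plane \<Rightarrow> real) \<Rightarrow> bool" where
  "mean_zero f \<longleftrightarrow> (LINT x:torus|lborel. f x) = 0"

text \<open>
  \<open>Ck_on k S f\<close>: the function is k times continuously differentiable on S. Derivatives are
  taken within S, so they are one-sided at boundary points; they are unique for the two kinds
  of sets used below, the plane and [0,T] times the plane with T > 0.
\<close>

fun Ck_on :: "nat \<Rightarrow> 'a::euclidean_space set \<Rightarrow> ('a \<Rightarrow> real) \<Rightarrow> bool" where
  "Ck_on 0 S f \<longleftrightarrow> continuous_on S f"
| "Ck_on (Suc k) S f \<longleftrightarrow>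
     (\<exists>D. (\<forall>x\<in>S. (f has_derivative D x) (at x within S)) \<and>
          (\<forall>b\<in>Basis. Ck_on k S (\<lambda>x. D x b)))"

definition smooth_on :: "'a::euclidean_space set \<Rightarrow> ('a \<Rightarrow> real) \<Rightarrow> bool" where
  "smooth_on S f \<longleftrightarrow> (\<forall>k. Ck_on k S f)"

definition partial :: "2 \<Rightarrow> (plane \<Rightarrow> real) \<Rightarrow> plane \<Rightarrow> real" where
  "partial i f x = frechet_derivative f (at x) (axis i 1)"

definition grad :: "(plane \<Rightarrow> real) \<Rightarrow> plane \<Rightarrow> plane" where
  "grad f x = (\<chi> i. partial i f x)"

definition grad_perp :: "(plane \<Rightarrow> real) \<Rightarrow> plane \<Rightarrow> plane" where
  "grad_perp f x = vector [- partial 2 f x, partial 1 f x]"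

definition hessian :: "(plane \<Rightarrow> real) \<Rightarrow> plane \<Rightarrow> real^2^2" where
  "hessian f x = (\<chi> i j. partial i (partial j f) x)"

text \<open>
  The norm on \<open>real^2^2\<close> is the Frobenius norm.
\<close>

definition Linf_norm :: "(plane \<Rightarrow> 'b::real_normed_vector) \<Rightarrow> ereal" where
  "Linf_norm F = esssup (restrict_space lborel torus) (\<lambda>x. ereal (norm (F x)))"

definition wavevector :: "int^2 \<Rightarrow> plane" where
  "wavevector k = (\<chi> i. real_of_int (k $ i))"

definition fourier_coeff :: "(plane \<Rightarrow> real) \<Rightarrow> int^2 \<Rightarrow> complex" where
  "fourier_coeff f k =
     (LINT x:torus|lborel. complex_of_real (f x) * cis (- (wavevector k \<bullet> x))) / (2 * pi)\<^sup>2"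

text \<open>
  \<open>frac_laplacian s f\<close> is the Fourier multiplier with symbol \<open>|k| powr (2 * s)\<close> for the power s of
  the negative Laplacian, acting on mean-zero functions (the mode k = 0 is omitted). For real
  smooth periodic arguments the series converges absolutely and its sum is real, because the
  coefficients at k and -k are conjugate; \<open>Re\<close> only converts the type.
\<close>

definition frac_laplacian :: "real \<Rightarrow> (plane \<Rightarrow> real) \<Rightarrow> plane \<Rightarrow> real" where
  "frac_laplacian s f x =
     Re (\<Sum>\<^sub>\<infinity>k\<in>-{0}. complex_of_real (norm (wavevector k) powr (2 * s)) *
            fourier_coeff f k * cis (wavevector k \<bullet> x))"

definition velocity :: "real \<Rightarrow> (plane \<Rightarrow> real) \<Rightarrow> plane \<Rightarrow> plane" where
  "velocity \<alpha> f = grad_perp (frac_laplacian (- 1 + \<alpha>) f)"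

definition smooth_periodic_data :: "(plane \<Rightarrow> real) \<Rightarrow> bool" where
  "smooth_periodic_data \<omega>\<^sub>0 \<longleftrightarrow> smooth_on UNIV \<omega>\<^sub>0 \<and> periodic \<omega>\<^sub>0 \<and> mean_zero \<omega>\<^sub>0"

text \<open>
  Solutions that are smooth on the closed time interval [0,T], end points included. Statements
  about all such \<open>\<omega>\<close> are void when the solution loses smoothness before or at time T, which is the
  convention that a norm of a solution counts as infinite once it has blown up.
\<close>

definition smooth_solution ::
    "real \<Rightarrow> (plane \<Rightarrow> real) \<Rightarrow> real \<Rightarrow> (real \<Rightarrow> plane \<Rightarrow> real) \<Rightarrow> bool" where
  "smooth_solution \<alpha> \<omega>\<^sub>0 T \<omega> \<longleftrightarrow>
     smooth_on ({0..T} \<times> UNIV) (\<lambda>(t, x). \<omega> t x) \<and>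
     (\<forall>t\<in>{0..T}. periodic (\<omega> t)) \<and>
     \<omega> 0 = \<omega>\<^sub>0 \<and>
     (\<forall>t\<in>{0..T}. \<forall>x. \<exists>\<omega>\<^sub>t.
        ((\<lambda>s. \<omega> s x) has_real_derivative \<omega>\<^sub>t) (at t within {0..T}) \<and>
        \<omega>\<^sub>t + velocity \<alpha> (\<omega> t) x \<bullet> grad (\<omega> t) x = 0)"

end

theory Submission
  imports Defs "HOL-Probability.Characteristic_Functions"
begin

text \<open>
  The data \<open>A sin\<^sup>3 x\<^sub>1 sin x\<^sub>2\<close> are odd in both variables, and an energy estimate (with a commutator
  cancellation that makes it work for all \<open>\<alpha>\<close>) shows that smooth solutions are unique, hence stay odd.
  The origin is therefore a hyperbolic stagnation point. Writing the Riesz potential as an integral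
  over the periodic heat semigroup, the strain \<open>\<lambda>\<close> there is positive by the maximum principle, and it is
  bounded below by a multiple of A for all time because energy and sup norm are conserved.

  Suppose the Hessian stays below \<open>B = exp (\<gamma> T)\<close>. Then the strain is nearly constant on a box whose
  size r is a fixed power of 1/B. In that box the flow is nearly linear, and it carries the
  value \<open>\<approx> r\<^sup>4 exp (- \<integral>\<lambda>)\<close> of the solution to a point with \<open>x\<^sub>1 \<approx> r exp (- \<integral>\<lambda>)\<close>. On the other hand the
  cubic vanishing of the data at \<open>x\<^sub>1 = 0\<close> persists to second order, so the solution is at most
  \<open>B x\<^sub>1\<^sup>2 \<approx> B r\<^sup>2 exp (- 2 \<integral>\<lambda>)\<close> there. For small \<open>\<gamma>\<close> this is a contradiction. Since the time scale is
  1/A, large A makes the growth rate large.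
\<close>

section \<open>Integration over the period cell\<close>

text \<open>The strain is a derivative of order 2 \<alpha> of the solution, so energy and sup norm
  cannot bound its variation near the origin; part of the assumed Hessian bound has to be spent on
  it. Cutting the heat integral at time \<delta> costs B \<delta>^(1-\<alpha>) before \<delta>,
  which fixes \<delta> ~ B^(-1/(1-\<alpha>)), and a Lipschitz constant \<delta>^(-4) after it, which
  fixes r ~ B^(-4/(1-\<alpha>)). With L the time integral of the strain, the two bounds at the end
  combine to exp(L) \<le> const B r^(-2), up to small errors in the exponent. The right side is a
  fixed power of B while L grows at least like A T, so any loss of powers of B is affordable. The
  third power of the sine makes the derivative across the axis vanish initially; with a first power
  the quadratic upper bound would fail at time 0. Transport is expressed through minimum principles
  rather than trajectories: a barrier touches the solution, and at the contact point the gradient of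
  the solution is that of the barrier.\<close>

abbreviation ax :: "2 \<Rightarrow> plane" where "ax i \<equiv> axis i 1"

text \<open>The closed square instead of the half-open \<open>torus\<close>: it is compact and a
  \<open>cbox\<close>, so the extreme value theorem and the gauge-integral theorems apply, and the
  difference is a null set.\<close>

definition cell :: "plane set" where "cell = cbox (\<chi> i. - pi) (\<chi> i. pi)"

definition cell_int :: "(plane \<Rightarrow> 'b::euclidean_space) \<Rightarrow> 'b" where
  "cell_int f = integral cell f"

lemma mem_cell: "x \<in> cell \<longleftrightarrow> (\<forall>i. - pi \<le> x $ i \<and> x $ i \<le> pi)"
  by (simp add: cell_def mem_box_cart)

lemma compact_cell [simp]: "compact cell"
  by (simp add: cell_def compact_cbox)

lemma integrable_on_cell:
  fixes f :: "plane \<Rightarrow> 'b::euclidean_space"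
  shows "continuous_on cell f \<Longrightarrow> f integrable_on cell"
  unfolding cell_def by (rule integrable_continuous)

lemma torus_borel [measurable]: "torus \<in> sets borel"
  unfolding torus_def by measurable

lemma torus_subset_cell: "torus \<subseteq> cell"
  unfolding torus_def by (auto simp: mem_cell less_imp_le)

lemma interior_cell_subset_torus: "box (\<chi> i. - pi) (\<chi> i. pi) \<subseteq> torus"
  unfolding torus_def by (auto simp: mem_box_cart less_imp_le)

lemma AE_torus_iff_cell: "AE x in lborel. x \<in> torus \<longleftrightarrow> x \<in> cell"
proof -
  have "cell - box (\<chi> i. - pi) (\<chi> i. pi) \<in> null_sets lborel"
    using negligible_frontier_interval[of "(\<chi> i. - pi) :: plane" "\<chi> i. pi"]
    by (simp add: cell_def negligible_iff_null_sets null_sets_completion_iff)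
  then show ?thesis
    using torus_subset_cell interior_cell_subset_torus
    by (auto intro: AE_I' [of "cell - box (\<chi> i. - pi) (\<chi> i. pi)"])
qed

lemma set_integrable_torus:
  fixes f :: "plane \<Rightarrow> 'b::euclidean_space"
  assumes "continuous_on UNIV f"
  shows "set_integrable lborel torus f"
proof -
  have "set_integrable lborel cell f"
    using borel_integrable_compact[of cell f] assms
    by (auto simp: set_integrable_def intro: continuous_on_subset)
  then show ?thesis
    by (rule set_integrable_subset) (use torus_subset_cell in auto)
qed

lemma LINT_torus_eq_cell_int:
  fixes f :: "plane \<Rightarrow> 'b::euclidean_space"
  assumes "continuous_on UNIV f"
  shows "(LINT x:torus|lborel. f x) = cell_int f"
proof -
  have [measurable]: "f \<in> borel_measurable borel"
    using assms by (rule borel_measurable_continuous_onI)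
  have [measurable]: "cell \<in> sets borel" by (simp add: cell_def)
  have si: "set_integrable lborel cell f"
    using borel_integrable_compact[of cell f] assms
    by (auto simp: set_integrable_def intro: continuous_on_subset)
  have "(LINT x:torus|lborel. f x) = (LINT x:cell|lborel. f x)"
    unfolding set_lebesgue_integral_def
    by (rule integral_cong_AE) (use AE_torus_iff_cell in \<open>auto simp: indicator_def\<close>)
  also have "\<dots> = cell_int f"
    unfolding cell_int_def using si by (rule set_borel_integral_eq_integral)
  finally show ?thesis .
qed

lemma set_integral_lborel_shift:
  fixes f :: "'a::euclidean_space \<Rightarrow> 'b::euclidean_space"
  assumes [measurable]: "f \<in> borel_measurable borel" "S \<in> sets borel"
  shows "(LINT x:S|lborel. f (x + c)) = (LINT x:{x. x - c \<in> S}|lborel. f x)"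
proof -
  have m: "(\<lambda>x. indicator S (x - c) *\<^sub>R f x) \<in> borel_measurable borel" by measurable
  have "(LINT x:{x. x - c \<in> S}|lborel. f x) = (\<integral>x. indicator S (x - c) *\<^sub>R f x \<partial>lborel)"
    unfolding set_lebesgue_integral_def by (intro Bochner_Integration.integral_cong) (auto simp: indicator_def)
  also have "\<dots> = (\<integral>x. indicator S (x - c) *\<^sub>R f x \<partial>distr lborel borel ((+) c))"
    by (simp add: lborel_distr_plus)
  also have "\<dots> = (\<integral>x. indicator S (c + x - c) *\<^sub>R f (c + x) \<partial>lborel)"
    by (rule integral_distr) (use m in auto)
  finally show ?thesis by (simp add: set_lebesgue_integral_def add.commute)
qed

text \<open>The slab of width \<open>h\<close> that leaves the cell under the shift re-enters on the
  opposite side, moved by one period. On the half-open \<open>torus\<close> the two pieces are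
  disjoint.\<close>

lemma cell_int_shift:
  fixes f :: "plane \<Rightarrow> 'b::euclidean_space"
  assumes f: "continuous_on UNIV f" and p: "\<And>x. f (x + (2 * pi) *\<^sub>R ax i) = f x"
    and h: "0 \<le> h" "h \<le> 2 * pi"
  shows "cell_int (\<lambda>x. f (x + h *\<^sub>R ax i)) = cell_int f"
proof -
  define A where "A = {x\<in>torus. x $ i < - pi + h}"
  define B where "B = torus - A"
  have [measurable]: "f \<in> borel_measurable borel"
    using f by (rule borel_measurable_continuous_onI)
  have [measurable]: "A \<in> sets borel" "B \<in> sets borel"
    unfolding A_def B_def by measurable
  define A' where "A' = {x. x - (2 * pi) *\<^sub>R ax i \<in> A}"
  have [measurable]: "A' \<in> sets borel" unfolding A'_def by measurable
  have siT: "set_integrable lborel torus (\<lambda>x. f (x + c))" for c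
    by (intro set_integrable_torus continuous_intros continuous_on_compose2[OF f]) auto
  have siA: "set_integrable lborel A f" "set_integrable lborel B f"
    using siT[of 0] by (auto intro!: set_integrable_subset[of lborel torus f] simp: A_def B_def)
  have siA': "set_integrable lborel A' f"
  proof -
    have "compact ((\<lambda>x. x + (2 * pi) *\<^sub>R ax i) ` cell)"
      by (intro compact_continuous_image continuous_intros) auto
    then have "set_integrable lborel ((\<lambda>x. x + (2 * pi) *\<^sub>R ax i) ` cell) f"
      using borel_integrable_compact f
      by (auto simp: set_integrable_def intro: continuous_on_subset)
    moreover have "A' \<subseteq> (\<lambda>x. x + (2 * pi) *\<^sub>R ax i) ` cell"
      using torus_subset_cell by (force simp: A'_def A_def image_iff intro: bexI[of _ "_ - (2 * pi) *\<^sub>R ax i"])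
    ultimately show ?thesis by (intro set_integrable_subset[of lborel _ f A']) auto
  qed
  have sh: "{x. x - h *\<^sub>R ax i \<in> torus} = B \<union> A'" "B \<inter> A' = {}"
  proof -
    have T: "x - c *\<^sub>R ax i \<in> torus \<longleftrightarrow> (\<forall>j. j \<noteq> i \<longrightarrow> - pi \<le> x $ j \<and> x $ j < pi) \<and> - pi \<le> x $ i - c \<and> x $ i - c < pi"
      for x c by (auto simp: torus_def axis_def)
    have "x \<in> A' \<longleftrightarrow> (\<forall>j. j \<noteq> i \<longrightarrow> - pi \<le> x $ j \<and> x $ j < pi) \<and> pi \<le> x $ i \<and> x $ i < pi + h" for x
      using T[of x "2 * pi"] h by (auto simp: A'_def A_def axis_def)
    moreover have "x \<in> B \<longleftrightarrow> (\<forall>j. j \<noteq> i \<longrightarrow> - pi \<le> x $ j \<and> x $ j < pi) \<and> - pi + h \<le> x $ i \<and> x $ i < pi" for x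
      using T[of x 0] h by (auto simp: B_def A_def)
    ultimately show "{x. x - h *\<^sub>R ax i \<in> torus} = B \<union> A'" "B \<inter> A' = {}"
      using T[of _ h] h by (force, force)
  qed
  have "cell_int (\<lambda>x. f (x + h *\<^sub>R ax i)) = (LINT x:torus|lborel. f (x + h *\<^sub>R ax i))"
    by (rule LINT_torus_eq_cell_int[symmetric]) (intro continuous_intros continuous_on_compose2[OF f], auto)
  also have "\<dots> = (LINT x:{x. x - h *\<^sub>R ax i \<in> torus}|lborel. f x)"
    by (rule set_integral_lborel_shift) auto
  also have "\<dots> = (LINT x:B|lborel. f x) + (LINT x:A'|lborel. f x)"
    unfolding sh by (rule set_integral_Un) (use sh siA siA' in auto)
  also have "(LINT x:A'|lborel. f x) = (LINT x:A|lborel. f (x + (2 * pi) *\<^sub>R ax i))"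
    unfolding A'_def by (rule set_integral_lborel_shift[symmetric]) auto
  also have "\<dots> = (LINT x:A|lborel. f x)" by (simp add: p)
  also have "(LINT x:B|lborel. f x) + (LINT x:A|lborel. f x) = (LINT x:B \<union> A|lborel. f x)"
    by (rule set_integral_Un[symmetric]) (use siA in \<open>auto simp: B_def\<close>)
  also have "B \<union> A = torus" by (auto simp: A_def B_def)
  also have "(LINT x:torus|lborel. f x) = cell_int f"
    by (rule LINT_torus_eq_cell_int) fact
  finally show ?thesis .
qed

section \<open>Directional derivatives and integration by parts on the torus\<close>

definition has_dir_deriv :: "2 \<Rightarrow> (plane \<Rightarrow> 'b::real_normed_vector) \<Rightarrow> (plane \<Rightarrow> 'b) \<Rightarrow> bool" where
  "has_dir_deriv i f g \<longleftrightarrow> (\<forall>x. ((\<lambda>h. f (x + h *\<^sub>R ax i)) has_vector_derivative g x) (at 0))"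

lemma has_dir_deriv_line:
  assumes "has_dir_deriv i f g"
  shows "((\<lambda>h. f (x + h *\<^sub>R ax i)) has_vector_derivative g (x + a *\<^sub>R ax i)) (at a within S)"
proof -
  have "((\<lambda>h. f (x + a *\<^sub>R ax i + h *\<^sub>R ax i)) has_vector_derivative g (x + a *\<^sub>R ax i)) (at (a - a))"
    using assms by (simp add: has_dir_deriv_def)
  moreover have "((\<lambda>h. h - a) has_vector_derivative 1) (at a)"
    by (auto intro!: derivative_eq_intros)
  ultimately have "(((\<lambda>h. f (x + a *\<^sub>R ax i + h *\<^sub>R ax i)) \<circ> (\<lambda>h. h - a)) has_vector_derivative
      1 *\<^sub>R g (x + a *\<^sub>R ax i)) (at a)"
    by (intro vector_diff_chain_at)
  moreover have "(\<lambda>h. f (x + a *\<^sub>R ax i + h *\<^sub>R ax i)) \<circ> (\<lambda>h. h - a) = (\<lambda>h. f (x + h *\<^sub>R ax i))"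
    by (auto simp: algebra_simps)
  ultimately show ?thesis by (auto intro: has_vector_derivative_at_within)
qed

text \<open>The integral of a translate does not depend on the translation; differentiate it under
  the integral sign.\<close>

lemma cell_int_dir_deriv_eq_0:
  fixes f :: "plane \<Rightarrow> 'b::euclidean_space"
  assumes d: "has_dir_deriv i f g" and f: "continuous_on UNIV f" and g: "continuous_on UNIV g"
    and p: "\<And>x. f (x + (2 * pi) *\<^sub>R ax i) = f x"
  shows "cell_int g = 0"
proof -
  \<comment> \<open>The derivative in \<open>h\<close> is taken from the right, since
    \<open>cell_int_shift\<close> covers only \<open>0 \<le> h\<close>.\<close>
  have "((\<lambda>h. integral cell (\<lambda>x. f (x + h *\<^sub>R ax i))) has_vector_derivative
         integral cell (\<lambda>x. g (x + 0 *\<^sub>R ax i))) (at 0 within {0..1})"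
    unfolding cell_def
  proof (rule leibniz_rule_vector_derivative)
    show "((\<lambda>h. f (x + h *\<^sub>R ax i)) has_vector_derivative g (x + a *\<^sub>R ax i)) (at a within {0..1})" for a x
      by (rule has_dir_deriv_line[OF d])
    show "(\<lambda>x. f (x + h *\<^sub>R ax i)) integrable_on cbox (\<chi> i. - pi) (\<chi> i. pi)" for h
      by (intro integrable_continuous continuous_intros continuous_on_compose2[OF f]) auto
    show "continuous_on ({0..1} \<times> cbox (\<chi> i. - pi) (\<chi> i. pi)) (\<lambda>(h, x). g (x + h *\<^sub>R ax i))"
      unfolding split_def by (intro continuous_intros continuous_on_compose2[OF g]) auto
  qed auto
  then have 1: "((\<lambda>h. cell_int (\<lambda>x. f (x + h *\<^sub>R ax i))) has_vector_derivative cell_int g) (at 0 within {0..1})"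
    by (simp add: cell_int_def)
  have "cell_int (\<lambda>x. f (x + h *\<^sub>R ax i)) = cell_int f" if "h \<in> {0..1}" for h
    using that pi_gt3 by (intro cell_int_shift f p) auto
  then have "((\<lambda>h. cell_int f) has_vector_derivative cell_int g) (at 0 within {0..1})"
    by (intro has_vector_derivative_transform[OF _ _ 1]) auto
  moreover have "((\<lambda>h. cell_int f) has_vector_derivative 0) (at (0::real) within {0..1})"
    by simp
  ultimately show ?thesis
    by (intro vector_derivative_unique_within[of "0::real" "{0..1}"])
       (auto simp: trivial_limit_within islimpt_Icc)
qed

section \<open>Characters of the torus\<close>

abbreviation freq_norm :: "int^2 \<Rightarrow> real" where "freq_norm k \<equiv> norm (wavevector k)"

definition character :: "int^2 \<Rightarrow> plane \<Rightarrow> complex" where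
  "character k x = cis (wavevector k \<bullet> x)"

lemma wavevector_nth [simp]: "wavevector k $ i = of_int (k $ i)"
  by (simp add: wavevector_def)

lemma wavevector_simps [simp]:
  "wavevector 0 = 0" "wavevector (- k) = - wavevector k"
  "wavevector (k + l) = wavevector k + wavevector l" "wavevector (k - l) = wavevector k - wavevector l"
  by (simp_all add: wavevector_def vec_eq_iff)

lemma inner_2: "(x::plane) \<bullet> y = x $ 1 * y $ 1 + x $ 2 * y $ 2"
  by (simp add: inner_vec_def UNIV_2)

lemma norm_2_sq: "(norm (x::plane))\<^sup>2 = (x $ 1)\<^sup>2 + (x $ 2)\<^sup>2"
  by (subst power2_norm_eq_inner) (simp add: inner_2 power2_eq_square)

lemma freq_norm_ge_1: "k \<noteq> 0 \<Longrightarrow> 1 \<le> freq_norm k"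
proof -
  assume "k \<noteq> 0"
  then obtain i where "k $ i \<noteq> 0" by (auto simp: vec_eq_iff)
  then have "1 \<le> \<bar>wavevector k $ i\<bar>" by simp
  also have "\<dots> \<le> freq_norm k" by (rule component_le_norm_cart)
  finally show ?thesis .
qed

lemma abs_comp_le_freq_norm: "\<bar>real_of_int (k $ i)\<bar> \<le> freq_norm k"
  using component_le_norm_cart[of "wavevector k" i] by simp

lemma norm_character [simp]: "norm (character k x) = 1"
  by (simp add: character_def)

lemma character_0 [simp]: "character 0 x = 1"
  by (simp add: character_def)

lemma character_mult: "character k x * character l x = character (k + l) x"
  by (simp add: character_def cis_mult inner_add_left)

lemma character_at_0 [simp]: "character k 0 = 1"
  by (simp add: character_def)

lemma cnj_character: "cnj (character k x) = character (- k) x"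
  by (simp add: character_def cis_cnj)

lemma character_add: "character k (x + y) = character k x * character k y"
  by (simp add: character_def cis_mult inner_add_right)

lemma periodic_character: "character k (x + (2 * pi) *\<^sub>R ax i) = character k x"
proof -
  have "character k ((2 * pi) *\<^sub>R ax i) = cis (2 * pi * of_int (k $ i))"
    by (simp add: character_def inner_axis)
  also have "\<dots> = 1"
    by (simp add: cis_multiple_2pi)
  finally show ?thesis by (simp add: character_add)
qed

lemma continuous_on_character [continuous_intros]: "continuous_on S (character k)"
  unfolding character_def by (intro continuous_intros)

lemma norm_cis_minus_1: "norm (cis y - 1) \<le> \<bar>y\<bar>"
  using iexp_approx1[of y 0] by (simp add: cis_conv_exp)

lemma norm_cis_minus_linear: "norm (cis y - 1 - \<i> * of_real y) \<le> y\<^sup>2 / 2"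
  using iexp_approx1[of y 1] by (simp add: cis_conv_exp algebra_simps power2_eq_square)

section \<open>Summability over the frequency lattice\<close>

lemma summable_on_int_inverse_sq: "(\<lambda>j::int. 1 / (1 + \<bar>real_of_int j\<bar>)\<^sup>2) summable_on UNIV"
proof -
  let ?f = "\<lambda>j::int. 1 / (1 + \<bar>real_of_int j\<bar>)\<^sup>2"
  have "summable (\<lambda>n. inverse ((real (Suc n))\<^sup>2))"
    using inverse_power_summable[of 2, where 'a=real] by (subst summable_Suc_iff) auto
  then have s: "(\<lambda>n::nat. 1 / (1 + real n)\<^sup>2) summable_on UNIV"
    by (intro summable_nonneg_imp_summable_on) (auto simp: field_simps)
  have 1: "?f summable_on (range int)"
    using s by (subst summable_on_reindex) (auto simp: o_def)
  have 2: "?f summable_on (range (\<lambda>n. - int n))"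
    using s by (subst summable_on_reindex) (auto simp: o_def inj_def)
  have "range int \<union> range (\<lambda>n. - int n) = UNIV"
  proof (intro set_eqI iffI)
    show "j \<in> range int \<union> range (\<lambda>n. - int n)" for j
      by (cases j rule: int_cases2) auto
  qed auto
  then show ?thesis using summable_on_union[OF 1 2] by simp
qed

lemma bij_vec2: "bij_betw (\<lambda>(a, b). (\<chi> i. if i = 1 then a else b) :: 'a^2) (UNIV \<times> UNIV) UNIV"
proof (rule bij_betwI[where g = "\<lambda>k. (k $ 1, k $ 2)"])
qed (auto simp: vec_eq_iff forall_2)

text \<open>Compared with the product of two one-dimensional inverse-square series, whence the
  exponent 4.\<close>

lemma summable_freq_norm_4: "(\<lambda>k. 1 / (1 + freq_norm k) ^ 4) summable_on UNIV"
proof -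
  let ?f = "\<lambda>j::int. 1 / (1 + \<bar>real_of_int j\<bar>)\<^sup>2"
  have "(\<lambda>p. ?f (fst p) * ?f (snd p)) summable_on UNIV \<times> UNIV"
  proof (rule summable_on_SigmaI)
    show "((\<lambda>b. ?f (fst (a, b)) * ?f (snd (a, b))) has_sum (?f a * (\<Sum>\<^sub>\<infinity>b. ?f b))) UNIV" for a
      unfolding fst_conv snd_conv by (intro has_sum_cmult_right has_sum_infsum summable_on_int_inverse_sq)
    show "(\<lambda>a. ?f a * (\<Sum>\<^sub>\<infinity>b. ?f b)) summable_on UNIV"
      by (intro summable_on_cmult_left summable_on_int_inverse_sq)
  qed auto
  then have "(\<lambda>p. (\<lambda>k. ?f (k $ 1) * ?f (k $ 2)) ((\<lambda>(a, b). (\<chi> i. if i = 1 then a else b) :: int^2) p)) summable_on UNIV \<times> UNIV"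
    by (simp add: case_prod_unfold)
  then have "(\<lambda>k::int^2. ?f (k $ 1) * ?f (k $ 2)) summable_on UNIV"
    by (subst (asm) summable_on_reindex_bij_betw[OF bij_vec2])
  then show ?thesis
  proof (rule summable_on_comparison_test)
    fix k :: "int^2"
    have "(1 + \<bar>real_of_int (k $ 1)\<bar>)\<^sup>2 * (1 + \<bar>real_of_int (k $ 2)\<bar>)\<^sup>2 \<le> (1 + freq_norm k)\<^sup>2 * (1 + freq_norm k)\<^sup>2"
      by (intro mult_mono power_mono add_mono abs_comp_le_freq_norm) auto
    also have "\<dots> = (1 + freq_norm k) ^ 4" by (simp flip: power_add)
    finally show "1 / (1 + freq_norm k) ^ 4 \<le> ?f (k $ 1) * ?f (k $ 2)"
      using frac_le[of 1 1 "(1 + \<bar>real_of_int (k $ 1)\<bar>)\<^sup>2 * (1 + \<bar>real_of_int (k $ 2)\<bar>)\<^sup>2" "(1 + freq_norm k) ^ 4"]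
      by (simp add: add_pos_nonneg)
  qed auto
qed

text \<open>The Schwartz class of the lattice: the coefficients of smooth periodic functions. The
  value type is left open so that real majorants of coefficients belong to it as well.\<close>

definition rapid :: "(int^2 \<Rightarrow> 'b::real_normed_vector) \<Rightarrow> bool" where
  "rapid a \<longleftrightarrow> (\<forall>n. (\<lambda>k. (1 + freq_norm k) ^ n * norm (a k)) summable_on UNIV)"

lemma rapid_mono:
  assumes "rapid M" and "\<And>k. norm (a k) \<le> C * (1 + freq_norm k) ^ m * norm (M k)"
  shows "rapid a"
  unfolding rapid_def
proof
  fix n
  have "(\<lambda>k. C * ((1 + freq_norm k) ^ (n + m) * norm (M k))) summable_on UNIV"
    using assms(1) by (intro summable_on_cmult_right) (auto simp: rapid_def)
  then show "(\<lambda>k. (1 + freq_norm k) ^ n * norm (a k)) summable_on UNIV"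
  proof (rule summable_on_comparison_test)
    fix k
    have "(1 + freq_norm k) ^ n * norm (a k) \<le> (1 + freq_norm k) ^ n * (C * (1 + freq_norm k) ^ m * norm (M k))"
      by (intro mult_left_mono assms) auto
    then show "(1 + freq_norm k) ^ n * norm (a k) \<le> C * ((1 + freq_norm k) ^ (n + m) * norm (M k))"
      by (simp add: power_add mult_ac)
  qed auto
qed

lemma rapid_norm_le: "rapid M \<Longrightarrow> (\<And>k. norm (a k) \<le> norm (M k)) \<Longrightarrow> rapid a"
  by (rule rapid_mono[where C=1 and m=0]) auto

text \<open>Four surplus powers of the weight pay for \<open>summable_freq_norm_4\<close>, turning
  sup bounds into summability.\<close>

lemma rapidI:
  assumes "\<And>n. \<exists>C. \<forall>k. (1 + freq_norm k) ^ n * norm (a k) \<le> C"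
  shows "rapid a"
  unfolding rapid_def
proof
  fix n
  obtain C where C: "\<And>k. (1 + freq_norm k) ^ (n + 4) * norm (a k) \<le> C" using assms by blast
  have "(\<lambda>k. C * (1 / (1 + freq_norm k) ^ 4)) summable_on UNIV"
    by (intro summable_on_cmult_right summable_freq_norm_4)
  then show "(\<lambda>k. (1 + freq_norm k) ^ n * norm (a k)) summable_on UNIV"
  proof (rule summable_on_comparison_test)
    fix k
    have "(1 + freq_norm k) ^ 4 > 0" by (smt (verit) norm_ge_zero zero_less_power)
    then show "(1 + freq_norm k) ^ n * norm (a k) \<le> C * (1 / (1 + freq_norm k) ^ 4)"
      using C[of k] by (simp add: field_simps power_add)
  qed auto
qed

lemma rapid_weight_summable: "rapid a \<Longrightarrow> (\<lambda>k. (1 + freq_norm k) ^ n * norm (a k)) summable_on UNIV"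
  by (simp add: rapid_def)

lemma rapid_power_summable:
  assumes "rapid a" shows "(\<lambda>k. freq_norm k ^ n * norm (a k)) summable_on UNIV"
  by (rule summable_on_comparison_test[OF rapid_weight_summable[OF assms, of n]])
     (auto intro!: mult_right_mono power_mono)

lemma rapid_abs_summable: "rapid a \<Longrightarrow> (\<lambda>k. norm (a k)) summable_on UNIV"
  using rapid_weight_summable[of a 0] by simp

lemma rapid_mult_le:
  fixes a :: "int^2 \<Rightarrow> 'a::real_normed_algebra"
  assumes "rapid a" "\<And>k. norm (p k) \<le> C * (1 + freq_norm k) ^ m"
  shows "rapid (\<lambda>k. p k * a k)"
proof (rule rapid_mono[OF assms(1)])
  fix k
  have "norm (p k * a k) \<le> norm (p k) * norm (a k)" by (rule norm_mult_ineq)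
  also have "\<dots> \<le> C * (1 + freq_norm k) ^ m * norm (a k)" by (intro mult_right_mono assms) auto
  finally show "norm (p k * a k) \<le> C * (1 + freq_norm k) ^ m * norm (a k)" .
qed

lemma rapid_add:
  assumes "rapid a" "rapid b" shows "rapid (\<lambda>k. a k + b k)"
  unfolding rapid_def
proof
  fix n
  have "(\<lambda>k. (1 + freq_norm k) ^ n * norm (a k) + (1 + freq_norm k) ^ n * norm (b k)) summable_on UNIV"
    using assms by (intro summable_on_add) (auto simp: rapid_def)
  then show "(\<lambda>k. (1 + freq_norm k) ^ n * norm (a k + b k)) summable_on UNIV"
  proof (rule summable_on_comparison_test)
    fix k
    show "(1 + freq_norm k) ^ n * norm (a k + b k) \<le> (1 + freq_norm k) ^ n * norm (a k) + (1 + freq_norm k) ^ n * norm (b k)"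
      unfolding distrib_left[symmetric] by (intro mult_left_mono norm_triangle_ineq) auto
  qed auto
qed

lemma rapid_minus: "rapid a \<Longrightarrow> rapid (\<lambda>k. - a k)"
  by (simp add: rapid_def)

lemma rapid_comp_mult [intro]:
  fixes a :: "int^2 \<Rightarrow> complex"
  assumes "rapid a" shows "rapid (\<lambda>k. \<i> * of_int (k $ i) * a k)"
proof (rule rapid_mult_le[OF assms, where C=1 and m=1])
  fix k :: "int^2"
  show "norm (\<i> * of_int (k $ i) :: complex) \<le> 1 * (1 + freq_norm k) ^ 1"
    using abs_comp_le_freq_norm[of k i] by (simp add: norm_mult)
qed

lemma norm_infsum_mono:
  fixes f :: "'a \<Rightarrow> 'b::banach" and g :: "'a \<Rightarrow> real"
  assumes "g summable_on A" "\<And>x. x \<in> A \<Longrightarrow> norm (f x) \<le> g x"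
  shows "f summable_on A" "norm (infsum f A) \<le> infsum g A"
proof -
  have "(\<lambda>x. norm (f x)) summable_on A"
    by (rule summable_on_comparison_test[OF assms(1)]) (use assms(2) in auto)
  then show f: "f summable_on A" by (rule abs_summable_summable)
  show "norm (infsum f A) \<le> infsum g A"
    by (rule norm_infsum_le[OF has_sum_infsum[OF f] has_sum_infsum[OF assms(1)] assms(2)])
qed

lemma has_sum_diff:
  fixes f g :: "'a \<Rightarrow> 'b::real_normed_vector"
  assumes "(f has_sum S) A" "(g has_sum T) A"
  shows "((\<lambda>x. f x - g x) has_sum (S - T)) A"
  using has_sum_add[OF assms(1) has_sum_bounded_linear[OF bounded_linear_minus[OF bounded_linear_ident] assms(2)]] by simp

section \<open>Fourier series\<close>

definition fseries :: "(int^2 \<Rightarrow> complex) \<Rightarrow> plane \<Rightarrow> complex" where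
  "fseries a x = (\<Sum>\<^sub>\<infinity>k. a k * character k x)"

lemma fseries_summable: "rapid a \<Longrightarrow> (\<lambda>k. a k * character k x) summable_on UNIV"
  by (rule norm_infsum_mono[where g = "\<lambda>k. norm (a k)"]) (auto simp: norm_mult rapid_abs_summable)

lemma norm_fseries_le: "rapid a \<Longrightarrow> norm (fseries a x) \<le> (\<Sum>\<^sub>\<infinity>k. norm (a k))"
  unfolding fseries_def by (rule norm_infsum_mono) (auto simp: norm_mult rapid_abs_summable)

lemma fseries_add: "rapid a \<Longrightarrow> rapid b \<Longrightarrow> fseries (\<lambda>k. a k + b k) x = fseries a x + fseries b x"
  unfolding fseries_def by (simp add: distrib_right infsum_add fseries_summable)

lemma fseries_cmult: "fseries (\<lambda>k. c * a k) x = c * fseries a x"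
  unfolding fseries_def by (simp add: mult.assoc infsum_cmult_right')

lemma fseries_minus: "fseries (\<lambda>k. - a k) x = - fseries a x"
  using fseries_cmult[of "-1" a x] by simp

lemma fseries_diff: "rapid a \<Longrightarrow> rapid b \<Longrightarrow> fseries (\<lambda>k. a k - b k) x = fseries a x - fseries b x"
  using fseries_add[of a "\<lambda>k. - b k" x] by (simp add: fseries_minus rapid_minus)

lemma fseries_periodic: "fseries a (x + (2 * pi) *\<^sub>R ax i) = fseries a x"
  by (simp add: fseries_def periodic_character)

lemma has_derivative_quadratic:
  fixes f :: "'a::real_normed_vector \<Rightarrow> 'b::real_normed_vector"
  assumes D: "bounded_linear D" and q: "\<And>h. x + h \<in> S \<Longrightarrow> norm (f (x + h) - f x - D h) \<le> C * (norm h)\<^sup>2"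
  shows "(f has_derivative D) (at x within S)"
  unfolding has_derivative_within_alt
proof (intro conjI D allI impI)
  fix e :: real assume e: "0 < e"
  define d where "d = e / (\<bar>C\<bar> + 1)"
  have d: "d > 0" using e by (simp add: d_def)
  show "\<exists>d>0. \<forall>y\<in>S. norm (y - x) < d \<longrightarrow> norm (f y - f x - D (y - x)) \<le> e * norm (y - x)"
  proof (intro exI[of _ d] conjI d ballI impI)
    fix y assume y: "y \<in> S" "norm (y - x) < d"
    have "norm (f y - f x - D (y - x)) \<le> C * (norm (y - x))\<^sup>2" using q[of "y - x"] y by simp
    also have "\<dots> \<le> (\<bar>C\<bar> + 1) * (norm (y - x))\<^sup>2" by (intro mult_right_mono) auto
    also have "\<dots> = ((\<bar>C\<bar> + 1) * norm (y - x)) * norm (y - x)" by (simp add: power2_eq_square)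
    also have "\<dots> \<le> e * norm (y - x)"
      using y by (intro mult_right_mono) (auto simp: d_def field_simps)
    finally show "norm (f y - f x - D (y - x)) \<le> e * norm (y - x)" .
  qed
qed

definition fderiv :: "2 \<Rightarrow> (int^2 \<Rightarrow> complex) \<Rightarrow> int^2 \<Rightarrow> complex" where
  "fderiv i a = (\<lambda>k. \<i> * of_int (k $ i) * a k)"

lemma rapid_fderiv [intro]: "rapid a \<Longrightarrow> rapid (fderiv i a)"
  unfolding fderiv_def by (rule rapid_comp_mult)

text \<open>The remainder is estimated mode by mode through \<open>norm_cis_minus_linear\<close>,
  which costs two powers of the frequency.\<close>

lemma fseries_has_derivative:
  assumes a: "rapid a"
  shows "(fseries a has_derivative (\<lambda>h. (h $ 1) *\<^sub>R fseries (fderiv 1 a) x + (h $ 2) *\<^sub>R fseries (fderiv 2 a) x)) (at x within S)"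
proof (rule has_derivative_quadratic[where C = "\<Sum>\<^sub>\<infinity>k. freq_norm k ^ 2 * norm (a k)"])
  show "bounded_linear (\<lambda>h. (h $ 1) *\<^sub>R fseries (fderiv 1 a) x + (h $ 2) *\<^sub>R fseries (fderiv 2 a) x)"
    by (intro bounded_linear_add bounded_linear_compose[OF bounded_linear_scaleR_left] bounded_linear_vec_nth)
  fix h :: plane
  note s = has_sum_infsum[OF fseries_summable]
  have "((\<lambda>k. a k * character k (x + h) - a k * character k x
           - ((h $ 1) *\<^sub>R (fderiv 1 a k * character k x) + (h $ 2) *\<^sub>R (fderiv 2 a k * character k x)))
    has_sum (fseries a (x + h) - fseries a x - ((h $ 1) *\<^sub>R fseries (fderiv 1 a) x + (h $ 2) *\<^sub>R fseries (fderiv 2 a) x))) UNIV"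
    unfolding fseries_def
    by (intro has_sum_diff has_sum_add has_sum_bounded_linear[OF bounded_linear_scaleR_right] s a rapid_fderiv)
  then have "fseries a (x + h) - fseries a x - ((h $ 1) *\<^sub>R fseries (fderiv 1 a) x + (h $ 2) *\<^sub>R fseries (fderiv 2 a) x)
      = (\<Sum>\<^sub>\<infinity>k. a k * character k (x + h) - a k * character k x
           - ((h $ 1) *\<^sub>R (fderiv 1 a k * character k x) + (h $ 2) *\<^sub>R (fderiv 2 a k * character k x)))"
    by (simp add: infsumI)
  also have "\<dots> = (\<Sum>\<^sub>\<infinity>k. a k * character k x * (cis (wavevector k \<bullet> h) - 1 - \<i> * of_real (wavevector k \<bullet> h)))"
    by (intro infsum_cong)
       (simp add: fderiv_def character_add character_def[of _ h] scaleR_conv_of_real inner_2 algebra_simps)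
  also have "norm \<dots> \<le> (\<Sum>\<^sub>\<infinity>k. (freq_norm k ^ 2 * norm (a k)) * (norm h)\<^sup>2)"
  proof (rule norm_infsum_mono)
    show "(\<lambda>k. (freq_norm k ^ 2 * norm (a k)) * (norm h)\<^sup>2) summable_on UNIV"
      by (intro summable_on_cmult_left rapid_power_summable a)
    fix k :: "int^2"
    have "norm (cis (wavevector k \<bullet> h) - 1 - \<i> * of_real (wavevector k \<bullet> h)) \<le> (wavevector k \<bullet> h)\<^sup>2 / 2"
      by (rule norm_cis_minus_linear)
    also have "\<dots> \<le> (wavevector k \<bullet> h)\<^sup>2" by simp
    also have "\<dots> \<le> (freq_norm k * norm h)\<^sup>2"
      by (intro abs_le_square_iff[THEN iffD1]) (simp add: Cauchy_Schwarz_ineq2)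
    finally have "norm (a k) * norm (cis (wavevector k \<bullet> h) - 1 - \<i> * of_real (wavevector k \<bullet> h)) \<le> norm (a k) * (freq_norm k * norm h)\<^sup>2"
      by (intro mult_left_mono) auto
    then show "norm (a k * character k x * (cis (wavevector k \<bullet> h) - 1 - \<i> * of_real (wavevector k \<bullet> h)))
        \<le> (freq_norm k ^ 2 * norm (a k)) * (norm h)\<^sup>2"
      by (simp add: norm_mult power_mult_distrib mult_ac)
  qed
  also have "\<dots> = (\<Sum>\<^sub>\<infinity>k. freq_norm k ^ 2 * norm (a k)) * (norm h)\<^sup>2"
    by (rule infsum_cmult_left')
  finally show "norm (fseries a (x + h) - fseries a x - ((h $ 1) *\<^sub>R fseries (fderiv 1 a) x + (h $ 2) *\<^sub>R fseries (fderiv 2 a) x))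
     \<le> (\<Sum>\<^sub>\<infinity>k. freq_norm k ^ 2 * norm (a k)) * (norm h)\<^sup>2" .
qed

lemma continuous_on_fseries: "rapid a \<Longrightarrow> continuous_on S (fseries a)"
  by (rule has_derivative_continuous_on, rule fseries_has_derivative)

lemma fseries_dir_deriv:
  assumes "rapid a"
  shows "has_dir_deriv i (fseries a) (fseries (fderiv i a))"
  unfolding has_dir_deriv_def has_vector_derivative_def
proof
  fix x
  have "((\<lambda>h. x + h *\<^sub>R ax i) has_derivative (\<lambda>h. h *\<^sub>R ax i)) (at 0)"
    by (auto intro!: derivative_eq_intros)
  moreover have "(fseries a has_derivative (\<lambda>h. (h $ 1) *\<^sub>R fseries (fderiv 1 a) x + (h $ 2) *\<^sub>R fseries (fderiv 2 a) x)) (at (x + 0 *\<^sub>R ax i))"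
    using fseries_has_derivative[OF assms] by simp
  ultimately have "((\<lambda>h. fseries a (x + h *\<^sub>R ax i)) has_derivative (\<lambda>h. ((h *\<^sub>R ax i) $ 1) *\<^sub>R fseries (fderiv 1 a) x + ((h *\<^sub>R ax i) $ 2) *\<^sub>R fseries (fderiv 2 a) x)) (at 0)"
    by (rule has_derivative_compose)
  moreover have "(\<lambda>h. ((h *\<^sub>R ax i) $ 1) *\<^sub>R fseries (fderiv 1 a) x + ((h *\<^sub>R ax i) $ 2) *\<^sub>R fseries (fderiv 2 a) x) = (\<lambda>h. h *\<^sub>R fseries (fderiv i a) x)"
    using exhaust_2[of i] by (auto simp: axis_def)
  ultimately show "((\<lambda>h. fseries a (x + h *\<^sub>R ax i)) has_derivative (\<lambda>h. h *\<^sub>R fseries (fderiv i a) x)) (at 0)"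
    by simp
qed

section \<open>Fourier coefficients\<close>

lemma cell_int_add:
  fixes f g :: "plane \<Rightarrow> 'b::euclidean_space"
  shows "continuous_on UNIV f \<Longrightarrow> continuous_on UNIV g \<Longrightarrow> cell_int (\<lambda>x. f x + g x) = cell_int f + cell_int g"
  unfolding cell_int_def by (intro integral_add integrable_on_cell) (auto intro: continuous_on_subset)

lemma cell_int_diff:
  fixes f g :: "plane \<Rightarrow> 'b::euclidean_space"
  shows "continuous_on UNIV f \<Longrightarrow> continuous_on UNIV g \<Longrightarrow> cell_int (\<lambda>x. f x - g x) = cell_int f - cell_int g"
  unfolding cell_int_def by (intro Henstock_Kurzweil_Integration.integral_diff integrable_on_cell) (auto intro: continuous_on_subset)

lemma cell_int_cmult_right: "cell_int (\<lambda>x. c * f x) = c * cell_int f" for c :: complex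
  unfolding cell_int_def by simp

lemma cell_int_cmult_right_real: "cell_int (\<lambda>x. c * f x) = c * cell_int f" for c :: real
  unfolding cell_int_def by simp

lemma cell_int_minus: "cell_int (\<lambda>x. - f x) = - cell_int f"
  unfolding cell_int_def by simp

lemma cell_int_of_real:
  assumes "continuous_on UNIV f"
  shows "cell_int (\<lambda>x. complex_of_real (f x)) = of_real (cell_int f)"
proof -
  have "f integrable_on cell" using assms by (intro integrable_on_cell) (auto intro: continuous_on_subset)
  then show ?thesis unfolding cell_int_def
    by (intro integral_unique has_integral_of_real) (simp add: has_integral_integral)
qed

lemma cell_int_mono:
  fixes f g :: "plane \<Rightarrow> real"
  shows "continuous_on UNIV f \<Longrightarrow> continuous_on UNIV g \<Longrightarrow> (\<And>x. x \<in> cell \<Longrightarrow> f x \<le> g x) \<Longrightarrow> cell_int f \<le> cell_int g"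
  unfolding cell_int_def by (intro integral_le integrable_on_cell) (auto intro: continuous_on_subset)

lemma measure_cell: "measure lborel cell = (2 * pi)\<^sup>2"
proof -
  have "cell \<noteq> {}" using mem_cell[of 0] by auto
  then show ?thesis unfolding cell_def
    by (subst content_cbox_cart) (auto simp: UNIV_2 power2_eq_square)
qed

lemma cell_int_const: "cell_int (\<lambda>x. c) = (2 * pi)\<^sup>2 *\<^sub>R c"
  using has_integral_const[of c "\<chi> i. - pi" "\<chi> i. pi"] measure_cell
  unfolding cell_int_def cell_def by auto

lemma norm_cell_int_le:
  fixes f :: "plane \<Rightarrow> 'b::euclidean_space"
  assumes "continuous_on UNIV f" "\<And>x. x \<in> cell \<Longrightarrow> norm (f x) \<le> B"
  shows "norm (cell_int f) \<le> (2 * pi)\<^sup>2 * B"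
proof -
  have B: "0 \<le> B" using order_trans[OF norm_ge_zero assms(2)[of 0]] by (simp add: mem_cell)
  have "f integrable_on cell" using assms(1) by (intro integrable_on_cell) (auto intro: continuous_on_subset)
  then have "(f has_integral cell_int f) (cbox (\<chi> i. - pi) (\<chi> i. pi))"
    by (simp add: cell_int_def cell_def has_integral_integral)
  from has_integral_bound[OF B this] show ?thesis
    using assms(2) measure_cell by (auto simp: cell_def mult.commute)
qed

lemma has_dir_deriv_character: "has_dir_deriv i (character k) (\<lambda>x. \<i> * of_int (k $ i) * character k x)"
  unfolding has_dir_deriv_def
proof
  fix x
  have "((\<lambda>h. cis (wavevector k \<bullet> x + h * of_int (k $ i))) has_vector_derivative
        (of_int (k $ i) *\<^sub>R (\<i> * cis (wavevector k \<bullet> x + 0 * of_int (k $ i))))) (at 0)"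
    unfolding cis_conv_exp
    by (auto intro!: derivative_eq_intros has_vector_derivative_real_field simp: scaleR_conv_of_real)
  then show "((\<lambda>h. character k (x + h *\<^sub>R ax i)) has_vector_derivative \<i> * of_int (k $ i) * character k x) (at 0)"
    by (simp add: character_def inner_add_right inner_scaleR_right inner_axis scaleR_conv_of_real[where 'a=complex] mult_ac)
qed

lemma has_dir_deriv_mult:
  fixes f g :: "plane \<Rightarrow> 'b::real_normed_algebra"
  assumes "has_dir_deriv i f f'" "has_dir_deriv i g g'"
  shows "has_dir_deriv i (\<lambda>x. f x * g x) (\<lambda>x. f x * g' x + f' x * g x)"
  using assms has_vector_derivative_mult[of "\<lambda>h. f (x + h *\<^sub>R ax i)" _ 0 UNIV "\<lambda>h. g (x + h *\<^sub>R ax i)" for x]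
  unfolding has_dir_deriv_def by fastforce

lemma has_dir_deriv_of_real:
  assumes "has_dir_deriv i f f'"
  shows "has_dir_deriv i (\<lambda>x. complex_of_real (f x)) (\<lambda>x. of_real (f' x))"
  using assms unfolding has_dir_deriv_def
  by (auto intro!: has_vector_derivative_of_real simp: has_real_derivative_iff_has_vector_derivative)

lemma cell_int_character: "cell_int (character k) = (if k = 0 then (2 * pi)\<^sup>2 else 0)"
proof (cases "k = 0")
  case True then show ?thesis
    using cell_int_const[of "1::complex"] by (simp add: scaleR_conv_of_real cell_int_def cong: Henstock_Kurzweil_Integration.integral_cong)
next
  case False
  then obtain i where i: "k $ i \<noteq> 0" by (auto simp: vec_eq_iff)
  have "cell_int (\<lambda>x. \<i> * of_int (k $ i) * character k x) = 0"
    by (rule cell_int_dir_deriv_eq_0[OF has_dir_deriv_character])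
       (auto intro!: continuous_intros simp: periodic_character)
  then show ?thesis using i False by (simp add: cell_int_cmult_right)
qed

text \<open>The Weierstrass M-test along finite sets of frequencies gives uniform convergence, which
  passes to the integrals.\<close>

lemma has_sum_cell_int_fseries:
  fixes g :: "plane \<Rightarrow> complex"
  assumes g: "continuous_on UNIV g" and a: "rapid a"
  shows "((\<lambda>k. a k * cell_int (\<lambda>x. g x * character k x)) has_sum cell_int (\<lambda>x. g x * fseries a x)) UNIV"
proof -
  have "bounded (g ` cell)"
    using g by (intro compact_imp_bounded compact_continuous_image) (auto intro: continuous_on_subset)
  then obtain B where B: "\<And>x. x \<in> cell \<Longrightarrow> norm (g x) \<le> B" by (auto simp: bounded_iff)
  have "uniform_limit (cbox (\<chi> i. - pi) (\<chi> i. pi)) (\<lambda>X x. \<Sum>k\<in>X. g x * (a k * character k x))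
     (\<lambda>x. \<Sum>\<^sub>\<infinity>k. g x * (a k * character k x)) (finite_subsets_at_top UNIV)"
  proof (rule Weierstrass_m_test_general)
    show "norm (g x * (a k * character k x)) \<le> B * norm (a k)" if "x \<in> cbox (\<chi> i. - pi) (\<chi> i. pi)" for k x
      using B[of x] that by (auto simp: norm_mult cell_def intro!: mult_right_mono)
    show "(\<lambda>k. B * norm (a k)) summable_on UNIV"
      by (intro summable_on_cmult_right rapid_abs_summable a)
  qed
  then obtain I J where IJ: "\<And>X. ((\<lambda>x. \<Sum>k\<in>X. g x * (a k * character k x)) has_integral I X) (cbox (\<chi> i. - pi) (\<chi> i. pi))"
    "((\<lambda>x. \<Sum>\<^sub>\<infinity>k. g x * (a k * character k x)) has_integral J) (cbox (\<chi> i. - pi) (\<chi> i. pi))"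
    "(I \<longlongrightarrow> J) (finite_subsets_at_top UNIV)"
    by (rule uniform_limit_integral_cbox)
       (auto intro!: continuous_intros continuous_on_subset[OF g])
  have "I X = (\<Sum>k\<in>X. a k * cell_int (\<lambda>x. g x * character k x))" for X
  proof -
    have "I X = integral cell (\<lambda>x. \<Sum>k\<in>X. g x * (a k * character k x))"
      using IJ(1)[of X] by (simp add: cell_def integral_unique)
    also have "\<dots> = (\<Sum>k\<in>X. integral cell (\<lambda>x. g x * (a k * character k x)))"
    proof (cases "finite X")
      case True then show ?thesis
        by (intro integral_sum integrable_on_cell) (auto intro!: continuous_intros continuous_on_subset[OF g])
    qed simp
    also have "\<dots> = (\<Sum>k\<in>X. a k * cell_int (\<lambda>x. g x * character k x))"
      unfolding cell_int_cmult_right[symmetric] by (simp add: cell_int_def mult_ac)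
    finally show ?thesis .
  qed
  then have "((\<lambda>X. \<Sum>k\<in>X. a k * cell_int (\<lambda>x. g x * character k x)) \<longlongrightarrow> J) (finite_subsets_at_top UNIV)"
    using IJ(3) by presburger
  moreover have "J = cell_int (\<lambda>x. g x * fseries a x)"
    using IJ(2) by (simp add: cell_int_def cell_def integral_unique fseries_def infsum_cmult_right')
  ultimately show ?thesis by (simp add: has_sum_def)
qed

definition fcoeff :: "(plane \<Rightarrow> complex) \<Rightarrow> int^2 \<Rightarrow> complex" where
  "fcoeff g k = cell_int (\<lambda>x. g x * character (- k) x) / (2 * pi)\<^sup>2"

lemma fourier_coeff_eq_fcoeff:
  assumes "continuous_on UNIV f"
  shows "fourier_coeff f k = fcoeff (\<lambda>x. of_real (f x)) k"
  unfolding fourier_coeff_def fcoeff_def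
  by (subst LINT_torus_eq_cell_int)
     (auto simp: character_def intro!: continuous_intros assms)

lemma fcoeff_fseries:
  assumes "rapid a" shows "fcoeff (fseries a) k = a k"
proof -
  have "((\<lambda>l. a l * cell_int (\<lambda>x. character (- k) x * character l x)) has_sum cell_int (\<lambda>x. character (- k) x * fseries a x)) UNIV"
    by (intro has_sum_cell_int_fseries continuous_intros assms)
  moreover have "a l * cell_int (\<lambda>x. character (- k) x * character l x) = (if l = k then (2 * pi)\<^sup>2 * a k else 0)" for l
    by (simp add: character_mult cell_int_character)
  ultimately have "((\<lambda>l. if l = k then (2 * pi)\<^sup>2 * a k else 0) has_sum cell_int (\<lambda>x. character (- k) x * fseries a x)) UNIV"
    by simp
  moreover have "((\<lambda>l. if l = k then (2 * pi)\<^sup>2 * a k else 0) has_sum (2 * pi)\<^sup>2 * a k) UNIV"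
    by (rule has_sum_finite_neutralI[of "{k}"]) auto
  ultimately have "cell_int (\<lambda>x. character (- k) x * fseries a x) = (2 * pi)\<^sup>2 * a k"
    by (rule has_sum_unique)
  then show ?thesis by (simp add: fcoeff_def mult.commute)
qed

lemma fcoeff_dir_deriv:
  assumes d: "has_dir_deriv i f g" and f: "continuous_on UNIV f" and g: "continuous_on UNIV g"
    and p: "\<And>x. f (x + (2 * pi) *\<^sub>R ax i) = f x"
  shows "fcoeff g k = \<i> * of_int (k $ i) * fcoeff f k"
proof -
  have "cell_int (\<lambda>x. f x * (\<i> * of_int ((- k) $ i) * character (- k) x) + g x * character (- k) x) = 0"
    by (rule cell_int_dir_deriv_eq_0[OF has_dir_deriv_mult[OF d has_dir_deriv_character]])
       (auto intro!: continuous_intros f g simp: periodic_character p)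
  then have "cell_int (\<lambda>x. (\<i> * of_int ((- k) $ i)) * (f x * character (- k) x)) + cell_int (\<lambda>x. g x * character (- k) x) = 0"
    by (subst (asm) cell_int_add) (auto intro!: continuous_intros f g simp: mult_ac)
  then show ?thesis unfolding cell_int_cmult_right
    by (simp add: fcoeff_def add_eq_0_iff)
qed

lemma norm_fcoeff_le:
  assumes "continuous_on UNIV f" "\<And>x. x \<in> cell \<Longrightarrow> norm (f x) \<le> B"
  shows "norm (fcoeff f k) \<le> B"
proof -
  have "norm (cell_int (\<lambda>x. f x * character (- k) x)) \<le> (2 * pi)\<^sup>2 * B"
    by (rule norm_cell_int_le) (auto intro!: continuous_intros assms simp: norm_mult)
  then show ?thesis by (simp add: fcoeff_def norm_divide norm_power field_simps)
qed

section \<open>Uniqueness of Fourier coefficients\<close>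

text \<open>\<open>1 + cos\<close> is a combination of three characters, so the product with
  \<open>g\<close> is again orthogonal to every character; iteration reaches the powers of a peaked
  kernel.\<close>

lemma cell_int_char_mult_cos:
  assumes g: "continuous_on UNIV g" and z: "\<And>k. cell_int (\<lambda>x. of_real (g x) * character k x) = 0"
  shows "cell_int (\<lambda>x. of_real (g x * (1 + cos (x $ i - b))) * character k x) = 0"
proof -
  have e: "complex_of_real (1 + cos (x $ i - b)) =
      1 + cis (- b) / 2 * character (axis i 1) x + cis b / 2 * character (- axis i 1) x" for x :: plane
  proof -
    have w: "wavevector (axis i 1) \<bullet> x = x $ i"
      by (simp add: wavevector_def inner_2 axis_def) (use exhaust_2[of i] in auto)
    show ?thesis
      unfolding character_def wavevector_simps inner_minus_left w
      by (simp add: complex_eq_iff cis_mult cos_add cos_diff sin_diff sin_add algebra_simps flip: add_divide_distrib)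
  qed
  have "cell_int (\<lambda>x. of_real (g x * (1 + cos (x $ i - b))) * character k x)
    = cell_int (\<lambda>x. of_real (g x) * character k x + (cis (- b) / 2 * (of_real (g x) * character (axis i 1 + k) x)
         + cis b / 2 * (of_real (g x) * character (- axis i 1 + k) x)))"
    unfolding of_real_mult e character_mult[symmetric] by (simp add: algebra_simps)
  also have "\<dots> = 0"
    by (subst cell_int_add, (intro continuous_intros g)+)+ (simp only: cell_int_cmult_right z, simp)
  finally show ?thesis .
qed

lemma cell_int_char_mult_cos_power:
  assumes g: "continuous_on UNIV g" and z: "\<And>k. cell_int (\<lambda>x. of_real (g x) * character k x) = 0"
  shows "cell_int (\<lambda>x. of_real (g x * (1 + cos (x $ i - b)) ^ n) * character k x) = 0"
proof (induction n arbitrary: k)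
  case 0 then show ?case using z by simp
next
  case (Suc n)
  have "cell_int (\<lambda>x. of_real ((g x * (1 + cos (x $ i - b)) ^ n) * (1 + cos (x $ i - b))) * character k x) = 0"
    by (rule cell_int_char_mult_cos) (intro continuous_intros g Suc.IH)+
  then show ?case by (simp add: mult_ac)
qed

text \<open>Classical peak-function argument. If \<open>h x0\<close> were positive, integrate
  \<open>h\<close> against the powers of \<open>p\<close>, a trigonometric polynomial that on the
  cell equals 1 at \<open>x0\<close> and is smaller elsewhere. All these integrals vanish, yet the
  part near \<open>x0\<close> eventually dominates the rest. The point is taken interior because a
  boundary point has a second copy in the closed cell, where \<open>p\<close> would be 1 as
  well.\<close>

lemma le_0_of_orthogonal:
  fixes h :: "plane \<Rightarrow> real"
  assumes h: "continuous_on UNIV h" and z: "\<And>k. cell_int (\<lambda>x. of_real (h x) * character k x) = 0"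
    and x0: "x0 \<in> box (\<chi> i. - pi) (\<chi> i. pi)"
  shows "h x0 \<le> 0"
proof (rule ccontr)
  assume neg: "\<not> h x0 \<le> 0"
  define c where "c = h x0 / 2"
  have c: "c > 0" "h x0 > c" using neg by (auto simp: c_def)
  define p where "p x = (1 + cos (x $ 1 - x0 $ 1)) * (1 + cos (x $ 2 - x0 $ 2)) / 4" for x :: plane
  have p_cont: "continuous_on S p" for S unfolding p_def by (intro continuous_intros) auto
  have cos01: "1 + cos t \<le> 2" "0 \<le> 1 + cos t" for t :: real
    using cos_le_one[of t] cos_ge_minus_one[of t] by linarith+
  have p0: "0 \<le> p x" for x unfolding p_def
    by (intro divide_nonneg_nonneg mult_nonneg_nonneg cos01) auto
  have p_lt: "p x < 1" if x: "x \<in> cell" "x \<noteq> x0" for x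
  proof -
    obtain i where i: "x $ i \<noteq> x0 $ i" using x by (auto simp: vec_eq_iff)
    have "\<bar>x $ i - x0 $ i\<bar> < 2 * pi"
      using x0 x(1) by (auto simp: mem_box_cart mem_cell abs_less_iff) (smt (verit))+
    have "cos (x $ i - x0 $ i) \<noteq> 1"
    proof
      assume "cos (x $ i - x0 $ i) = 1"
      then obtain m :: int where m: "x $ i - x0 $ i = m * 2 * pi" by (auto simp: cos_one_2pi_int)
      with \<open>\<bar>x $ i - x0 $ i\<bar> < 2 * pi\<close> have "\<bar>real_of_int m\<bar> < 1" by (simp add: abs_mult)
      then have "m = 0" by linarith
      with m i show False by simp
    qed
    then have *: "1 + cos (x $ i - x0 $ i) < 2" using cos_le_one[of "x $ i - x0 $ i"] by linarith
    have "p x \<le> (1 + cos (x $ i - x0 $ i)) * 2 / 4"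
      using exhaust_2[of i] mult_left_mono[OF cos01(1) cos01(2), of "x $ 2 - x0 $ 2" "x $ 1 - x0 $ 1"]
        mult_left_mono[OF cos01(1) cos01(2), of "x $ 1 - x0 $ 1" "x $ 2 - x0 $ 2"]
      by (auto simp: p_def mult.commute)
    with * show ?thesis by simp
  qed
  \<comment> \<open>Off \<open>K\<close> the integrand is non-negative; on \<open>K\<close>, by
    compactness, \<open>p\<close> stays below some \<open>\<rho>0\<close> less than 1. A level
    \<open>\<rho>1\<close> between \<open>\<rho>0\<close> and 1 is exceeded by \<open>p\<close> near
    \<open>x0\<close>, and the ratio of the two levels to the power n tends to 0.\<close>
  define K where "K = {x\<in>cell. h x \<le> c}"
  have "compact K"
    unfolding K_def
    using compact_Int_closed[OF compact_cell closed_Collect_le[OF h continuous_on_const[of UNIV c]]]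
    by (simp add: Int_def)
  obtain \<rho>0 where \<rho>0: "0 \<le> \<rho>0" "\<rho>0 < 1" "\<And>x. x \<in> K \<Longrightarrow> p x \<le> \<rho>0"
  proof (cases "K = {}")
    case True then show ?thesis using that[of 0] by auto
  next
    case False
    obtain x where x: "x \<in> K" "\<And>y. y \<in> K \<Longrightarrow> p y \<le> p x"
      using continuous_attains_sup[OF \<open>compact K\<close> False p_cont] by auto
    have "p x < 1" using x(1) c by (intro p_lt) (auto simp: K_def)
    then show ?thesis using that[of "p x"] x p0 by auto
  qed
  define \<rho>1 where "\<rho>1 = (1 + \<rho>0) / 2"
  have \<rho>1: "\<rho>0 < \<rho>1" "\<rho>1 < 1" "0 < \<rho>1" using \<rho>0 by (auto simp: \<rho>1_def)
  define U where "U = box (\<chi> i. - pi) (\<chi> i. pi) \<inter> ({x. c < h x} \<inter> {x. \<rho>1 < p x})"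
  have "open U" unfolding U_def
    by (intro open_Int open_box open_Collect_less h p_cont continuous_intros)
  moreover have "x0 \<in> U" using x0 c \<rho>1 by (simp add: U_def p_def)
  ultimately obtain \<delta> where \<delta>: "\<delta> > 0" "ball x0 \<delta> \<subseteq> U" by (auto simp: open_contains_ball)
  define B where "B = cbox (x0 - (\<chi> i. \<delta> / 3)) (x0 + (\<chi> i. \<delta> / 3))"
  have BU: "B \<subseteq> U"
  proof
    fix y assume "y \<in> B"
    then have "x0 $ i \<le> y $ i + \<delta> / 3 \<and> y $ i \<le> x0 $ i + \<delta> / 3" for i
      by (simp add: B_def mem_box_cart algebra_simps)
    from this have y: "\<bar>(x0 - y) $ i\<bar> \<le> \<delta> / 3" for i
      using abs_le_iff[of "x0 $ i - y $ i" "\<delta> / 3"] by (smt (verit) vector_minus_component)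
    have "norm (x0 - y) \<le> (\<Sum>i\<in>UNIV. \<bar>(x0 - y) $ i\<bar>)" by (rule norm_le_l1_cart)
    also have "\<dots> \<le> \<delta> / 3 + \<delta> / 3" unfolding UNIV_2 using y[of 1] y[of 2] by simp
    also have "\<dots> < \<delta>" using \<delta> by simp
    finally show "y \<in> U" using \<delta>(2) by (auto simp: dist_norm)
  qed
  have Bcell: "B \<subseteq> cell" using BU interior_cell_subset_torus torus_subset_cell by (auto simp: U_def)
  have Bpos: "0 < measure lborel B"
    unfolding B_def by (rule content_pos_lt) (use \<delta> in \<open>auto simp: Basis_vec_def inner_axis\<close>)
  have "bounded (h ` cell)"
    using h by (intro compact_imp_bounded compact_continuous_image) (auto intro: continuous_on_subset)
  then obtain M where M: "\<And>x. x \<in> cell \<Longrightarrow> \<bar>h x\<bar> \<le> M" by (auto simp: bounded_iff)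
  have M0: "0 \<le> M" using M[of 0] by (auto simp: mem_cell)
  have key: "c * \<rho>1 ^ n * measure lborel B \<le> M * \<rho>0 ^ n * (2 * pi)\<^sup>2" for n
  proof -
    have "cell_int (\<lambda>x. of_real ((h x * (1 + cos (x $ 1 - x0 $ 1)) ^ n) * (1 + cos (x $ 2 - x0 $ 2)) ^ n) * character 0 x) = 0"
      by (intro cell_int_char_mult_cos_power continuous_intros h z)
    then have "cell_int (\<lambda>x. complex_of_real (4 ^ n * (h x * p x ^ n))) = 0"
      by (simp add: p_def power_divide power_mult_distrib mult_ac)
    then have 0: "cell_int (\<lambda>x. h x * p x ^ n) = 0"
      by (subst (asm) cell_int_of_real) (auto simp: cell_int_cmult_right_real intro!: continuous_intros h p_cont)
    have i1: "((\<lambda>x. (if x \<in> B then c * \<rho>1 ^ n else 0) - M * \<rho>0 ^ n) has_integral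
        (measure lborel B *\<^sub>R (c * \<rho>1 ^ n) - (2 * pi)\<^sup>2 *\<^sub>R (M * \<rho>0 ^ n))) cell"
    proof (rule Henstock_Kurzweil_Integration.has_integral_diff)
      show "((\<lambda>x. if x \<in> B then c * \<rho>1 ^ n else 0) has_integral measure lborel B *\<^sub>R (c * \<rho>1 ^ n)) cell"
        unfolding has_integral_restrict[OF Bcell] unfolding B_def by (rule has_integral_const)
      show "((\<lambda>x. M * \<rho>0 ^ n) has_integral (2 * pi)\<^sup>2 *\<^sub>R (M * \<rho>0 ^ n)) cell"
        unfolding measure_cell[symmetric] unfolding cell_def by (rule has_integral_const)
    qed
    have i2: "((\<lambda>x. h x * p x ^ n) has_integral 0) cell"
    proof -
      have "(\<lambda>x. h x * p x ^ n) integrable_on cell"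
        by (intro integrable_on_cell continuous_intros p_cont continuous_on_subset[OF h]) auto
      then show ?thesis using 0 by (simp add: cell_int_def has_integral_iff)
    qed
    have "measure lborel B *\<^sub>R (c * \<rho>1 ^ n) - (2 * pi)\<^sup>2 *\<^sub>R (M * \<rho>0 ^ n) \<le> 0"
    proof (rule has_integral_le[OF i1 i2])
      fix x assume x: "x \<in> cell"
      show "(if x \<in> B then c * \<rho>1 ^ n else 0) - M * \<rho>0 ^ n \<le> h x * p x ^ n"
      proof (cases "x \<in> K")
        case True
        then have "x \<notin> B" using BU by (auto simp: K_def U_def)
        have "\<bar>h x * p x ^ n\<bar> \<le> M * \<rho>0 ^ n"
          unfolding abs_mult using M[OF x] \<rho>0(3)[OF True] p0[of x] M0
          by (intro mult_mono) (auto intro: power_mono)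
        then show ?thesis using \<open>x \<notin> B\<close> by simp
      next
        case False
        then have hx: "c < h x" using x by (auto simp: K_def)
        have "(if x \<in> B then c * \<rho>1 ^ n else 0) \<le> h x * p x ^ n"
          using hx c p0[of x] \<rho>1 BU by (auto simp: U_def intro!: mult_mono power_mono)
        moreover have "0 \<le> M * \<rho>0 ^ n" using M0 \<rho>0 by simp
        ultimately show ?thesis by linarith
      qed
    qed
    then show ?thesis by (simp add: mult_ac)
  qed
  define r where "r = \<rho>0 / \<rho>1"
  have r: "0 \<le> r" "r < 1" using \<rho>0 \<rho>1 by (auto simp: r_def)
  have "c * measure lborel B \<le> M * (2 * pi)\<^sup>2 * r ^ n" for n
    using key[of n] \<rho>1 by (simp add: r_def power_divide field_simps)
  moreover have "(\<lambda>n. M * (2 * pi)\<^sup>2 * r ^ n) \<longlonglongrightarrow> M * (2 * pi)\<^sup>2 * 0"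
    using r by (intro tendsto_intros LIMSEQ_realpow_zero)
  ultimately have "c * measure lborel B \<le> M * (2 * pi)\<^sup>2 * 0"
    by (intro LIMSEQ_le_const) auto
  then show False using c Bpos by (simp add: mult_le_0_iff)
qed

section \<open>Reduction of periodic functions to the cell, and Fourier inversion\<close>

definition torus_rep :: "plane \<Rightarrow> plane" where
  "torus_rep x = (\<chi> i. x $ i - 2 * pi * of_int \<lfloor>(x $ i + pi) / (2 * pi)\<rfloor>)"

lemma torus_rep_in_torus: "torus_rep x \<in> torus"
proof -
  have "- pi \<le> x $ i - 2 * pi * of_int \<lfloor>(x $ i + pi) / (2 * pi)\<rfloor>" for i
    using mult_left_mono[OF of_int_floor_le[of "(x $ i + pi) / (2 * pi)"], of "2 * pi"] pi_gt_zero by simp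
  moreover have "x $ i - 2 * pi * of_int \<lfloor>(x $ i + pi) / (2 * pi)\<rfloor> < pi" for i
    using floor_correct[of "(x $ i + pi) / (2 * pi)"] pi_gt_zero by (simp add: field_simps)
  ultimately show ?thesis by (simp add: torus_def torus_rep_def)
qed

lemma periodic_of_nat: "periodic f \<Longrightarrow> f (x + (2 * pi * real n) *\<^sub>R ax i) = f x"
proof (induction n)
  case (Suc n)
  have "f (x + (2 * pi * real (Suc n)) *\<^sub>R ax i) = f (x + (2 * pi * real n) *\<^sub>R ax i + (2 * pi) *\<^sub>R ax i)"
    by (simp add: algebra_simps)
  then show ?case using Suc by (simp add: periodic_def)
qed simp

lemma periodic_of_int: 
  assumes "periodic f" shows "f (x + (2 * pi * of_int m) *\<^sub>R ax i) = f x"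
proof (cases m rule: int_cases2)
  case (nonneg n) then show ?thesis using periodic_of_nat[OF assms] by simp
next
  case (nonpos n) then show ?thesis using periodic_of_nat[OF assms, of "x + (2 * pi * of_int m) *\<^sub>R ax i" n i]
    by (simp add: algebra_simps)
qed

lemma periodic_torus_rep: 
  assumes "periodic f" shows "f (torus_rep x) = f x"
proof -
  define m where "m i = \<lfloor>(x $ i + pi) / (2 * pi)\<rfloor>" for i
  have "x = torus_rep x + (2 * pi * of_int (m 1)) *\<^sub>R ax 1 + (2 * pi * of_int (m 2)) *\<^sub>R ax 2"
    by (simp add: vec_eq_iff forall_2 torus_rep_def m_def axis_def)
  then have "f x = f (torus_rep x + (2 * pi * of_int (m 1)) *\<^sub>R ax 1 + (2 * pi * of_int (m 2)) *\<^sub>R ax 2)" by simp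
  then show ?thesis by (simp only: periodic_of_int[OF assms])
qed

lemma periodic_fseries: "periodic (fseries a)"
  by (simp add: periodic_def fseries_periodic)

text \<open>\<open>le_0_of_orthogonal\<close> for \<open>h\<close> and for its negative settles the
  open square; closure and periodicity do the rest.\<close>

lemma eq_0_of_orthogonal:
  fixes h :: "plane \<Rightarrow> real"
  assumes h: "continuous_on UNIV h" "periodic h" and z: "\<And>k. cell_int (\<lambda>x. of_real (h x) * character k x) = 0"
  shows "h x = 0"
proof -
  let ?B = "box (\<chi> i. - pi) (\<chi> i. pi) :: plane set"
  have "cell_int (\<lambda>x. of_real (- h x) * character k x) = 0" for k
    using z[of k] by (simp add: cell_int_minus)
  then have "- h y \<le> 0" if "y \<in> ?B" for y
    using that h by (intro le_0_of_orthogonal[of "\<lambda>x. - h x"]) (auto intro: continuous_intros)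
  moreover have "h y \<le> 0" if "y \<in> ?B" for y
    using that h z by (intro le_0_of_orthogonal[of h]) auto
  ultimately have "?B \<subseteq> {y. h y = 0}" by force
  moreover have "closed {y. h y = 0}"
    by (intro closed_Collect_eq h continuous_intros)
  ultimately have "closure ?B \<subseteq> {y. h y = 0}" by (rule closure_minimal)
  moreover have "closure ?B = cell"
    unfolding cell_def by (rule closure_box) (use pi_gt_zero in \<open>simp add: box_ne_empty Basis_vec_def inner_axis\<close>)
  ultimately show ?thesis
    using torus_rep_in_torus[of x] torus_subset_cell periodic_torus_rep[OF h(2), of x] by auto
qed

theorem fourier_inversion:
  fixes g :: "plane \<Rightarrow> complex"
  assumes g: "continuous_on UNIV g" "periodic g" and a: "rapid (fcoeff g)"
  shows "g x = fseries (fcoeff g) x"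
proof -
  define H where "H x = g x - fseries (fcoeff g) x" for x
  have Hc: "continuous_on UNIV H" unfolding H_def by (intro continuous_intros g continuous_on_fseries a)
  have Hp: "periodic H" using g(2) by (simp add: H_def periodic_def fseries_periodic)
  have H0: "cell_int (\<lambda>x. H x * character k x) = 0" for k
  proof -
    have "cell_int (\<lambda>x. H x * character k x) = cell_int (\<lambda>x. g x * character k x) - cell_int (\<lambda>x. fseries (fcoeff g) x * character k x)"
      unfolding H_def left_diff_distrib
      by (intro cell_int_diff continuous_intros g continuous_on_fseries a)
    moreover have "cell_int (\<lambda>x. f x * character k x) = (2 * pi)\<^sup>2 * fcoeff f (- k)" for f
      by (simp add: fcoeff_def)
    ultimately show ?thesis by (simp add: fcoeff_fseries a)
  qed
  \<comment> \<open>Orthogonality to all characters is symmetric under a change of sign of k, so it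
    passes to the conjugate and hence to real and imaginary parts, for which
    \<open>eq_0_of_orthogonal\<close> is stated.\<close>
  have H1: "cell_int (\<lambda>x. cnj (H x) * character k x) = 0" for k
    using arg_cong[OF H0[of "- k"], of cnj] 
    unfolding cell_int_def integral_cnj by (simp add: cnj_character)
  have c: "continuous_on UNIV (\<lambda>x. cnj (H x))" by (intro continuous_intros Hc)
  have re: "cell_int (\<lambda>x. of_real (Re (H x)) * character k x) = 0" for k
  proof -
    have "(\<lambda>x. of_real (Re (H x)) * character k x) = (\<lambda>x. 1 / 2 * (H x * character k x + cnj (H x) * character k x))"
      by (simp add: complex_add_cnj flip: distrib_right)
    then show ?thesis 
      by (simp only: cell_int_cmult_right) (subst cell_int_add; simp add: H0 H1 continuous_intros Hc c)
  qed
  have im: "cell_int (\<lambda>x. of_real (Im (H x)) * character k x) = 0" for k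
  proof -
    have "(\<lambda>x. of_real (Im (H x)) * character k x) = (\<lambda>x. - \<i> / 2 * (H x * character k x - cnj (H x) * character k x))"
      by (simp add: fun_eq_iff complex_diff_cnj mult_ac flip: left_diff_distrib)
    then show ?thesis 
      by (simp only: cell_int_cmult_right) (subst cell_int_diff; simp add: H0 H1 continuous_intros Hc c)
  qed
  have "Re (H x) = 0" using Hp by (intro eq_0_of_orthogonal[of "\<lambda>x. Re (H x)"] re continuous_intros Hc) (simp add: periodic_def)
  moreover have "Im (H x) = 0" using Hp by (intro eq_0_of_orthogonal[of "\<lambda>x. Im (H x)"] im continuous_intros Hc) (simp add: periodic_def)
  ultimately have "H x = 0" by (simp add: complex_eq_iff)
  then show ?thesis by (simp add: H_def)
qed

section \<open>Minimum principles\<close>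

text \<open>Perturb by \<open>e * t\<close> and take a minimum over space-time: there the time
  derivative would be positive, so the perturbed function was smaller just before. The hypothesis
  \<open>step\<close> concerns only spatial minima of negative value; there the heat equation offers
  the second derivative test, a transport equation a known gradient, and boundary points can be
  excluded.\<close>

lemma minimum_principle:
  fixes F :: "real \<Rightarrow> 'a::metric_space \<Rightarrow> real"
  assumes K: "compact K" and F: "continuous_on ({0..T} \<times> K) (\<lambda>(t, x). F t x)"
    and init: "\<And>x. x \<in> K \<Longrightarrow> 0 \<le> F 0 x"
    and step: "\<And>t x. \<lbrakk>0 < t; t \<le> T; x \<in> K; F t x < 0; \<And>y. y \<in> K \<Longrightarrow> F t x \<le> F t y\<rbrakk> \<Longrightarrow>
        \<exists>d\<ge>0. ((\<lambda>s. F s x) has_real_derivative d) (at t within {0..T})"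
    and t: "t \<in> {0..T}" and x: "x \<in> K"
  shows "0 \<le> F t x"
proof (rule ccontr)
  assume neg: "\<not> 0 \<le> F t x"
  \<comment> \<open>Small enough that \<open>F + e * t\<close> is still negative at the given point,
    so that its minimum is negative and lies at a positive time.\<close>
  define e where "e = - F t x / (2 * (T + 1))"
  have e: "e > 0" using neg t by (auto simp: e_def divide_neg_pos)
  define G where "G = (\<lambda>(t, x). F t x + e * t)"
  have "continuous_on ({0..T} \<times> K) G"
    using continuous_on_add[OF F, of "\<lambda>p. e * fst p"] by (simp add: G_def case_prod_unfold continuous_intros)
  moreover have "compact ({0..T} \<times> K)" "{0..T} \<times> K \<noteq> {}"
    using K t x by (auto intro: compact_Times)
  ultimately obtain p where p: "p \<in> {0..T} \<times> K" "\<And>q. q \<in> {0..T} \<times> K \<Longrightarrow> G p \<le> G q"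
    using continuous_attains_inf by metis
  obtain t1 x1 where tx: "p = (t1, x1)" by (cases p)
  have "e * t \<le> e * T" using e t by auto
  also have "\<dots> < e * (2 * (T + 1))" using e t by (intro mult_strict_left_mono) auto
  also have "\<dots> = - F t x" using t by (simp add: e_def)
  finally have "G (t, x) < 0" by (simp add: G_def)
  then have Gp: "F t1 x1 + e * t1 < 0" using p(2)[of "(t, x)"] t x tx by (auto simp: G_def)
  have t1: "0 < t1" "t1 \<le> T" and x1: "x1 \<in> K"
    using p(1) tx Gp init[of x1] by (auto simp: less_eq_real_def)
  have "e * t1 \<ge> 0" using e t1 by simp
  then have "F t1 x1 < 0" using Gp by linarith
  moreover have "F t1 x1 \<le> F t1 y" if "y \<in> K" for y
    using p(2)[of "(t1, y)"] that t1 tx by (auto simp: G_def)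
  ultimately obtain d where d: "d \<ge> 0" "((\<lambda>s. F s x1) has_real_derivative d) (at t1 within {0..T})"
    using step[OF t1 x1] by blast
  have "((\<lambda>s. F s x1 + e * s) has_real_derivative d + e) (at t1 within {0..T})"
    using d(2) by (auto intro!: derivative_eq_intros)
  moreover have "0 < d + e" using d e by simp
  ultimately have "\<exists>\<delta>>0. \<forall>h>0. t1 - h \<in> {0..T} \<longrightarrow> h < \<delta> \<longrightarrow> F (t1 - h) x1 + e * (t1 - h) < F t1 x1 + e * t1"
    by (rule has_real_derivative_pos_inc_left)
  then obtain \<delta> where \<delta>: "\<delta> > 0" "\<And>h. 0 < h \<Longrightarrow> t1 - h \<in> {0..T} \<Longrightarrow> h < \<delta> \<Longrightarrow> F (t1 - h) x1 + e * (t1 - h) < F t1 x1 + e * t1"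
    by blast
  define h where "h = min (\<delta> / 2) t1"
  have "F (t1 - h) x1 + e * (t1 - h) < F t1 x1 + e * t1"
    using \<delta> t1 by (intro \<delta>(2)) (auto simp: h_def)
  moreover have "G p \<le> G (t1 - h, x1)" using \<delta> t1 x1 by (intro p(2)) (auto simp: h_def)
  ultimately show False by (simp add: tx G_def)
qed

lemma second_derivative_nonneg_at_local_min:
  fixes f :: "real \<Rightarrow> real"
  assumes f: "\<And>x. (f has_real_derivative f' x) (at x)" and f': "(f' has_real_derivative c) (at 0)"
    and e: "e > 0" "\<And>x. \<bar>x\<bar> < e \<Longrightarrow> f 0 \<le> f x"
  shows "0 \<le> c"
proof (rule ccontr)
  assume "\<not> 0 \<le> c"
  have f0: "f' 0 = 0" by (rule DERIV_local_min[OF f e(1)]) (use e(2) in auto)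
  obtain d where d: "d > 0" "\<And>h. 0 < h \<Longrightarrow> h < d \<Longrightarrow> f' 0 > f' (0 + h)"
    using has_real_derivative_neg_dec_right[OF f'] \<open>\<not> 0 \<le> c\<close> by auto
  define h where "h = min d e / 2"
  have h: "0 < h" "h < d" "h < e" using d e by (auto simp: h_def)
  obtain z where z: "0 < z" "z < h" "f h - f 0 = (h - 0) * f' z"
    using MVT2[OF h(1), of f f'] f by auto
  have "f' z < 0" using d(2)[of z] z h f0 by auto
  then have "h * f' z < 0" using h by (simp add: mult_pos_neg)
  then have "f h < f 0" using z by simp
  then show False using e(2)[of h] h by auto
qed

lemma continuous_on_infsum:
  fixes f :: "'i \<Rightarrow> 'a::topological_space \<Rightarrow> 'b::banach"
  assumes "\<And>k. continuous_on S (f k)" "\<And>k z. z \<in> S \<Longrightarrow> norm (f k z) \<le> M k" "M summable_on UNIV"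
  shows "continuous_on S (\<lambda>z. \<Sum>\<^sub>\<infinity>k. f k z)"
proof (rule uniform_limit_theorem)
  show "uniform_limit S (\<lambda>X z. \<Sum>k\<in>X. f k z) (\<lambda>z. \<Sum>\<^sub>\<infinity>k. f k z) (finite_subsets_at_top UNIV)"
    using assms by (intro Weierstrass_m_test_general) auto
  show "\<forall>\<^sub>F X in finite_subsets_at_top UNIV. continuous_on S (\<lambda>z. \<Sum>k\<in>X. f k z)"
    by (intro always_eventually allI continuous_on_sum assms)
qed auto

section \<open>The periodic heat semigroup\<close>

definition heat :: "real \<Rightarrow> (int^2 \<Rightarrow> complex) \<Rightarrow> int^2 \<Rightarrow> complex" where
  "heat \<tau> a k = of_real (exp (- \<tau> * (freq_norm k)\<^sup>2)) * a k"

lemma norm_heat_le: "0 \<le> \<tau> \<Longrightarrow> norm (heat \<tau> a k) \<le> norm (a k)"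
  by (simp add: heat_def norm_mult mult_left_le_one_le)

lemma rapid_heat: "rapid a \<Longrightarrow> 0 \<le> \<tau> \<Longrightarrow> rapid (heat \<tau> a)"
  by (rule rapid_norm_le) (auto intro: norm_heat_le)

lemma heat_0 [simp]: "heat 0 a = a"
  by (simp add: heat_def fun_eq_iff)

lemma fderiv_heat: "fderiv i (heat \<tau> a) = heat \<tau> (fderiv i a)"
  by (simp add: fderiv_def heat_def fun_eq_iff mult_ac)

text \<open>Taylor remainder of exp(-x) for x \<ge> 0: convexity bounds it below and, together with
  the Lipschitz bound, above. It is the termwise error in the time derivative of the heat
  flow.\<close>

lemma exp_neg_diff_le:
  fixes a b :: real
  assumes "0 \<le> a" "0 \<le> b"
  shows "\<bar>exp (- b) - exp (- a) + (b - a) * exp (- a)\<bar> \<le> (b - a)\<^sup>2"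
proof -
  have lip: "\<bar>exp (- x) - exp (- y)\<bar> \<le> \<bar>x - y\<bar>" if "0 \<le> x" "x \<le> y" for x y :: real
  proof -
    have "exp (- x) - exp (- y) = exp (- x) * (1 - exp (- (y - x)))"
      by (simp add: algebra_simps flip: exp_add)
    also have "\<dots> \<le> 1 * (y - x)"
      using that exp_ge_add_one_self[of "- (y - x)"] by (intro mult_mono) (simp_all add: algebra_simps)
    finally show ?thesis using that by simp
  qed
  have "exp (- b) = exp (- a) * exp (- (b - a))" by (simp flip: exp_add)
  also have "\<dots> \<ge> exp (- a) * (1 + - (b - a))" by (intro mult_left_mono exp_ge_add_one_self) auto
  finally have 1: "exp (- b) - exp (- a) + (b - a) * exp (- a) \<ge> 0" by (simp add: algebra_simps)
  have "exp (- a) = exp (- b) * exp (b - a)" by (simp flip: exp_add)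
  also have "\<dots> \<ge> exp (- b) * (1 + (b - a))" by (intro mult_left_mono exp_ge_add_one_self) auto
  finally have "exp (- b) - exp (- a) + (b - a) * exp (- a) \<le> (b - a) * (exp (- a) - exp (- b))"
    by (simp add: algebra_simps)
  also have "\<dots> \<le> \<bar>b - a\<bar> * \<bar>exp (- a) - exp (- b)\<bar>" by (metis abs_ge_self abs_mult)
  also have "\<bar>exp (- a) - exp (- b)\<bar> \<le> \<bar>b - a\<bar>"
    using lip[of a b] lip[of b a] assms by (cases "a \<le> b") (simp_all add: abs_minus_commute)
  then have "\<bar>b - a\<bar> * \<bar>exp (- a) - exp (- b)\<bar> \<le> \<bar>b - a\<bar> * \<bar>b - a\<bar>"
    by (intro mult_left_mono) auto
  also have "\<dots> = (b - a)\<^sup>2" by (simp add: power2_eq_square)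
  finally show ?thesis using 1 by simp
qed

definition flaplacian :: "(int^2 \<Rightarrow> complex) \<Rightarrow> int^2 \<Rightarrow> complex" where
  "flaplacian a k = fderiv 1 (fderiv 1 a) k + fderiv 2 (fderiv 2 a) k"

lemma flaplacian_eq: "flaplacian a k = - of_real ((freq_norm k)\<^sup>2) * a k"
proof -
  have "complex_of_real ((freq_norm k)\<^sup>2) = (of_int (k $ 1))\<^sup>2 + (of_int (k $ 2))\<^sup>2"
    unfolding norm_2_sq by simp
  then show ?thesis
    by (simp add: flaplacian_def fderiv_def algebra_simps power2_eq_square)
qed

lemma rapid_flaplacian: "rapid a \<Longrightarrow> rapid (flaplacian a)"
  unfolding flaplacian_def by (intro rapid_add rapid_fderiv)

text \<open>Restricted to the half line because for negative times the coefficients may fail to be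
  summable. A remainder of second order in time costs four powers of the frequency.\<close>

lemma fseries_heat_deriv:
  assumes a: "rapid a" and t: "0 \<le> \<tau>"
  shows "((\<lambda>\<tau>. fseries (heat \<tau> a) x) has_vector_derivative fseries (flaplacian (heat \<tau> a)) x) (at \<tau> within {0..})"
  unfolding has_vector_derivative_def
proof (rule has_derivative_quadratic[where C = "\<Sum>\<^sub>\<infinity>k. freq_norm k ^ 4 * norm (a k)"])
  show "bounded_linear (\<lambda>h. h *\<^sub>R fseries (flaplacian (heat \<tau> a)) x)"
    by (rule bounded_linear_scaleR_left)
  fix h assume h: "\<tau> + h \<in> {0..}"
  note s = has_sum_infsum[OF fseries_summable]
  have "((\<lambda>k. heat (\<tau> + h) a k * character k x - heat \<tau> a k * character k x
           - h *\<^sub>R (flaplacian (heat \<tau> a) k * character k x))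
    has_sum (fseries (heat (\<tau> + h) a) x - fseries (heat \<tau> a) x - h *\<^sub>R fseries (flaplacian (heat \<tau> a)) x)) UNIV"
    unfolding fseries_def
    by (intro has_sum_diff has_sum_bounded_linear[OF bounded_linear_scaleR_right] s a rapid_flaplacian rapid_heat t)
       (use h in auto)
  then have "fseries (heat (\<tau> + h) a) x - fseries (heat \<tau> a) x - h *\<^sub>R fseries (flaplacian (heat \<tau> a)) x
      = (\<Sum>\<^sub>\<infinity>k. heat (\<tau> + h) a k * character k x - heat \<tau> a k * character k x
           - h *\<^sub>R (flaplacian (heat \<tau> a) k * character k x))"
    by (simp add: infsumI)
  also have "norm \<dots> \<le> (\<Sum>\<^sub>\<infinity>k. (freq_norm k ^ 4 * norm (a k)) * (norm h)\<^sup>2)"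
  proof (rule norm_infsum_mono)
    show "(\<lambda>k. (freq_norm k ^ 4 * norm (a k)) * (norm h)\<^sup>2) summable_on UNIV"
      by (intro summable_on_cmult_left rapid_power_summable a)
    fix k :: "int^2"
    let ?q = "(freq_norm k)\<^sup>2"
    have "heat (\<tau> + h) a k * character k x - heat \<tau> a k * character k x - h *\<^sub>R (flaplacian (heat \<tau> a) k * character k x)
      = of_real (exp (- ((\<tau> + h) * ?q)) - exp (- (\<tau> * ?q)) + ((\<tau> + h) * ?q - \<tau> * ?q) * exp (- (\<tau> * ?q))) * a k * character k x"
      by (simp add: heat_def flaplacian_eq scaleR_conv_of_real algebra_simps)
    also have "norm \<dots> = \<bar>exp (- ((\<tau> + h) * ?q)) - exp (- (\<tau> * ?q)) + ((\<tau> + h) * ?q - \<tau> * ?q) * exp (- (\<tau> * ?q))\<bar> * norm (a k)"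
      by (simp only: norm_mult norm_of_real norm_character mult_1_right)
    also have "\<dots> \<le> ((\<tau> + h) * ?q - \<tau> * ?q)\<^sup>2 * norm (a k)"
      using h t by (intro mult_right_mono exp_neg_diff_le mult_nonneg_nonneg) auto
    also have "\<dots> = (freq_norm k ^ 4 * norm (a k)) * (norm h)\<^sup>2"
      by (simp add: algebra_simps power2_eq_square power4_eq_xxxx)
    finally show "norm (heat (\<tau> + h) a k * character k x - heat \<tau> a k * character k x - h *\<^sub>R (flaplacian (heat \<tau> a) k * character k x))
       \<le> (freq_norm k ^ 4 * norm (a k)) * (norm h)\<^sup>2" .
  qed
  also have "\<dots> = (\<Sum>\<^sub>\<infinity>k. freq_norm k ^ 4 * norm (a k)) * (norm h)\<^sup>2"
    by (rule infsum_cmult_left')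
  finally show "norm (fseries (heat (\<tau> + h) a) x - fseries (heat \<tau> a) x - h *\<^sub>R fseries (flaplacian (heat \<tau> a)) x)
     \<le> (\<Sum>\<^sub>\<infinity>k. freq_norm k ^ 4 * norm (a k)) * (norm h)\<^sup>2" .
qed

lemma continuous_on_heat:
  assumes "rapid a" "T \<subseteq> {0..}"
  shows "continuous_on (T \<times> S) (\<lambda>(\<tau>, x). fseries (heat \<tau> a) x)"
  unfolding fseries_def case_prod_unfold
proof (rule continuous_on_infsum[OF _ _ rapid_abs_summable[OF assms(1)]])
  show "continuous_on (T \<times> S) (\<lambda>p. heat (fst p) a k * character k (snd p))" for k
    unfolding heat_def character_def by (intro continuous_intros)
  show "norm (heat (fst p) a k * character k (snd p)) \<le> norm (a k)" if "p \<in> T \<times> S" for k p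
    using that assms(2) by (auto simp: norm_mult intro!: norm_heat_le)
qed

text \<open>Heat equation plus second derivative test along each coordinate line. A minimum on short
  coordinate segments is enough, which suits both the torus and the interior of the
  quadrant.\<close>

lemma heat_time_deriv_nonneg:
  assumes a: "rapid a" and t: "0 \<le> \<tau>" "\<tau> \<le> T"
    and e: "e > 0" "\<And>i s. \<bar>s\<bar> < e \<Longrightarrow> Re (fseries (heat \<tau> a) x) \<le> Re (fseries (heat \<tau> a) (x + s *\<^sub>R ax i))"
  shows "\<exists>d\<ge>0. ((\<lambda>\<tau>. Re (fseries (heat \<tau> a) x)) has_real_derivative d) (at \<tau> within {0..T})"
proof (intro exI conjI)
  have b: "rapid (heat \<tau> a)" by (rule rapid_heat[OF a t(1)])
  have "0 \<le> Re (fseries (fderiv i (fderiv i (heat \<tau> a))) x)" for i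
  proof (rule second_derivative_nonneg_at_local_min[OF _ _ e(1)])
    have line: "((\<lambda>s. Re (fseries c (x + s *\<^sub>R ax i))) has_real_derivative Re (fseries (fderiv i c) (x + s *\<^sub>R ax i))) (at s)"
      if "rapid c" for c s
      using has_dir_deriv_line[OF fseries_dir_deriv[OF that], of x i s UNIV]
      by (auto simp: has_vector_derivative_complex_iff has_real_derivative_iff_has_vector_derivative)
    show "((\<lambda>s. Re (fseries (heat \<tau> a) (x + s *\<^sub>R ax i))) has_real_derivative Re (fseries (fderiv i (heat \<tau> a)) (x + s *\<^sub>R ax i))) (at s)" for s
      by (rule line[OF b])
    show "((\<lambda>s. Re (fseries (fderiv i (heat \<tau> a)) (x + s *\<^sub>R ax i))) has_real_derivative Re (fseries (fderiv i (fderiv i (heat \<tau> a))) x)) (at 0)"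
      using line[OF rapid_fderiv[OF b], of i 0] by simp
    show "Re (fseries (heat \<tau> a) (x + 0 *\<^sub>R ax i)) \<le> Re (fseries (heat \<tau> a) (x + s *\<^sub>R ax i))" if "\<bar>s\<bar> < e" for s
      using e(2)[OF that] by simp
  qed
  from this[of 1] this[of 2] show "0 \<le> Re (fseries (flaplacian (heat \<tau> a)) x)"
    unfolding flaplacian_def by (subst fseries_add) (auto intro!: rapid_fderiv b)
  have "((\<lambda>\<tau>. fseries (heat \<tau> a) x) has_vector_derivative fseries (flaplacian (heat \<tau> a)) x) (at \<tau> within {0..T})"
    by (rule has_vector_derivative_within_subset[OF fseries_heat_deriv[OF a t(1)]]) auto
  then show "((\<lambda>\<tau>. Re (fseries (heat \<tau> a) x)) has_real_derivative Re (fseries (flaplacian (heat \<tau> a)) x)) (at \<tau> within {0..T})"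
    by (auto simp: has_vector_derivative_complex_iff has_real_derivative_iff_has_vector_derivative)
qed

lemma heat_lower_bound:
  assumes a: "rapid a" and m: "\<And>x. m \<le> Re (fseries a x)" and t: "0 \<le> \<tau>"
  shows "m \<le> Re (fseries (heat \<tau> a) x)"
proof -
  have "0 \<le> Re (fseries (heat \<tau> a) y) - m" if "y \<in> cell" for y
  proof (rule minimum_principle[where K = cell and T = \<tau> and x = y and t = \<tau>])
    show "continuous_on ({0..\<tau>} \<times> cell) (\<lambda>(\<tau>, x). Re (fseries (heat \<tau> a) x) - m)"
      using continuous_on_heat[OF a, of "{0..\<tau>}" cell] by (auto simp: case_prod_unfold intro!: continuous_intros)
    show "\<exists>d\<ge>0. ((\<lambda>s. Re (fseries (heat s a) y) - m) has_real_derivative d) (at \<sigma> within {0..\<tau>})"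
      if \<sigma>: "0 < \<sigma>" "\<sigma> \<le> \<tau>" "y \<in> cell"
        "\<And>z. z \<in> cell \<Longrightarrow> Re (fseries (heat \<sigma> a) y) - m \<le> Re (fseries (heat \<sigma> a) z) - m" for \<sigma> y
    proof -
      have "Re (fseries (heat \<sigma> a) y) \<le> Re (fseries (heat \<sigma> a) z)" for z
        using \<sigma>(4)[of "torus_rep z"] torus_subset_cell torus_rep_in_torus[of z] periodic_torus_rep[OF periodic_fseries, of "heat \<sigma> a" z] by auto
      then obtain d where "d \<ge> 0" "((\<lambda>s. Re (fseries (heat s a) y)) has_real_derivative d) (at \<sigma> within {0..\<tau>})"
        using heat_time_deriv_nonneg[OF a, of \<sigma> \<tau> 1 y] \<sigma> by auto
      then have "((\<lambda>s. Re (fseries (heat s a) y) - m) has_real_derivative d - 0) (at \<sigma> within {0..\<tau>})"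
        by (intro DERIV_diff DERIV_const)
      then show ?thesis using \<open>d \<ge> 0\<close> by auto
    qed
  qed (use m t that in auto)
  from this[of "torus_rep x"] show ?thesis
    using torus_subset_cell torus_rep_in_torus[of x] periodic_torus_rep[OF periodic_fseries, of "heat \<tau> a" x] by auto
qed

lemma abs_heat_le:
  assumes a: "rapid a" and N: "\<And>x. \<bar>Re (fseries a x)\<bar> \<le> N" and t: "0 \<le> \<tau>"
  shows "\<bar>Re (fseries (heat \<tau> a) x)\<bar> \<le> N"
proof -
  have "- N \<le> Re (fseries (heat \<tau> a) x)"
    by (rule heat_lower_bound[OF a _ t]) (use N in \<open>auto simp: abs_le_iff minus_le_iff\<close>)
  moreover have "- N \<le> Re (fseries (heat \<tau> (\<lambda>k. - a k)) x)"
    by (rule heat_lower_bound[OF rapid_minus[OF a] _ t]) (use N in \<open>auto simp: abs_le_iff fseries_minus\<close>)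
  moreover have "heat \<tau> (\<lambda>k. - a k) = (\<lambda>k. - heat \<tau> a k)" by (simp add: heat_def fun_eq_iff)
  ultimately show ?thesis by (simp add: fseries_minus abs_le_iff)
qed

definition quadrant :: "plane set" where "quadrant = cbox 0 (\<chi> i. pi)"

lemma mem_quadrant: "x \<in> quadrant \<longleftrightarrow> (\<forall>i. 0 \<le> x $ i \<and> x $ i \<le> pi)"
  by (simp add: quadrant_def mem_box_cart)

lemma compact_quadrant: "compact quadrant"
  by (simp add: quadrant_def compact_cbox)

lemma quadrant_interior_step:
  assumes "x \<in> quadrant" "\<And>i. x $ i \<noteq> 0" "\<And>i. x $ i \<noteq> pi"
  obtains e where "e > 0" "\<And>s i. \<bar>s\<bar> < e \<Longrightarrow> x + s *\<^sub>R ax i \<in> quadrant"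
proof -
  have x: "0 < x $ i" "x $ i < pi" for i
    using assms(1) assms(2)[of i] assms(3)[of i] by (auto simp: mem_quadrant less_le)
  define e where "e = min (min (x $ 1) (x $ 2)) (min (pi - x $ 1) (pi - x $ 2))"
  have "e > 0" using x by (simp add: e_def)
  moreover have "x + s *\<^sub>R ax i \<in> quadrant" if "\<bar>s\<bar> < e" for s i
    using that x[of 1] x[of 2] exhaust_2[of i] by (auto simp: e_def mem_quadrant forall_2 axis_def abs_less_iff)
  ultimately show ?thesis using that by blast
qed

text \<open>Odd reflection makes the heat flow on the quadrant a Dirichlet problem.\<close>

lemma heat_nonneg_quadrant:
  assumes a: "rapid a"
    and nonneg: "\<And>x. x \<in> quadrant \<Longrightarrow> 0 \<le> Re (fseries a x)"
    and bdry: "\<And>\<tau> x i. 0 \<le> \<tau> \<Longrightarrow> x $ i = 0 \<or> x $ i = pi \<Longrightarrow> Re (fseries (heat \<tau> a) x) = 0"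
    and t: "0 \<le> \<tau>" and x: "x \<in> quadrant"
  shows "0 \<le> Re (fseries (heat \<tau> a) x)"
proof (rule minimum_principle[where K = quadrant and T = \<tau> and x = x and t = \<tau>])
  show "continuous_on ({0..\<tau>} \<times> quadrant) (\<lambda>(\<tau>, x). Re (fseries (heat \<tau> a) x))"
    using continuous_on_heat[OF a, of "{0..\<tau>}" quadrant] by (auto simp: case_prod_unfold intro!: continuous_intros)
  show "\<exists>d\<ge>0. ((\<lambda>s. Re (fseries (heat s a) y)) has_real_derivative d) (at \<sigma> within {0..\<tau>})"
    if \<sigma>: "0 < \<sigma>" "\<sigma> \<le> \<tau>" "y \<in> quadrant" "Re (fseries (heat \<sigma> a) y) < 0"
      "\<And>z. z \<in> quadrant \<Longrightarrow> Re (fseries (heat \<sigma> a) y) \<le> Re (fseries (heat \<sigma> a) z)" for \<sigma> y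
  proof -
    have "y $ i \<noteq> 0 \<and> y $ i \<noteq> pi" for i using bdry[of \<sigma> y i] \<sigma> by auto
    then obtain e where "e > 0" "\<And>s i. \<bar>s\<bar> < e \<Longrightarrow> y + s *\<^sub>R ax i \<in> quadrant"
      using quadrant_interior_step[OF \<sigma>(3)] by metis
    then show ?thesis using \<sigma> by (intro heat_time_deriv_nonneg[OF a]) auto
  qed
qed (use t x nonneg compact_quadrant in auto)

section \<open>Riesz potentials by subordination to the heat semigroup\<close>

text \<open>Euler's integral with the variable scaled by \<open>q\<close>, computed as a
  non-negative integral so that integrability comes out together with the value.\<close>

lemma Gamma_integral_scaled:
  fixes s q :: real
  assumes s: "0 < s" and q: "0 < q"
  shows "((\<lambda>t. t powr (s - 1) * exp (- t * q)) has_integral (Gamma s * q powr (- s))) {0..}"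
proof -
  let ?g = "\<lambda>t. indicator {0..} t * (t powr (s - 1) * exp (- t * q))"
  have "ennreal (Gamma s) = (\<integral>\<^sup>+ t. ennreal (indicator {0..} t * t powr (s - 1) / exp t) \<partial>lborel)"
    by (rule Gamma_conv_nn_integral_real[OF s])
  also have "\<dots> = ennreal \<bar>q\<bar> * (\<integral>\<^sup>+ t. ennreal (indicator {0..} (0 + q * t) * (0 + q * t) powr (s - 1) / exp (0 + q * t)) \<partial>lborel)"
    by (rule nn_integral_real_affine) (use q in auto)
  also have "(\<lambda>t. indicator {0..} (0 + q * t) * (0 + q * t) powr (s - 1) / exp (0 + q * t)) = (\<lambda>t. q powr (s - 1) * ?g t)"
    using q by (auto simp: fun_eq_iff indicator_def zero_le_mult_iff powr_mult exp_minus field_simps)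
  also have "(\<integral>\<^sup>+ t. ennreal (q powr (s - 1) * ?g t) \<partial>lborel) = ennreal (q powr (s - 1)) * (\<integral>\<^sup>+ t. ennreal (?g t) \<partial>lborel)"
    by (subst ennreal_mult) (auto intro!: nn_integral_cmult mult_nonneg_nonneg)
  finally have 1: "ennreal (Gamma s) = ennreal \<bar>q\<bar> * (ennreal (q powr (s - 1)) * (\<integral>\<^sup>+ t. ennreal (?g t) \<partial>lborel))" .
  define I where "I = (\<integral>\<^sup>+ t. ennreal (?g t) \<partial>lborel)"
  have 2: "q powr (- s) * (q * q powr (s - 1)) = 1"
    using q by (simp add: powr_diff flip: powr_add)
  have "ennreal (q powr (- s)) * ennreal (Gamma s) = ennreal (q powr (- s) * (q * q powr (s - 1))) * I"
    unfolding 1 I_def[symmetric] using q by (simp add: ennreal_mult mult.assoc)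
  then have "I = ennreal (Gamma s * q powr (- s))"
    using s unfolding 2 by (simp add: ennreal_mult'' mult.commute)
  then have "(\<integral>\<^sup>+ t. ennreal (?g t) \<partial>lborel) = ennreal (Gamma s * q powr (- s))" by (simp only: I_def)
  then have "(?g has_integral (Gamma s * q powr (- s))) UNIV"
    using s by (intro nn_integral_has_integral) (auto intro!: mult_nonneg_nonneg simp: Gamma_real_pos less_imp_le)
  moreover have "?g = (\<lambda>t. if t \<in> {0..} then t powr (s - 1) * exp (- t * q) else 0)"
    by (auto simp: fun_eq_iff)
  ultimately show ?thesis by (simp only: has_integral_restrict_UNIV)
qed

text \<open>The zero mode is removed: its symbol is \<open>0 powr (2 * s) = 0\<close>, for negative s as well.\<close>

definition riesz :: "real \<Rightarrow> (int^2 \<Rightarrow> complex) \<Rightarrow> int^2 \<Rightarrow> complex" where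
  "riesz s a k = of_real (freq_norm k powr (2 * s)) * a k"

lemma freq_symbol_le_1: "s \<le> 0 \<Longrightarrow> freq_norm k powr (2 * s) \<le> 1"
proof (cases "k = 0")
  case False
  assume "s \<le> 0"
  then have "freq_norm k powr (2 * s) \<le> freq_norm k powr 0"
    using freq_norm_ge_1[OF False] by (intro powr_mono) auto
  then show ?thesis using freq_norm_ge_1[OF False] by (auto split: if_splits)
qed auto

lemma norm_riesz_le: "s \<le> 0 \<Longrightarrow> norm (riesz s a k) \<le> norm (a k)"
  using freq_symbol_le_1[of s k] by (simp add: riesz_def norm_mult mult_left_le_one_le)

lemma rapid_riesz: "rapid a \<Longrightarrow> s \<le> 0 \<Longrightarrow> rapid (riesz s a)"
  by (rule rapid_norm_le) (auto intro: norm_riesz_le)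

lemma fderiv_riesz: "fderiv i (riesz s a) = riesz s (fderiv i a)"
  by (simp add: fderiv_def riesz_def fun_eq_iff mult_ac)

text \<open>Up to \<open>Gamma s\<close>, the symbol of the potential is the Mellin transform in
  \<tau> of the heat symbol. Sum and integral are interchanged by dominated convergence; mean zero
  leaves only |k| \<ge> 1 and so provides the factor exp(-\<tau>) of the majorant.\<close>

lemma subordination:
  assumes a: "rapid a" and a0: "a 0 = 0" and s: "0 < s"
  shows "((\<lambda>\<tau>. \<tau> powr (s - 1) * Re (fseries (heat \<tau> a) x)) has_integral
           Gamma s * Re (fseries (riesz (- s) a) x)) {0..}"
proof -
  \<comment> \<open>Dominated convergence speaks of sequences, hence an enumeration of the lattice
    by natural numbers.\<close>
  define e where "e = from_nat_into (UNIV :: (int^2) set)"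
  have "infinite (UNIV :: (int^2) set)"
  proof -
    have "inj (\<lambda>j::int. (\<chi> i. j) :: int^2)" by (auto simp: inj_def vec_eq_iff)
    then show ?thesis using finite_imageD[of "\<lambda>j::int. (\<chi> i. j) :: int^2" UNIV] infinite_UNIV_int
      by (metis finite_subset subset_UNIV)
  qed
  then have e: "bij_betw e UNIV UNIV"
    unfolding e_def by (intro bij_betw_from_nat_into) auto
  define b where "b n = Re (a (e n) * character (e n) x)" for n
  define q where "q n = (freq_norm (e n))\<^sup>2" for n
  have q: "1 \<le> q n" if "b n \<noteq> 0" for n
  proof -
    have "e n \<noteq> 0" using that a0 by (auto simp: b_def)
    then show ?thesis unfolding q_def using freq_norm_ge_1 by (simp add: one_le_power)
  qed
  have conv: "(\<lambda>n. w (e n) * b n) sums Re (fseries (\<lambda>k. of_real (w k) * a k) x)"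
    if "rapid (\<lambda>k. of_real (w k) * a k)" for w :: "int^2 \<Rightarrow> real"
  proof -
    have "((\<lambda>k. Re (of_real (w k) * a k * character k x)) has_sum Re (fseries (\<lambda>k. of_real (w k) * a k) x)) UNIV"
      unfolding fseries_def by (intro has_sum_Re has_sum_infsum fseries_summable that)
    then have "((\<lambda>n. Re (of_real (w (e n)) * a (e n) * character (e n) x)) has_sum Re (fseries (\<lambda>k. of_real (w k) * a k) x)) UNIV"
      by (subst has_sum_reindex_bij_betw[OF e])
    from has_sum_imp_sums[OF this] show ?thesis by (simp add: b_def mult.assoc)
  qed
  have "((\<lambda>k. norm (a k)) has_sum (\<Sum>\<^sub>\<infinity>k. norm (a k))) UNIV"
    by (intro has_sum_infsum rapid_abs_summable a)
  then have "((\<lambda>n. norm (a (e n))) has_sum (\<Sum>\<^sub>\<infinity>k. norm (a k))) UNIV"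
    by (subst has_sum_reindex_bij_betw[OF e])
  then have sa: "(\<lambda>n. norm (a (e n))) sums (\<Sum>\<^sub>\<infinity>k. norm (a k))" by (rule has_sum_imp_sums)
  define B where "B = (\<Sum>\<^sub>\<infinity>k. norm (a k))"
  have B: "(\<Sum>i<n. \<bar>b i\<bar>) \<le> B" for n
  proof -
    have "(\<Sum>i<n. \<bar>b i\<bar>) \<le> (\<Sum>i<n. norm (a (e i)))"
      unfolding b_def by (intro sum_mono order_trans[OF abs_Re_le_cmod]) (simp add: norm_mult)
    also have "\<dots> \<le> B" using sum_le_suminf[OF sums_summable[OF sa], of "{..<n}"] sums_unique[OF sa] by (simp add: B_def)
    finally show ?thesis .
  qed
  show ?thesis
  proof (rule has_integral_dominated_convergence)
    show "((\<lambda>\<tau>. \<Sum>i<n. b i * (\<tau> powr (s - 1) * exp (- \<tau> * q i))) has_integral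
       (\<Sum>i<n. b i * (Gamma s * q i powr (- s)))) {0..}" for n
    proof (intro has_integral_sum finite_lessThan)
      fix i
      show "((\<lambda>\<tau>. b i * (\<tau> powr (s - 1) * exp (- \<tau> * q i))) has_integral b i * (Gamma s * q i powr (- s))) {0..}"
        using Gamma_integral_scaled[OF s, of "q i"] q[of i]
        by (cases "b i = 0") (auto intro!: has_integral_mult_right)
    qed
    show "(\<lambda>\<tau>. B * (\<tau> powr (s - 1) * exp (- \<tau> * 1))) integrable_on {0..}"
      by (rule has_integral_integrable[OF has_integral_mult_right[OF Gamma_integral_scaled[OF s zero_less_one]]])
    show "\<forall>\<tau>\<in>{0..}. norm (\<Sum>i<n. b i * (\<tau> powr (s - 1) * exp (- \<tau> * q i))) \<le> B * (\<tau> powr (s - 1) * exp (- \<tau> * 1))" for n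
    proof
      fix \<tau> :: real assume \<tau>: "\<tau> \<in> {0..}"
      have "norm (\<Sum>i<n. b i * (\<tau> powr (s - 1) * exp (- \<tau> * q i))) \<le> (\<Sum>i<n. \<bar>b i\<bar> * (\<tau> powr (s - 1) * exp (- \<tau> * 1)))"
      proof (intro sum_norm_le)
        fix i
        show "norm (b i * (\<tau> powr (s - 1) * exp (- \<tau> * q i))) \<le> \<bar>b i\<bar> * (\<tau> powr (s - 1) * exp (- \<tau> * 1))"
          using q[of i] \<tau> mult_left_mono[of 1 "q i" \<tau>] by (cases "b i = 0") (auto simp: abs_mult intro!: mult_left_mono)
      qed
      also have "\<dots> \<le> B * (\<tau> powr (s - 1) * exp (- \<tau> * 1))"
        unfolding sum_distrib_right[symmetric] by (intro mult_right_mono B) auto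
      finally show "norm (\<Sum>i<n. b i * (\<tau> powr (s - 1) * exp (- \<tau> * q i))) \<le> B * (\<tau> powr (s - 1) * exp (- \<tau> * 1))" .
    qed
    show "\<forall>\<tau>\<in>{0..}. (\<lambda>n. \<Sum>i<n. b i * (\<tau> powr (s - 1) * exp (- \<tau> * q i))) \<longlonglongrightarrow> \<tau> powr (s - 1) * Re (fseries (heat \<tau> a) x)"
    proof
      fix \<tau> :: real assume "\<tau> \<in> {0..}"
      then have "rapid (heat \<tau> a)" by (intro rapid_heat a) auto
      then have "(\<lambda>n. exp (- \<tau> * q n) * b n) sums Re (fseries (heat \<tau> a) x)"
        using conv[of "\<lambda>k. exp (- \<tau> * (freq_norm k)\<^sup>2)"] by (simp add: heat_def[abs_def] q_def)
      from sums_mult[OF this, of "\<tau> powr (s - 1)"]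
      show "(\<lambda>n. \<Sum>i<n. b i * (\<tau> powr (s - 1) * exp (- \<tau> * q i))) \<longlonglongrightarrow> \<tau> powr (s - 1) * Re (fseries (heat \<tau> a) x)"
        by (simp add: sums_def mult_ac)
    qed
    have "rapid (riesz (- s) a)" using s by (intro rapid_riesz a) auto
    then have "(\<lambda>n. freq_norm (e n) powr (2 * (- s)) * b n) sums Re (fseries (riesz (- s) a) x)"
      using conv[of "\<lambda>k. freq_norm k powr (2 * (- s))"] by (simp add: riesz_def[abs_def])
    from sums_mult[OF this, of "Gamma s"]
    have "(\<lambda>n. Gamma s * (freq_norm (e n) powr (2 * (- s)) * b n)) sums (Gamma s * Re (fseries (riesz (- s) a) x))" .
    moreover have "freq_norm (e n) powr (2 * (- s)) = q n powr (- s)" for n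
      unfolding q_def by (simp flip: powr_numeral powr_powr add: powr_powr)
    ultimately show "(\<lambda>n. \<Sum>i<n. b i * (Gamma s * q i powr (- s))) \<longlonglongrightarrow> Gamma s * Re (fseries (riesz (- s) a) x)"
      by (simp add: sums_def mult_ac)
  qed
qed

text \<open>Splits the subordination integral at \<delta>. The decay rate 1/2 is half of the
  spectral gap 1; \<open>riesz_oscillation\<close> spends the remaining decay on smoothing.\<close>

lemma riesz_bound:
  assumes a: "rapid a" and a0: "a 0 = 0" and s: "0 < s" and d: "0 < \<delta>"
    and B: "\<And>\<tau>. 0 \<le> \<tau> \<Longrightarrow> \<tau> \<le> \<delta> \<Longrightarrow> \<bar>Re (fseries (heat \<tau> a) x)\<bar> \<le> B"
    and D: "\<And>\<tau>. \<delta> < \<tau> \<Longrightarrow> \<bar>Re (fseries (heat \<tau> a) x)\<bar> \<le> D * exp (- \<tau> / 2)" "0 \<le> D"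
  shows "Gamma s * \<bar>Re (fseries (riesz (- s) a) x)\<bar> \<le> B * (\<delta> powr s / s) + D * (Gamma s * 2 powr s)"
proof -
  have B0: "0 \<le> B" using B[of 0] d by auto
  have G: "Gamma s > 0" using s by (rule Gamma_real_pos)
  let ?g = "\<lambda>\<tau>. (if \<tau> \<in> {0..\<delta>} then B * \<tau> powr (s - 1) else 0) + D * (\<tau> powr (s - 1) * exp (- \<tau> * (1 / 2)))"
  have g: "(?g has_integral (B * (\<delta> powr s / s) + D * (Gamma s * (1 / 2) powr (- s)))) {0..}"
  proof (intro has_integral_add has_integral_mult_right Gamma_integral_scaled s)
    have "((\<lambda>\<tau>. B * \<tau> powr (s - 1)) has_integral B * (\<delta> powr s / s)) {0..\<delta>}"
      using has_integral_powr_from_0[of "s - 1" \<delta>] s d by (intro has_integral_mult_right) auto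
    then show "((\<lambda>\<tau>. if \<tau> \<in> {0..\<delta>} then B * \<tau> powr (s - 1) else 0) has_integral B * (\<delta> powr s / s)) {0..}"
      by (subst has_integral_restrict) auto
  qed auto
  note S = subordination[OF a a0 s, of x]
  have "norm (integral {0..} (\<lambda>\<tau>. \<tau> powr (s - 1) * Re (fseries (heat \<tau> a) x))) \<le> integral {0..} ?g"
  proof (rule integral_norm_bound_integral)
    fix \<tau> :: real assume \<tau>: "\<tau> \<in> {0..}"
    show "norm (\<tau> powr (s - 1) * Re (fseries (heat \<tau> a) x)) \<le> ?g \<tau>"
    proof (cases "\<tau> \<le> \<delta>")
      case True
      then have "\<tau> powr (s - 1) * \<bar>Re (fseries (heat \<tau> a) x)\<bar> \<le> \<tau> powr (s - 1) * B"
        using \<tau> by (intro mult_left_mono B) auto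
      moreover have "0 \<le> D * (\<tau> powr (s - 1) * exp (- \<tau> * (1 / 2)))" using D(2) by simp
      ultimately show ?thesis using True \<tau> by (simp add: abs_mult mult.commute)
    next
      case False
      then have "\<tau> powr (s - 1) * \<bar>Re (fseries (heat \<tau> a) x)\<bar> \<le> \<tau> powr (s - 1) * (D * exp (- \<tau> / 2))"
        using \<tau> by (intro mult_left_mono D) auto
      then show ?thesis using False by (simp add: abs_mult mult_ac)
    qed
  qed (use S g in blast)+
  then show ?thesis
    using S g G by (simp add: integral_unique abs_mult powr_minus_divide powr_divide)
qed


section \<open>Quantitative smoothing by the heat multiplier\<close>

lemma exp_minus_le: "0 < y \<Longrightarrow> exp (- y) \<le> 256 / y ^ 4" for y :: real
proof -
  assume y: "0 < y"
  \<comment> \<open>The constant 256 is 4 ^ 4.\<close>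
  have "y / 4 \<le> exp (y / 4)" using exp_ge_add_one_self[of "y / 4"] by linarith
  then have "(y / 4) ^ 4 \<le> exp (y / 4) ^ 4" using y by (intro power_mono) auto
  also have "exp (y / 4) ^ 4 = exp y" by (simp flip: exp_of_nat_mult)
  finally have "y ^ 4 \<le> 256 * exp y" by (simp add: power_divide)
  then show "exp (- y) \<le> 256 / y ^ 4" using y by (simp add: exp_minus field_simps)
qed

definition lattice_sum :: real where "lattice_sum = (\<Sum>\<^sub>\<infinity>k. 1 / (1 + freq_norm k) ^ 4)"

lemma lattice_sum_nonneg: "0 \<le> lattice_sum"
  unfolding lattice_sum_def by (intro infsum_nonneg) auto

lemma inverse_freq_norm_4_le:
  assumes "k \<noteq> 0" shows "1 / freq_norm k ^ 4 \<le> 16 / (1 + freq_norm k) ^ 4"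
proof -
  have "(1 + freq_norm k) ^ 4 \<le> (2 * freq_norm k) ^ 4"
    using freq_norm_ge_1[OF assms] by (intro power_mono) auto
  then have "(1 + freq_norm k) ^ 4 \<le> 16 * freq_norm k ^ 4" by (simp add: power_mult_distrib)
  moreover have "0 < freq_norm k ^ 4" using freq_norm_ge_1[OF assms] by (intro zero_less_power) auto
  moreover have "0 < (1 + freq_norm k) ^ 4" by (intro zero_less_power add_pos_nonneg) auto
  ultimately show ?thesis by (simp add: field_simps)
qed

text \<open>65536 = 256 * 2 ^ 4 * 16: \<open>exp_minus_le\<close> at half of \<delta> |k|^2, then
  \<open>inverse_freq_norm_4_le\<close>. Eight powers of decay in |k| remain summable after
  multiplication by |k|^4.\<close>

lemma exp_freq_norm_le:
  assumes "k \<noteq> 0" "0 < \<delta>"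
  shows "exp (- \<delta> * (freq_norm k)\<^sup>2 / 2) * freq_norm k ^ 4 \<le> 65536 / \<delta> ^ 4 * (1 / (1 + freq_norm k) ^ 4)"
proof -
  let ?n = "freq_norm k"
  have n: "1 \<le> ?n" using freq_norm_ge_1[OF assms(1)] .
  then have n0: "0 < ?n" by linarith
  have "exp (- (\<delta> * ?n\<^sup>2 / 2)) \<le> 256 / (\<delta> * ?n\<^sup>2 / 2) ^ 4"
    by (rule exp_minus_le) (use assms n0 in \<open>auto intro!: mult_pos_pos zero_less_power\<close>)
  also have "\<dots> = 4096 / \<delta> ^ 4 * (1 / ?n ^ 8)"
    by (simp add: power_divide power_mult_distrib flip: power_mult)
  finally have "exp (- (\<delta> * ?n\<^sup>2 / 2)) * ?n ^ 4 \<le> 4096 / \<delta> ^ 4 * (1 / ?n ^ 8) * ?n ^ 4"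
    by (intro mult_right_mono) auto
  also have "\<dots> = 4096 / \<delta> ^ 4 * (1 / ?n ^ 4)"
  proof -
    have "1 / ?n ^ 8 * ?n ^ 4 = 1 / ?n ^ 4" using n0 by (simp add: divide_simps flip: power_add)
    then show ?thesis by (simp only: mult.assoc)
  qed
  also have "\<dots> \<le> 4096 / \<delta> ^ 4 * (16 / (1 + ?n) ^ 4)"
    by (intro mult_left_mono inverse_freq_norm_4_le assms) (use assms in auto)
  finally show ?thesis by simp
qed

text \<open>
  For \<open>\<tau> \<le> \<delta>\<close> the maximum principle bounds the heat extension by N; for \<open>\<tau> > \<delta>\<close> the smoothing
  of the semigroup gives a Lipschitz bound that does not involve N.
\<close>

lemma riesz_oscillation:
  assumes a: "rapid a" and s: "0 < s" and d: "0 < \<delta>"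
    and N: "\<And>y. \<bar>Re (fseries a y)\<bar> \<le> N"
    and A: "\<And>k. norm (a k) \<le> A * (freq_norm k)\<^sup>2"
  shows "Gamma s * \<bar>Re (fseries (riesz (- s) a) x) - Re (fseries (riesz (- s) a) 0)\<bar>
     \<le> 2 * N * (\<delta> powr s / s) + A * norm x * (65536 / \<delta> ^ 4) * lattice_sum * (Gamma s * 2 powr s)"
proof -
  have a0: "a 0 = 0" using A[of 0] by simp
  \<comment> \<open>The heat flow and the Riesz potential of \<open>b\<close> at the origin are the
    differences between \<open>x\<close> and 0 of those of \<open>a\<close>. The oscillation thus
    becomes a single potential, to which \<open>riesz_bound\<close> applies.\<close>
  define b where "b k = a k * (character k x - 1)" for k
  have n1: "norm (character k x - 1) \<le> 2" for k
    using norm_triangle_ineq4[of "character k x" 1] by simp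
  have b: "rapid b"
  proof (rule rapid_mono[OF a, of _ 2 0])
    show "norm (b k) \<le> 2 * (1 + freq_norm k) ^ 0 * norm (a k)" for k
      using mult_left_mono[OF n1[of k] norm_ge_zero[of "a k"]] by (simp add: b_def norm_mult mult.commute)
  qed
  have diff: "fseries (\<lambda>k. c k * (character k x - 1)) 0 = fseries c x - fseries c 0" if "rapid c" for c
  proof -
    have "((\<lambda>k. c k * character k x - c k * character k 0) has_sum (fseries c x - fseries c 0)) UNIV"
      unfolding fseries_def by (intro has_sum_diff has_sum_infsum fseries_summable that)
    then show ?thesis unfolding fseries_def by (intro infsumI) (simp add: algebra_simps)
  qed
  have hb: "fseries (heat \<tau> b) 0 = fseries (heat \<tau> a) x - fseries (heat \<tau> a) 0" if "0 \<le> \<tau>" for \<tau>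
    using diff[OF rapid_heat[OF a that]] by (simp add: heat_def[abs_def] b_def mult.assoc)
  have rb: "fseries (riesz (- s) b) 0 = fseries (riesz (- s) a) x - fseries (riesz (- s) a) 0"
    using diff[OF rapid_riesz[OF a, of "- s"]] s by (simp add: riesz_def[abs_def] b_def mult.assoc)
  have A0: "0 \<le> A"
  proof -
    have "axis 1 1 \<noteq> (0 :: int^2)" by (simp add: axis_eq_0_iff)
    then have "0 < (freq_norm (axis 1 1))\<^sup>2" using freq_norm_ge_1[of "axis 1 1"] by (intro zero_less_power) auto
    then show ?thesis using order_trans[OF norm_ge_zero A[of "axis 1 1"]] by (simp add: zero_le_mult_iff)
  qed
  let ?D = "A * norm x * (65536 / \<delta> ^ 4) * lattice_sum"
  have "Gamma s * \<bar>Re (fseries (riesz (- s) b) 0)\<bar> \<le> 2 * N * (\<delta> powr s / s) + ?D * (Gamma s * 2 powr s)"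
  proof (rule riesz_bound[OF b _ s d])
    show "b 0 = 0" by (simp add: b_def)
    show "\<bar>Re (fseries (heat \<tau> b) 0)\<bar> \<le> 2 * N" if "0 \<le> \<tau>" "\<tau> \<le> \<delta>" for \<tau>
      using abs_heat_le[OF a N that(1), of x] abs_heat_le[OF a N that(1), of 0] by (simp add: hb that abs_le_iff)
    show "0 \<le> ?D" using A0 lattice_sum_nonneg d by simp
    show "\<bar>Re (fseries (heat \<tau> b) 0)\<bar> \<le> ?D * exp (- \<tau> / 2)" if t: "\<delta> < \<tau>" for \<tau>
    proof -
      let ?c = "A * norm x * (65536 / \<delta> ^ 4) * exp (- \<tau> / 2)"
      have "norm (fseries (heat \<tau> b) 0) \<le> (\<Sum>\<^sub>\<infinity>k. ?c * (1 / (1 + freq_norm k) ^ 4))"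
        unfolding fseries_def
      proof (rule norm_infsum_mono)
        show "(\<lambda>k. ?c * (1 / (1 + freq_norm k) ^ 4)) summable_on UNIV"
          by (intro summable_on_cmult_right summable_freq_norm_4)
        fix k :: "int^2"
        show "norm (heat \<tau> b k * character k 0) \<le> ?c * (1 / (1 + freq_norm k) ^ 4)"
        proof (cases "k = 0")
          case True then show ?thesis using A0 d by (simp add: heat_def b_def)
        next
          case False
          let ?n = "freq_norm k"
          have n: "1 \<le> ?n" using freq_norm_ge_1[OF False] .
          have "norm (character k x - 1) \<le> \<bar>wavevector k \<bullet> x\<bar>"
            unfolding character_def by (rule norm_cis_minus_1)
          also have "\<dots> \<le> ?n * norm x" by (rule Cauchy_Schwarz_ineq2)
          finally have "norm (b k) \<le> (A * ?n\<^sup>2) * (?n * norm x)"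
            unfolding b_def norm_mult using A A0 by (intro mult_mono) auto
          also have "\<dots> = A * norm x * ?n ^ 3" by (simp add: power2_eq_square power3_eq_cube)
          also have "\<dots> \<le> A * norm x * ?n ^ 4"
            using n A0 by (intro mult_left_mono power_increasing) auto
          finally have bk: "norm (b k) \<le> A * norm x * ?n ^ 4" .
          \<comment> \<open>Half of the exponent gives decay in time, the other half a Gaussian in
            the frequency that no longer depends on \<tau>.\<close>
          have "\<delta> * ?n\<^sup>2 / 2 + \<tau> / 2 \<le> \<tau> * ?n\<^sup>2"
          proof -
            have "1 \<le> ?n\<^sup>2" using n by (simp add: one_le_power)
            then have "\<tau> \<le> \<tau> * ?n\<^sup>2" "\<delta> * ?n\<^sup>2 \<le> \<tau> * ?n\<^sup>2"
              using t d by (auto intro: mult_right_mono)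
            then show ?thesis by linarith
          qed
          then have "exp (- \<tau> * ?n\<^sup>2) \<le> exp (- \<tau> / 2) * exp (- \<delta> * ?n\<^sup>2 / 2)"
            by (simp flip: exp_add)
          then have "norm (heat \<tau> b k * character k 0) \<le> (exp (- \<tau> / 2) * exp (- \<delta> * ?n\<^sup>2 / 2)) * (A * norm x * ?n ^ 4)"
            unfolding heat_def norm_mult using bk by (auto intro!: mult_mono)
          also have "\<dots> = A * norm x * exp (- \<tau> / 2) * (exp (- \<delta> * ?n\<^sup>2 / 2) * ?n ^ 4)" by (simp add: mult_ac)
          also have "\<dots> \<le> A * norm x * exp (- \<tau> / 2) * (65536 / \<delta> ^ 4 * (1 / (1 + ?n) ^ 4))"
            using A0 by (intro mult_left_mono exp_freq_norm_le False d) auto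
          finally show ?thesis by (simp add: mult_ac)
        qed
      qed
      also have "\<dots> = ?D * exp (- \<tau> / 2)"
        unfolding infsum_cmult_right' lattice_sum_def by (simp add: mult_ac)
      finally show ?thesis using abs_Re_le_cmod order_trans by blast
    qed
  qed
  then show ?thesis by (simp add: rb)
qed

text \<open>Positivity allows all of the integral but the window from \<open>\<tau>0\<close> to
  \<open>\<tau>0 + 1\<close> to be dropped. The rate 2 is the value of |k|^2 on the corner modes;
  \<open>s \<le> 1\<close> makes the weight decreasing.\<close>

lemma riesz_lower_bound:
  assumes a: "rapid a" and a0: "a 0 = 0" and s: "0 < s" "s \<le> 1"
    and pos: "\<And>\<tau>. 0 \<le> \<tau> \<Longrightarrow> 0 \<le> Re (fseries (heat \<tau> a) x)"
    and m: "\<And>\<tau>. \<tau>0 \<le> \<tau> \<Longrightarrow> m * exp (- 2 * \<tau>) \<le> Re (fseries (heat \<tau> a) x)" "0 \<le> m" "1 \<le> \<tau>0"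
  shows "m * exp (- 2 * (\<tau>0 + 1)) * (\<tau>0 + 1) powr (s - 1) \<le> Gamma s * Re (fseries (riesz (- s) a) x)"
proof -
  let ?c = "m * exp (- 2 * (\<tau>0 + 1)) * (\<tau>0 + 1) powr (s - 1)"
  have "((\<lambda>\<tau>. if \<tau> \<in> {\<tau>0..\<tau>0 + 1} then ?c else 0) has_integral ?c) {0..}"
    using has_integral_const_real[of ?c \<tau>0 "\<tau>0 + 1"] m(3) by (subst has_integral_restrict) auto
  then show ?thesis
  proof (rule has_integral_le[OF _ subordination[OF a a0 s(1), of x]])
    fix \<tau> :: real assume \<tau>: "\<tau> \<in> {0..}"
    show "(if \<tau> \<in> {\<tau>0..\<tau>0 + 1} then ?c else 0) \<le> \<tau> powr (s - 1) * Re (fseries (heat \<tau> a) x)"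
    proof (cases "\<tau> \<in> {\<tau>0..\<tau>0 + 1}")
      case True
      have "m * exp (- 2 * (\<tau>0 + 1)) \<le> m * exp (- 2 * \<tau>)"
        using True m by (intro mult_left_mono) auto
      also have "\<dots> \<le> Re (fseries (heat \<tau> a) x)" using True by (intro m) auto
      finally have "(m * exp (- 2 * (\<tau>0 + 1))) * (\<tau>0 + 1) powr (s - 1) \<le> Re (fseries (heat \<tau> a) x) * \<tau> powr (s - 1)"
        using True m s \<tau> by (intro mult_mono powr_mono2' pos) auto
      then show ?thesis using True by (simp add: mult.commute)
    next
      case False then show ?thesis using pos[of \<tau>] \<tau> by auto
    qed
  qed
qed

text \<open>The coefficients of a mixed derivative vanish on the coordinate axes of the lattice. Off
  the axes these are the frequencies with the least |k|^2, namely 2, so they dominate the heat flow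
  at late times.\<close>

definition corner_modes :: "(int^2) set" where
  "corner_modes = {k. \<bar>k $ 1\<bar> = 1 \<and> \<bar>k $ 2\<bar> = 1}"

lemma corner_modes: "finite corner_modes" "card corner_modes = 4"
proof -
  define v where "v = (\<lambda>(a, b). (\<chi> i. if i = 1 then a else b) :: int^2)"
  have c: "corner_modes = v ` ({1, -1} \<times> {1, -1})"
    by (auto simp: v_def corner_modes_def vec_eq_iff forall_2 image_iff abs_if split: if_splits)
  have "inj_on v ({1, -1} \<times> {1, -1})" by (auto simp: v_def inj_on_def vec_eq_iff forall_2)
  then have "card corner_modes = card ({1, -1::int} \<times> {1, -1::int})" unfolding c by (rule card_image)
  then show "card corner_modes = 4" by (simp add: card_cartesian_product)
  show "finite corner_modes" unfolding c by simp
qed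

text \<open>The four corner modes contribute 4 \<beta> exp(-2 \<tau>). Every other mode has
  coefficient 0 or |k|^2 \<ge> 5, and the second condition on \<tau> keeps the total of these below
  half of that.\<close>

lemma heat_corner_lower_bound:
  assumes a: "rapid a" and \<beta>: "0 \<le> \<beta>"
    and corner: "\<And>k. k \<in> corner_modes \<Longrightarrow> a k = of_real \<beta>"
    and bound: "\<And>k. norm (a k) \<le> \<beta> * (real_of_int (k $ 1))\<^sup>2 * (real_of_int (k $ 2))\<^sup>2"
    and t: "1 \<le> \<tau>" "65536 * lattice_sum \<le> 2 * \<tau>"
  shows "2 * \<beta> * exp (- 2 * \<tau>) \<le> Re (fseries (heat \<tau> a) 0)"
proof -
  let ?e = "\<beta> * exp (- 2 * \<tau>)"
  \<comment> \<open>A termwise minorant. The error is subtracted at the corners too, so that its sum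
    is the full \<open>lattice_sum\<close>.\<close>
  let ?g = "\<lambda>k. ?e * ((if k \<in> corner_modes then 1 else 0) - 65536 / \<tau> ^ 4 * (1 / (1 + freq_norm k) ^ 4))"
  have cs: "((\<lambda>k. if k \<in> corner_modes then 1 else 0) has_sum (4::real)) UNIV"
    by (rule has_sum_finite_neutralI[of corner_modes]) (auto simp: corner_modes)
  have gs: "(?g has_sum (?e * (4 - 65536 / \<tau> ^ 4 * lattice_sum))) UNIV"
    unfolding lattice_sum_def
    by (intro has_sum_cmult_right has_sum_diff cs has_sum_infsum summable_freq_norm_4)
  have hs: "((\<lambda>k. Re (heat \<tau> a k * character k 0)) has_sum Re (fseries (heat \<tau> a) 0)) UNIV"
    unfolding fseries_def by (intro has_sum_Re has_sum_infsum fseries_summable rapid_heat a) (use t in auto)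
  have "?e * (4 - 65536 / \<tau> ^ 4 * lattice_sum) \<le> Re (fseries (heat \<tau> a) 0)"
  proof (rule has_sum_mono[OF gs hs])
    fix k
    show "?g k \<le> Re (heat \<tau> a k * character k 0)"
    proof (cases "k \<in> corner_modes")
      case True
      then have "\<bar>k $ 1\<bar>\<^sup>2 = 1" "\<bar>k $ 2\<bar>\<^sup>2 = 1" by (auto simp: corner_modes_def)
      then have "real_of_int ((k $ 1)\<^sup>2 + (k $ 2)\<^sup>2) = 2" by simp
      then have "(freq_norm k)\<^sup>2 = 2" by (simp add: norm_2_sq)
      then have "Re (heat \<tau> a k * character k 0) = ?e" using corner[OF True] by (simp add: heat_def mult_ac)
      moreover have "0 \<le> ?e * (65536 / \<tau> ^ 4 * (1 / (1 + freq_norm k) ^ 4))" using \<beta> t by (intro mult_nonneg_nonneg) auto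
      ultimately show ?thesis using True by (simp add: algebra_simps)
    next
      case False
      have "norm (heat \<tau> a k * character k 0) \<le> ?e * (65536 / \<tau> ^ 4 * (1 / (1 + freq_norm k) ^ 4))"
      proof (cases "k $ 1 = 0 \<or> k $ 2 = 0")
        case True
        then have "a k = 0" using bound[of k] by auto
        then show ?thesis using \<beta> t by (auto simp: heat_def)
      next
        case nz: False
        then have k0: "k \<noteq> 0" by auto
        have sq: "j\<^sup>2 \<ge> 4" if "\<bar>j\<bar> \<noteq> 1" "j \<noteq> 0" for j :: int
        proof -
          have "2 \<le> \<bar>j\<bar>" using that by linarith
          then have "2\<^sup>2 \<le> \<bar>j\<bar>\<^sup>2" by (intro power_mono) auto
          then show ?thesis by simp
        qed
        have sq1: "j\<^sup>2 \<ge> 1" if "j \<noteq> 0" for j :: int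
          using zero_less_power2[of j] that by linarith
        have "(k $ 1)\<^sup>2 + (k $ 2)\<^sup>2 \<ge> 5"
          using False nz sq[of "k $ 1"] sq[of "k $ 2"] sq1[of "k $ 1"] sq1[of "k $ 2"] by (auto simp: corner_modes_def)
        then have "real_of_int ((k $ 1)\<^sup>2 + (k $ 2)\<^sup>2) \<ge> 5" by linarith
        then have n5: "(freq_norm k)\<^sup>2 \<ge> 5" by (simp add: norm_2_sq)
        \<comment> \<open>Half of the exponent already reaches the corner rate 2 \<tau>; the other
          half makes the series converge.\<close>
        have "\<tau> * 4 \<le> \<tau> * (freq_norm k)\<^sup>2" using n5 t by (intro mult_left_mono) auto
        then have ex: "exp (- \<tau> * (freq_norm k)\<^sup>2) \<le> exp (- 2 * \<tau>) * exp (- \<tau> * (freq_norm k)\<^sup>2 / 2)"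
          by (simp flip: exp_add)
        have "norm (a k) \<le> \<beta> * ((real_of_int (k $ 1))\<^sup>2 * (real_of_int (k $ 2))\<^sup>2)" using bound[of k] by (simp add: mult.assoc)
        also have "\<dots> \<le> \<beta> * ((freq_norm k)\<^sup>2 * (freq_norm k)\<^sup>2)"
          by (intro mult_left_mono mult_mono \<beta>) (auto simp: norm_2_sq)
        also have "\<dots> = \<beta> * freq_norm k ^ 4" by (simp flip: power_add)
        finally have "norm (heat \<tau> a k * character k 0) \<le> (exp (- 2 * \<tau>) * exp (- \<tau> * (freq_norm k)\<^sup>2 / 2)) * (\<beta> * freq_norm k ^ 4)"
          unfolding heat_def norm_mult using ex by (auto intro!: mult_mono)
        also have "\<dots> = ?e * (exp (- \<tau> * (freq_norm k)\<^sup>2 / 2) * freq_norm k ^ 4)" by (simp add: mult_ac)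
        also have "\<dots> \<le> ?e * (65536 / \<tau> ^ 4 * (1 / (1 + freq_norm k) ^ 4))"
          using \<beta> t by (intro mult_left_mono exp_freq_norm_le k0) auto
        finally show ?thesis .
      qed
      then have "- (?e * (65536 / \<tau> ^ 4 * (1 / (1 + freq_norm k) ^ 4))) \<le> Re (heat \<tau> a k * character k 0)"
        using abs_Re_le_cmod[of "heat \<tau> a k * character k 0"] by linarith
      then show ?thesis using False by simp
    qed
  qed
  moreover have "65536 / \<tau> ^ 4 * lattice_sum \<le> 2"
  proof -
    have "\<tau> \<le> \<tau> ^ 4" using t by (simp add: self_le_power)
    then have "65536 * lattice_sum \<le> 2 * \<tau> ^ 4" using t by linarith
    then show ?thesis using t by (simp add: field_simps)
  qed
  then have "?e * 2 \<le> ?e * (4 - 65536 / \<tau> ^ 4 * lattice_sum)" using \<beta> by (intro mult_left_mono) auto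
  ultimately show ?thesis by simp
qed

section \<open>Real Fourier series and the velocity field\<close>

definition rseries :: "(int^2 \<Rightarrow> complex) \<Rightarrow> plane \<Rightarrow> real" where
  "rseries a x = Re (fseries a x)"

lemma rseries_has_derivative:
  assumes "rapid a"
  shows "(rseries a has_derivative (\<lambda>h. (h $ 1) * rseries (fderiv 1 a) x + (h $ 2) * rseries (fderiv 2 a) x)) (at x)"
  using bounded_linear.has_derivative[OF bounded_linear_Re fseries_has_derivative[OF assms]]
  by (simp add: rseries_def[abs_def])

lemma frechet_rseries:
  "rapid a \<Longrightarrow> frechet_derivative (rseries a) (at x) =
     (\<lambda>h. (h $ 1) * rseries (fderiv 1 a) x + (h $ 2) * rseries (fderiv 2 a) x)"
  by (rule frechet_derivative_at[symmetric]) (rule rseries_has_derivative)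

lemma partial_rseries: "rapid a \<Longrightarrow> partial i (rseries a) = rseries (fderiv i a)"
  using exhaust_2[of i] by (auto simp: fun_eq_iff partial_def frechet_rseries axis_def)

lemma continuous_on_rseries [continuous_intros]: "rapid a \<Longrightarrow> continuous_on S (rseries a)"
  unfolding rseries_def[abs_def] by (intro continuous_intros continuous_on_fseries)

lemma periodic_rseries: "periodic (rseries a)"
  by (simp add: periodic_def rseries_def fseries_periodic)

lemma rseries_periodic: "rseries a (x + (2 * pi) *\<^sub>R ax i) = rseries a x"
  by (simp add: rseries_def fseries_periodic)

lemma rseries_dir_deriv: "rapid a \<Longrightarrow> has_dir_deriv i (rseries a) (rseries (fderiv i a))"
  using fseries_dir_deriv[of a i]
  by (simp add: has_dir_deriv_def rseries_def[abs_def] has_vector_derivative_complex_iff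
      has_real_derivative_iff_has_vector_derivative)

lemma abs_rseries_le: "rapid a \<Longrightarrow> \<bar>rseries a x\<bar> \<le> (\<Sum>\<^sub>\<infinity>k. norm (a k))"
  unfolding rseries_def using norm_fseries_le abs_Re_le_cmod order_trans by blast

definition herm :: "(int^2 \<Rightarrow> complex) \<Rightarrow> bool" where
  "herm a \<longleftrightarrow> (\<forall>k. a (- k) = cnj (a k))"

lemma herm_fderiv: "herm a \<Longrightarrow> herm (fderiv i a)"
  by (simp add: herm_def fderiv_def)

lemma herm_riesz: "herm a \<Longrightarrow> herm (riesz s a)"
  by (simp add: herm_def riesz_def)

lemma bij_uminus_freq: "bij_betw uminus (UNIV :: (int^2) set) UNIV"
  by (rule bij_betwI[where g = uminus]) auto

lemma fseries_herm:
  assumes "rapid a" "herm a"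
  shows "fseries a x = of_real (rseries a x)"
proof -
  have "cnj (fseries a x) = (\<Sum>\<^sub>\<infinity>k. cnj (a k * character k x))"
    unfolding fseries_def by (rule infsum_cnj[symmetric])
  also have "\<dots> = (\<Sum>\<^sub>\<infinity>k. a (- k) * character (- k) x)"
    using assms(2) by (simp add: herm_def cnj_character)
  also have "\<dots> = fseries a x"
    unfolding fseries_def by (rule infsum_reindex_bij_betw[OF bij_uminus_freq])
  finally show ?thesis by (simp add: complex_eq_iff rseries_def)
qed

lemma fourier_coeff_real:
  assumes f: "continuous_on UNIV f" "periodic f" and r: "rapid (fourier_coeff f)"
  shows "herm (fourier_coeff f)" "f = rseries (fourier_coeff f)"
proof -
  have eq: "fourier_coeff f = fcoeff (\<lambda>x. of_real (f x))"
    using fourier_coeff_eq_fcoeff[OF f(1)] by auto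
  have "cnj (fcoeff (\<lambda>x. of_real (f x)) k) = fcoeff (\<lambda>x. of_real (f x)) (- k)" for k
    by (simp add: fcoeff_def cell_int_def integral_cnj cnj_character)
  then show "herm (fourier_coeff f)" by (simp add: herm_def eq)
  have "of_real (f x) = fseries (fourier_coeff f) x" for x
    using fourier_inversion[of "\<lambda>x. of_real (f x)" x] f r
    by (simp add: eq periodic_def continuous_on_of_real)
  then have "f x = rseries (fourier_coeff f) x" for x
    unfolding rseries_def by (metis Re_complex_of_real)
  then show "f = rseries (fourier_coeff f)" by auto
qed

lemma frac_laplacian_eq_rseries: "frac_laplacian s f = rseries (riesz s (fourier_coeff f))"
proof
  fix x
  have "(\<Sum>\<^sub>\<infinity>k\<in>-{0}. complex_of_real (freq_norm k powr (2 * s)) * fourier_coeff f k * cis (wavevector k \<bullet> x)) =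
    (\<Sum>\<^sub>\<infinity>k. riesz s (fourier_coeff f) k * character k x)"
    by (rule infsum_cong_neutral) (auto simp: riesz_def character_def)
  then show "frac_laplacian s f x = rseries (riesz s (fourier_coeff f)) x"
    by (simp add: frac_laplacian_def rseries_def fseries_def)
qed

definition vel1 :: "real \<Rightarrow> (int^2 \<Rightarrow> complex) \<Rightarrow> plane \<Rightarrow> real" where
  "vel1 s c x = - rseries (fderiv 2 (riesz s c)) x"

definition vel2 :: "real \<Rightarrow> (int^2 \<Rightarrow> complex) \<Rightarrow> plane \<Rightarrow> real" where
  "vel2 s c x = rseries (fderiv 1 (riesz s c)) x"

lemma velocity_inner:
  assumes "rapid (fourier_coeff f)" "\<alpha> \<le> 1"
  shows "velocity \<alpha> f x \<bullet> v = vel1 (- 1 + \<alpha>) (fourier_coeff f) x * v $ 1 + vel2 (- 1 + \<alpha>) (fourier_coeff f) x * v $ 2"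
  using partial_rseries[OF rapid_riesz[OF assms(1), of "- 1 + \<alpha>"]] assms(2)
  by (simp add: velocity_def grad_perp_def frac_laplacian_eq_rseries vel1_def vel2_def inner_2)

text \<open>Two arguments, the source \<open>c\<close> of the velocity and the transported
  \<open>d\<close>, because the uniqueness proof needs the polarised nonlinearity.\<close>

definition vel_dot_grad :: "real \<Rightarrow> (int^2 \<Rightarrow> complex) \<Rightarrow> (int^2 \<Rightarrow> complex) \<Rightarrow> plane \<Rightarrow> real" where
  "vel_dot_grad s c d x = vel1 s c x * rseries (fderiv 1 d) x + vel2 s c x * rseries (fderiv 2 d) x"

lemma continuous_on_vel [continuous_intros]:
  assumes "rapid c" "s \<le> 0"
  shows "continuous_on S (vel1 s c)" "continuous_on S (vel2 s c)"
  unfolding vel1_def[abs_def] vel2_def[abs_def]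
  by (intro continuous_intros rapid_fderiv rapid_riesz assms)+

lemma continuous_on_vel_dot_grad [continuous_intros]:
  assumes "rapid c" "rapid d" "s \<le> 0"
  shows "continuous_on S (vel_dot_grad s c d)"
  unfolding vel_dot_grad_def[abs_def] by (intro continuous_intros rapid_fderiv assms)

lemma fderiv_commute: "fderiv i (fderiv j a) = fderiv j (fderiv i a)"
  by (simp add: fderiv_def fun_eq_iff mult_ac)

lemma has_dir_deriv_minus: "has_dir_deriv i f f' \<Longrightarrow> has_dir_deriv i (\<lambda>x. - f x) (\<lambda>x. - f' x)"
  by (auto simp: has_dir_deriv_def intro!: derivative_intros)

text \<open>The velocity is divergence free, so the integrand is half the divergence of the velocity
  times the square of the transported function. The two copies of the mixed derivative
  \<open>?q\<close> cancel.\<close>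

lemma transport_orthogonal:
  assumes c: "rapid c" and e: "rapid e" and s: "s \<le> 0"
  shows "cell_int (\<lambda>x. rseries c x * vel_dot_grad s e c x) = 0"
proof -
  note r = c rapid_riesz[OF e s] rapid_fderiv
  let ?q = "rseries (fderiv 1 (fderiv 2 (riesz s e)))"
  have "has_dir_deriv 1 (\<lambda>x. vel1 s e x * (rseries c x * rseries c x))
     (\<lambda>x. vel1 s e x * (rseries c x * rseries (fderiv 1 c) x + rseries (fderiv 1 c) x * rseries c x) + (- ?q x) * (rseries c x * rseries c x))"
    unfolding vel1_def by (intro has_dir_deriv_mult has_dir_deriv_minus rseries_dir_deriv r)
  then have 1: "cell_int (\<lambda>x. vel1 s e x * (rseries c x * rseries (fderiv 1 c) x + rseries (fderiv 1 c) x * rseries c x) + (- ?q x) * (rseries c x * rseries c x)) = 0"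
    by (rule cell_int_dir_deriv_eq_0) (auto intro!: continuous_intros r s e simp: vel1_def rseries_periodic)
  have "has_dir_deriv 2 (\<lambda>x. vel2 s e x * (rseries c x * rseries c x))
     (\<lambda>x. vel2 s e x * (rseries c x * rseries (fderiv 2 c) x + rseries (fderiv 2 c) x * rseries c x) + ?q x * (rseries c x * rseries c x))"
    unfolding vel2_def fderiv_commute[of 1 2] by (intro has_dir_deriv_mult rseries_dir_deriv r)
  then have 2: "cell_int (\<lambda>x. vel2 s e x * (rseries c x * rseries (fderiv 2 c) x + rseries (fderiv 2 c) x * rseries c x) + ?q x * (rseries c x * rseries c x)) = 0"
    by (rule cell_int_dir_deriv_eq_0) (auto intro!: continuous_intros r s e simp: vel2_def rseries_periodic)
  have "cell_int (\<lambda>x. 2 * (rseries c x * vel_dot_grad s e c x)) =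
    cell_int (\<lambda>x. (vel1 s e x * (rseries c x * rseries (fderiv 1 c) x + rseries (fderiv 1 c) x * rseries c x) + (- ?q x) * (rseries c x * rseries c x))
      + (vel2 s e x * (rseries c x * rseries (fderiv 2 c) x + rseries (fderiv 2 c) x * rseries c x) + ?q x * (rseries c x * rseries c x)))"
    by (simp add: vel_dot_grad_def algebra_simps)
  also have "\<dots> = 0"
    by (subst cell_int_add) (auto intro!: continuous_intros r s e simp only: 1 2 add_0)
  finally show ?thesis by (simp add: cell_int_cmult_right_real)
qed

lemma fcoeff_rseries:
  assumes "rapid c" "herm c"
  shows "cell_int (\<lambda>x. of_real (rseries c x) * character k x) = of_real ((2 * pi)\<^sup>2) * c (- k)"
  using fcoeff_fseries[OF assms(1), of "- k"] fseries_herm[OF assms] by (simp add: fcoeff_def field_simps)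

lemma parseval:
  assumes c: "rapid c" "herm c"
  shows "((\<lambda>k. (norm (c k))\<^sup>2) has_sum cell_int (\<lambda>x. (rseries c x)\<^sup>2) / (2 * pi)\<^sup>2) UNIV"
proof -
  have "((\<lambda>k. c k * cell_int (\<lambda>x. of_real (rseries c x) * character k x)) has_sum
      cell_int (\<lambda>x. of_real (rseries c x) * fseries c x)) UNIV"
    by (intro has_sum_cell_int_fseries c continuous_intros)
  moreover have "cell_int (\<lambda>x. of_real (rseries c x) * fseries c x) = of_real (cell_int (\<lambda>x. (rseries c x)\<^sup>2))"
    unfolding fseries_herm[OF c]
    by (subst cell_int_of_real[symmetric]) (auto intro!: continuous_intros c simp: power2_eq_square)
  moreover have "c k * cell_int (\<lambda>x. of_real (rseries c x) * character k x) = of_real ((2 * pi)\<^sup>2 * (norm (c k))\<^sup>2)" for k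
    unfolding fcoeff_rseries[OF c] using c(2) complex_norm_square[of "c k"] by (simp add: herm_def)
  ultimately have "((\<lambda>k. complex_of_real ((2 * pi)\<^sup>2 * (norm (c k))\<^sup>2)) has_sum of_real (cell_int (\<lambda>x. (rseries c x)\<^sup>2))) UNIV"
    by simp
  then have "((\<lambda>k. (2 * pi)\<^sup>2 * (norm (c k))\<^sup>2) has_sum (cell_int (\<lambda>x. (rseries c x)\<^sup>2))) UNIV"
    by (simp only: has_sum_of_real_iff)
  from has_sum_divide_const[OF this, of "(2 * pi)\<^sup>2"] show ?thesis by simp
qed

section \<open>The commutator estimate\<close>

lemma powr_neg_diff_le:
  fixes a b p :: real
  assumes "1 \<le> a" "a \<le> b" "0 \<le> p" "p \<le> 2"
  shows "0 \<le> a powr (- p) - b powr (- p)" "a powr (- p) - b powr (- p) \<le> 2 * (b - a) / a"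
proof -
  show "0 \<le> a powr (- p) - b powr (- p)" using assms powr_mono2'[of "- p" a b] by simp
  have r: "0 < a / b" "a / b \<le> 1" using assms by auto
  \<comment> \<open>As a/b \<le> 1 and p \<le> 2, the exponent may be replaced by 2, and 1 - x^2
    \<le> 2 (1 - x): hence the constant 2, uniform in p.\<close>
  have "(a / b)\<^sup>2 = (a / b) powr 2" using r by simp
  also have "\<dots> \<le> (a / b) powr p" using r assms by (intro powr_mono') auto
  finally have 1: "1 - (a / b) powr p \<le> 1 - (a / b)\<^sup>2" by simp
  have 2: "1 - (a / b)\<^sup>2 \<le> 2 * (1 - a / b)"
    using zero_le_power2[of "1 - a / b"] by (simp add: power2_eq_square algebra_simps)
  have "a powr (- p) - b powr (- p) = a powr (- p) * (1 - (a / b) powr p)"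
    using assms by (simp add: powr_divide powr_minus field_simps)
  also have "\<dots> \<le> 1 * (1 - (a / b) powr p)"
  proof (intro mult_right_mono)
    show "a powr (- p) \<le> 1" using assms powr_mono[of "- p" 0 a] by simp
    show "0 \<le> 1 - (a / b) powr p" using r assms powr_mono'[of 0 p "a / b"] by simp
  qed
  also have "\<dots> \<le> 2 * (1 - a / b)" using 1 2 by simp
  also have "\<dots> = 2 * (b - a) / b" using assms by (simp add: field_simps)
  also have "\<dots> \<le> 2 * (b - a) / a" using assms by (intro divide_left_mono) auto
  finally show "a powr (- p) - b powr (- p) \<le> 2 * (b - a) / a" .
qed

text \<open>Up to sign, the symbol of the Jacobian bracket of a stream function at frequency k with
  a function at frequency l. Its antisymmetry produces the commutator.\<close>

definition cross :: "int^2 \<Rightarrow> int^2 \<Rightarrow> real" where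
  "cross k l = of_int (k $ 1 * l $ 2 - k $ 2 * l $ 1)"

lemma cross_swap: "cross l k = - cross k l"
  by (simp add: cross_def)

lemma cross_0 [simp]: "cross 0 l = 0" "cross l 0 = 0"
  by (simp_all add: cross_def)

lemma abs_cross_le: "\<bar>cross k l\<bar> \<le> freq_norm k * freq_norm l"
proof -
  have "(cross k l)\<^sup>2 \<le> (freq_norm k)\<^sup>2 * (freq_norm l)\<^sup>2"
    using zero_le_power2[of "real_of_int (k $ 1) * real_of_int (l $ 1) + real_of_int (k $ 2) * real_of_int (l $ 2)"]
    unfolding cross_def norm_2_sq by (simp add: power2_eq_square algebra_simps)
  then have "(cross k l)\<^sup>2 \<le> (freq_norm k * freq_norm l)\<^sup>2" by (simp add: power_mult_distrib)
  then show ?thesis unfolding abs_le_square_iff[symmetric] by (simp add: abs_mult)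
qed

text \<open>Let k be the shorter vector. The symbols differ by at most 2 |k + l| / |k|, while
  \<open>cross k l = cross k (k + l)\<close> is at most |k| |k + l|, and |k| cancels. The bound
  involves only k + l, the frequency of the smooth factor, whatever s is.\<close>

lemma symbol_commutator:
  assumes s: "- 1 \<le> s" "s \<le> 0"
  shows "\<bar>(freq_norm k powr (2 * s) - freq_norm l powr (2 * s)) * cross k l\<bar> \<le> 2 * (freq_norm (k + l))\<^sup>2"
proof -
  have *: "\<bar>(freq_norm k powr (2 * s) - freq_norm l powr (2 * s)) * cross k l\<bar> \<le> 2 * (freq_norm (k + l))\<^sup>2"
    if kl: "k \<noteq> 0" "freq_norm k \<le> freq_norm l" for k l
  proof -
    have n: "1 \<le> freq_norm k" using freq_norm_ge_1[OF kl(1)] .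
    have "cross k l = cross k (k + l)" by (simp add: cross_def algebra_simps)
    then have c: "\<bar>cross k l\<bar> \<le> freq_norm k * freq_norm (k + l)" using abs_cross_le[of k "k + l"] by simp
    have tri: "freq_norm l - freq_norm k \<le> freq_norm (k + l)"
      using norm_triangle_ineq4[of "wavevector (k + l)" "wavevector k"] by simp
    have "\<bar>freq_norm k powr (2 * s) - freq_norm l powr (2 * s)\<bar> \<le> 2 * (freq_norm l - freq_norm k) / freq_norm k"
      using powr_neg_diff_le[OF n kl(2), of "- 2 * s"] s by simp
    also have "\<dots> \<le> 2 * freq_norm (k + l) / freq_norm k"
      using tri n by (intro divide_right_mono) auto
    finally have "\<bar>freq_norm k powr (2 * s) - freq_norm l powr (2 * s)\<bar> * \<bar>cross k l\<bar> \<le>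
       (2 * freq_norm (k + l) / freq_norm k) * (freq_norm k * freq_norm (k + l))"
      using c by (intro mult_mono) auto
    also have "\<dots> = 2 * (freq_norm (k + l))\<^sup>2"
    proof -
      have "freq_norm k \<noteq> 0" using n by linarith
      then show ?thesis by (simp only: power2_eq_square) simp
    qed
    finally show ?thesis by (simp only: abs_mult)
  qed
  show ?thesis
  proof (cases "k = 0 \<or> l = 0")
    case False
    show ?thesis
    proof (cases "freq_norm k \<le> freq_norm l")
      case True then show ?thesis using * False by blast
    next
      case le: False
      then have "\<bar>(freq_norm l powr (2 * s) - freq_norm k powr (2 * s)) * cross l k\<bar> \<le> 2 * (freq_norm (l + k))\<^sup>2"
        using False by (intro *) auto
      then show ?thesis by (simp add: cross_swap[of l k] abs_mult abs_minus_commute add.commute)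
    qed
  qed auto
qed


text \<open>
  Integrating by parts makes the form antisymmetric up to a commutator of the Riesz potential with
  multiplication, which is of order zero by \<open>symbol_commutator\<close>.
\<close>

lemma stretching_bound:
  assumes c: "rapid c" "herm c" and d: "rapid d" "herm d" and s: "- 1 \<le> s" "s \<le> 0"
  shows "\<bar>cell_int (\<lambda>x. rseries c x * vel_dot_grad s c d x)\<bar>
     \<le> (\<Sum>\<^sub>\<infinity>m. (freq_norm m)\<^sup>2 * norm (d m)) * cell_int (\<lambda>x. (rseries c x)\<^sup>2)"
proof -
  let ?J = "cell_int (\<lambda>x. rseries c x * vel_dot_grad s c d x)"
  let ?P = "complex_of_real ((2 * pi)\<^sup>2)"
  define w where "w k = freq_norm k powr (2 * s)" for k
  define G where "G k l = of_real (w k * cross k l) * (c k * c l * d (- (k + l)))" for k l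
  have w1: "0 \<le> w k" "w k \<le> 1" for k using freq_symbol_le_1[OF s(2)] by (auto simp: w_def)
  note rc = rapid_riesz[OF c(1) s(2)] 
  have tm: "((\<lambda>k. fderiv i (riesz s c) k * (\<Sum>\<^sub>\<infinity>m. fderiv j d m * (?P * c (- (k + m))))) has_sum
      cell_int (\<lambda>x. (of_real (rseries c x) * fseries (fderiv j d) x) * fseries (fderiv i (riesz s c)) x)) UNIV" for i j
  proof -
    have inner: "cell_int (\<lambda>x. of_real (rseries c x) * fseries (fderiv j d) x * character k x) =
        (\<Sum>\<^sub>\<infinity>m. fderiv j d m * (?P * c (- (k + m))))" for k
    proof -
      have "((\<lambda>m. fderiv j d m * cell_int (\<lambda>x. (of_real (rseries c x) * character k x) * character m x)) has_sum
         cell_int (\<lambda>x. (of_real (rseries c x) * character k x) * fseries (fderiv j d) x)) UNIV"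
        by (intro has_sum_cell_int_fseries rapid_fderiv d continuous_intros c)
      moreover have "cell_int (\<lambda>x. (of_real (rseries c x) * character k x) * character m x) = ?P * c (- (k + m))" for m
        unfolding mult.assoc character_mult by (rule fcoeff_rseries[OF c])
      ultimately show ?thesis by (simp add: infsumI mult_ac)
    qed
    show ?thesis
      unfolding inner[symmetric] by (intro has_sum_cell_int_fseries rapid_fderiv rc d continuous_intros c continuous_on_fseries)
  qed
  have split: "complex_of_real ?J =
      cell_int (\<lambda>x. (of_real (rseries c x) * fseries (fderiv 2 d) x) * fseries (fderiv 1 (riesz s c)) x)
    - cell_int (\<lambda>x. (of_real (rseries c x) * fseries (fderiv 1 d) x) * fseries (fderiv 2 (riesz s c)) x)"
    unfolding fseries_herm[OF rapid_fderiv[OF d(1)] herm_fderiv[OF d(2)]]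
      fseries_herm[OF rapid_fderiv[OF rc] herm_fderiv[OF herm_riesz[OF c(2)]]]
    by (subst cell_int_diff[symmetric], (intro continuous_intros c d rapid_fderiv rc)+,
        subst cell_int_of_real[symmetric], (intro continuous_intros c d s)+)
       (simp add: vel_dot_grad_def vel1_def vel2_def algebra_simps)
  have dsum: "(\<lambda>m. fderiv j d m * (?P * c (- (k + m)))) summable_on UNIV" for j k
  proof -
    obtain B where B: "\<And>k. norm (c k) \<le> B"
      using finite_sum_le_infsum[OF rapid_abs_summable[OF c(1)], of "{_}"] by fastforce
    show ?thesis
    proof (rule norm_infsum_mono(1))
      show "(\<lambda>m. norm (fderiv j d m) * (norm ?P * B)) summable_on UNIV"
        by (intro summable_on_cmult_left rapid_abs_summable rapid_fderiv d)
      show "norm (fderiv j d m * (?P * c (- (k + m)))) \<le> norm (fderiv j d m) * (norm ?P * B)" for m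
        unfolding norm_mult by (intro mult_left_mono B) auto
    qed
  qed
  have "((\<lambda>k. fderiv 1 (riesz s c) k * (\<Sum>\<^sub>\<infinity>m. fderiv 2 d m * (?P * c (- (k + m))))
      - fderiv 2 (riesz s c) k * (\<Sum>\<^sub>\<infinity>m. fderiv 1 d m * (?P * c (- (k + m))))) has_sum of_real ?J) UNIV"
    unfolding split by (intro has_sum_diff tm)
  moreover have "fderiv 1 (riesz s c) k * (\<Sum>\<^sub>\<infinity>m. fderiv 2 d m * (?P * c (- (k + m))))
      - fderiv 2 (riesz s c) k * (\<Sum>\<^sub>\<infinity>m. fderiv 1 d m * (?P * c (- (k + m)))) = ?P * (\<Sum>\<^sub>\<infinity>l. G k l)" for k
  proof -
    have "((\<lambda>m. fderiv 1 (riesz s c) k * (fderiv 2 d m * (?P * c (- (k + m)))) - fderiv 2 (riesz s c) k * (fderiv 1 d m * (?P * c (- (k + m)))))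
        has_sum (fderiv 1 (riesz s c) k * (\<Sum>\<^sub>\<infinity>m. fderiv 2 d m * (?P * c (- (k + m))))
      - fderiv 2 (riesz s c) k * (\<Sum>\<^sub>\<infinity>m. fderiv 1 d m * (?P * c (- (k + m)))))) UNIV"
      by (intro has_sum_diff has_sum_cmult_right has_sum_infsum dsum)
    then have "fderiv 1 (riesz s c) k * (\<Sum>\<^sub>\<infinity>m. fderiv 2 d m * (?P * c (- (k + m))))
      - fderiv 2 (riesz s c) k * (\<Sum>\<^sub>\<infinity>m. fderiv 1 d m * (?P * c (- (k + m)))) =
      (\<Sum>\<^sub>\<infinity>m. fderiv 1 (riesz s c) k * (fderiv 2 d m * (?P * c (- (k + m)))) - fderiv 2 (riesz s c) k * (fderiv 1 d m * (?P * c (- (k + m)))))"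
      by (simp add: infsumI)
    also have "\<dots> = (\<Sum>\<^sub>\<infinity>m. ?P * (- of_real (w k * cross k m) * (c k * c (- (k + m)) * d m)))"
      by (intro infsum_cong) (simp add: fderiv_def riesz_def w_def cross_def algebra_simps)
    \<comment> \<open>Substituting m = -(k + l) gives the two factors \<open>c\<close> the free
      frequencies k and l, so that exchanging them becomes a symmetry of the double sum.\<close>
    also have "\<dots> = (\<Sum>\<^sub>\<infinity>l. ?P * (- of_real (w k * cross k (- (k + l))) * (c k * c (- (k + (- (k + l)))) * d (- (k + l)))))"
      by (rule infsum_reindex_bij_betw[symmetric, of "\<lambda>l. - (k + l)"])
         (rule bij_betwI[where g = "\<lambda>l. - (k + l)"], auto)
    also have "\<dots> = (\<Sum>\<^sub>\<infinity>l. ?P * G k l)"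
      by (intro infsum_cong) (simp add: G_def cross_def algebra_simps)
    finally show ?thesis by (simp add: infsum_cmult_right')
  qed
  ultimately have J: "((\<lambda>k. ?P * (\<Sum>\<^sub>\<infinity>l. G k l)) has_sum of_real ?J) UNIV" by simp
  obtain B where B: "\<And>k. norm (d k) \<le> B"
    using finite_sum_le_infsum[OF rapid_abs_summable[OF d(1)], of "{_}"] by fastforce
  let ?S = "\<lambda>k. freq_norm k * norm (c k)"
  have sS: "?S summable_on UNIV" using rapid_power_summable[OF c(1), of 1] by simp
  \<comment> \<open>A crude bound that loses derivatives of \<open>c\<close>; it serves to justify
    the exchange of the two sums.\<close>
  have Gle: "norm (G k l) \<le> B * (?S k * ?S l)" for k l
  proof -
    have "norm (G k l) = (w k * \<bar>cross k l\<bar>) * (norm (c k) * norm (c l) * norm (d (- (k + l))))"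
      using w1 by (simp add: G_def norm_mult abs_mult)
    also have "\<dots> \<le> (1 * (freq_norm k * freq_norm l)) * (norm (c k) * norm (c l) * B)"
      using w1 by (intro mult_mono abs_cross_le B) auto
    finally show ?thesis by (simp add: mult_ac)
  qed
  have pairs: "(\<lambda>p. B * (?S (fst p) * ?S (snd p))) summable_on UNIV \<times> UNIV"
  proof (intro summable_on_cmult_right summable_on_SigmaI)
    show "((\<lambda>l. ?S (fst (k, l)) * ?S (snd (k, l))) has_sum (?S k * (\<Sum>\<^sub>\<infinity>l. ?S l))) UNIV" for k
      unfolding fst_conv snd_conv by (intro has_sum_cmult_right has_sum_infsum sS)
    show "(\<lambda>k. ?S k * (\<Sum>\<^sub>\<infinity>l. ?S l)) summable_on UNIV"
      by (intro summable_on_cmult_left sS)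
  qed auto
  have Gs: "(\<lambda>(k, l). G k l) summable_on UNIV \<times> UNIV"
    by (rule norm_infsum_mono(1)[OF pairs]) (use Gle in auto)
  have Js: "complex_of_real ?J = ?P * (\<Sum>\<^sub>\<infinity>k. \<Sum>\<^sub>\<infinity>l. G k l)"
    using infsumI[OF J] by (simp add: infsum_cmult_right')
  have swap: "(\<Sum>\<^sub>\<infinity>k. \<Sum>\<^sub>\<infinity>l. G k l) = (\<Sum>\<^sub>\<infinity>k. \<Sum>\<^sub>\<infinity>l. G l k)"
    by (rule infsum_swap_banach[OF Gs])
  have pair_eq: "(\<Sum>\<^sub>\<infinity>k. \<Sum>\<^sub>\<infinity>l. G k l) = (\<Sum>\<^sub>\<infinity>(k, l)\<in>UNIV \<times> UNIV. G k l)"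
    by (rule infsum_Sigma'_banach[OF Gs])
  have Gs': "(\<lambda>(k, l). G l k) summable_on UNIV \<times> UNIV"
    using Gs by (subst summable_on_swap) (simp add: case_prod_unfold)
  have pair_eq': "(\<Sum>\<^sub>\<infinity>k. \<Sum>\<^sub>\<infinity>l. G l k) = (\<Sum>\<^sub>\<infinity>(k, l)\<in>UNIV \<times> UNIV. G l k)"
    by (rule infsum_Sigma'_banach[OF Gs'])
  have "2 * (\<Sum>\<^sub>\<infinity>k. \<Sum>\<^sub>\<infinity>l. G k l) = (\<Sum>\<^sub>\<infinity>(k, l)\<in>UNIV \<times> UNIV. G k l) + (\<Sum>\<^sub>\<infinity>(k, l)\<in>UNIV \<times> UNIV. G l k)"
    using swap pair_eq pair_eq' by simp
  also have "\<dots> = (\<Sum>\<^sub>\<infinity>p\<in>UNIV \<times> UNIV. (case p of (k, l) \<Rightarrow> G k l) + (case p of (k, l) \<Rightarrow> G l k))"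
    by (rule infsum_add[symmetric, OF Gs Gs'])
  finally have two: "2 * (\<Sum>\<^sub>\<infinity>k. \<Sum>\<^sub>\<infinity>l. G k l) = (\<Sum>\<^sub>\<infinity>p\<in>UNIV \<times> UNIV. (case p of (k, l) \<Rightarrow> G k l) + (case p of (k, l) \<Rightarrow> G l k))" .
  define D where "D = (\<Sum>\<^sub>\<infinity>m. (freq_norm m)\<^sup>2 * norm (d m))"
  define Ds where "Ds m = (freq_norm m)\<^sup>2 * norm (d m)" for m
  have hD: "(Ds has_sum D) UNIV"
    unfolding Ds_def[abs_def] D_def by (intro has_sum_infsum rapid_power_summable d)
  have hD': "((\<lambda>l. Ds (- (k + l))) has_sum D) UNIV" for k
    by (subst has_sum_reindex_bij_betw[of "\<lambda>l. - (k + l)" UNIV UNIV Ds D])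
       (auto intro!: bij_betwI[where g = "\<lambda>l. - (k + l)"] hD)
  define E where "E = cell_int (\<lambda>x. (rseries c x)\<^sup>2) / (2 * pi)\<^sup>2"
  have hE: "((\<lambda>k. (norm (c k))\<^sup>2) has_sum E) UNIV" unfolding E_def by (rule parseval[OF c])
  \<comment> \<open>The simplest case of Young's inequality: summing over l at fixed k leaves the
    total mass \<open>D\<close> of \<open>Ds\<close>.\<close>
  have A: "((\<lambda>(k, l). (norm (c k))\<^sup>2 * Ds (- (k + l))) has_sum (E * D)) (UNIV \<times> UNIV)"
  proof (rule has_sum_SigmaI)
    show inner: "((\<lambda>l. case (k, l) of (k, l) \<Rightarrow> (norm (c k))\<^sup>2 * Ds (- (k + l))) has_sum ((norm (c k))\<^sup>2 * D)) UNIV" for k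
      unfolding prod.case by (intro has_sum_cmult_right hD')
    show outer: "((\<lambda>k. (norm (c k))\<^sup>2 * D) has_sum (E * D)) UNIV"
      by (intro has_sum_cmult_left hE)
    show "(\<lambda>(k, l). (norm (c k))\<^sup>2 * Ds (- (k + l))) summable_on UNIV \<times> UNIV"
      by (rule summable_on_SigmaI[OF inner has_sum_imp_summable[OF outer]]) (simp add: Ds_def)
  qed
  have A': "((\<lambda>(k, l). (norm (c l))\<^sup>2 * Ds (- (l + k))) has_sum (E * D)) (UNIV \<times> UNIV)"
    using A by (subst has_sum_swap) (simp add: case_prod_unfold)
  have "norm (2 * (\<Sum>\<^sub>\<infinity>k. \<Sum>\<^sub>\<infinity>l. G k l)) \<le> E * D + E * D"
    unfolding two
  proof (rule norm_infsum_le[OF _ has_sum_add[OF A A']])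
    show "((\<lambda>p. (case p of (k, l) \<Rightarrow> G k l) + (case p of (k, l) \<Rightarrow> G l k)) has_sum
       (\<Sum>\<^sub>\<infinity>p\<in>UNIV \<times> UNIV. (case p of (k, l) \<Rightarrow> G k l) + (case p of (k, l) \<Rightarrow> G l k))) (UNIV \<times> UNIV)"
      by (intro has_sum_infsum summable_on_add Gs Gs')
    fix p :: "(int^2) \<times> (int^2)"
    obtain k l where p: "p = (k, l)" by (cases p)
    have "G k l + G l k = of_real ((w k - w l) * cross k l) * (c k * c l * d (- (k + l)))"
      by (simp add: G_def cross_swap[of l k] algebra_simps)
    then have "norm (G k l + G l k) = \<bar>(w k - w l) * cross k l\<bar> * (norm (c k) * norm (c l) * norm (d (- (k + l))))"
      by (simp add: norm_mult del: of_real_mult of_real_diff)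
    also have "\<dots> \<le> (2 * (freq_norm (k + l))\<^sup>2) * (norm (c k) * norm (c l) * norm (d (- (k + l))))"
      unfolding w_def by (intro mult_right_mono symbol_commutator s) auto
    also have "\<dots> = (2 * norm (c k) * norm (c l)) * Ds (- (k + l))"
      unfolding Ds_def wavevector_simps(2) norm_minus_cancel by (simp add: mult_ac)
    also have "\<dots> \<le> ((norm (c k))\<^sup>2 + (norm (c l))\<^sup>2) * Ds (- (k + l))"
      by (intro mult_right_mono sum_squares_bound) (auto simp: Ds_def)
    finally show "norm ((case p of (k, l) \<Rightarrow> G k l) + (case p of (k, l) \<Rightarrow> G l k)) \<le>
        (case p of (k, l) \<Rightarrow> (norm (c k))\<^sup>2 * Ds (- (k + l))) + (case p of (k, l) \<Rightarrow> (norm (c l))\<^sup>2 * Ds (- (l + k)))"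
      by (simp add: p algebra_simps)
  qed
  then have "norm (\<Sum>\<^sub>\<infinity>k. \<Sum>\<^sub>\<infinity>l. G k l) \<le> E * D" by (simp add: norm_mult mult.commute)
  then have "norm (complex_of_real ?J) \<le> (2 * pi)\<^sup>2 * (E * D)"
    unfolding Js norm_mult by (intro mult_mono) (auto simp: norm_power)
  then show ?thesis by (simp add: E_def D_def mult.commute)
qed

section \<open>Smooth solutions in Fourier variables\<close>

lemma Ck_on_cong:
  assumes "\<And>x. x \<in> S \<Longrightarrow> f x = g x" "Ck_on k S f"
  shows "Ck_on k S g"
  using assms
proof (induction k arbitrary: f g)
  case 0 then show ?case by (simp cong: continuous_on_cong)
next
  case (Suc k)
  from Suc.prems(2) obtain D where D: "\<And>x. x \<in> S \<Longrightarrow> (f has_derivative D x) (at x within S)"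
    "\<And>b. b \<in> Basis \<Longrightarrow> Ck_on k S (\<lambda>x. D x b)" unfolding Ck_on.simps by blast
  have "(g has_derivative D x) (at x within S)" if "x \<in> S" for x
    by (rule has_derivative_transform[OF that _ D(1)[OF that]]) (simp add: Suc.prems(1))
  then show ?case using D(2) by auto
qed

definition space_partial :: "2 \<Rightarrow> (real \<times> plane \<Rightarrow> real) \<Rightarrow> real \<times> plane \<Rightarrow> real" where
  "space_partial i g = (\<lambda>(t, x). partial i (\<lambda>y. g (t, y)) x)"

text \<open>Derivatives are taken within the slab, yet each time slice is a whole plane, so the
  spatial derivatives are two-sided also at the two end times.\<close>

lemma Ck_on_slice:
  fixes g :: "real \<times> plane \<Rightarrow> real"
  assumes g: "Ck_on (Suc k) ({0..T} \<times> UNIV) g"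
  shows "Ck_on k ({0..T} \<times> UNIV) (space_partial i g)"
    and "t \<in> {0..T} \<Longrightarrow> ((\<lambda>y. g (t, y)) has_derivative
      (\<lambda>h. h $ 1 * space_partial 1 g (t, x) + h $ 2 * space_partial 2 g (t, x))) (at x)"
proof -
  obtain D where D: "\<And>p. p \<in> {0..T} \<times> UNIV \<Longrightarrow> (g has_derivative D p) (at p within {0..T} \<times> UNIV)"
    "\<And>b. b \<in> Basis \<Longrightarrow> Ck_on k ({0..T} \<times> UNIV) (\<lambda>p. D p b)"
    using g unfolding Ck_on.simps by blast
  have sl: "((\<lambda>y. g (t, y)) has_derivative (\<lambda>h. h $ 1 * D (t, x) (0, ax 1) + h $ 2 * D (t, x) (0, ax 2))) (at x)"
    if t: "t \<in> {0..T}" for t x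
  proof -
    have d: "(g has_derivative D (t, x)) (at (t, x) within {0..T} \<times> UNIV)" using t by (intro D) auto
    have lin: "linear (D (t, x))" using d has_derivative_linear by blast
    have "(g has_derivative D (t, x)) (at (t, x) within (\<lambda>y. (t, y)) ` UNIV)"
      by (rule has_derivative_subset[OF d]) (use t in auto)
    moreover have "((\<lambda>y. (t, y)) has_derivative (\<lambda>h. (0, h))) (at x within UNIV)"
      by (auto intro!: derivative_eq_intros)
    ultimately have c1: "((\<lambda>y. g (t, y)) has_derivative (\<lambda>h. D (t, x) (0, h))) (at x within UNIV)"
      by (rule has_derivative_in_compose[rotated])
    have c2: "D (t, x) (0, h) = h $ 1 * D (t, x) (0, ax 1) + h $ 2 * D (t, x) (0, ax 2)" for h
    proof -
      have "(0::real, h) = (h $ 1) *\<^sub>R (0, ax 1) + (h $ 2) *\<^sub>R (0, ax 2)"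
        by (simp add: vec_eq_iff forall_2 axis_def)
      then show ?thesis by (simp only: linear_add[OF lin] linear_scale[OF lin]) simp
    qed
    show ?thesis by (rule has_derivative_eq_rhs[OF c1]) (rule ext, rule c2)
  qed
  have sp: "space_partial i g (t, x) = D (t, x) (0, ax i)" if "t \<in> {0..T}" for t x i
    using frechet_derivative_at[OF sl[OF that, of x], symmetric] exhaust_2[of i]
    by (auto simp: space_partial_def partial_def axis_def)
  have "(0, ax i) \<in> (Basis :: (real \<times> plane) set)"
    by (auto simp: Basis_prod_def Basis_vec_def)
  then show "Ck_on k ({0..T} \<times> UNIV) (space_partial i g)"
    using sp by (intro Ck_on_cong[OF _ D(2)]) auto
  show "t \<in> {0..T} \<Longrightarrow> ((\<lambda>y. g (t, y)) has_derivative
      (\<lambda>h. h $ 1 * space_partial 1 g (t, x) + h $ 2 * space_partial 2 g (t, x))) (at x)"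
    using sl sp by simp
qed

lemma smooth_on_space_partial:
  "smooth_on ({0..T} \<times> UNIV) g \<Longrightarrow> smooth_on ({0..T} \<times> UNIV) (space_partial i g)"
  unfolding smooth_on_def using Ck_on_slice(1) by blast

lemma smooth_on_continuous: "smooth_on S g \<Longrightarrow> continuous_on S g"
  unfolding smooth_on_def using Ck_on.simps(1) by blast

lemma smooth_slice_continuous:
  assumes "smooth_on ({0..T} \<times> UNIV) g" "t \<in> {0..T}"
  shows "continuous_on UNIV (\<lambda>x. g (t, x))"
  by (rule continuous_on_compose2[OF smooth_on_continuous[OF assms(1)]]) (auto intro!: continuous_intros assms)

lemma smooth_slice_dir_deriv:
  assumes "smooth_on ({0..T} \<times> UNIV) g" "t \<in> {0..T}"
  shows "has_dir_deriv i (\<lambda>x. g (t, x)) (\<lambda>x. space_partial i g (t, x))"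
  unfolding has_dir_deriv_def has_vector_derivative_def
proof
  fix x
  have "Ck_on (Suc 0) ({0..T} \<times> UNIV) g" using assms by (auto simp: smooth_on_def simp del: Ck_on.simps)
  from Ck_on_slice(2)[OF this assms(2), of "x + 0 *\<^sub>R ax i"]
  have "((\<lambda>y. g (t, y)) has_derivative (\<lambda>h. h $ 1 * space_partial 1 g (t, x) + h $ 2 * space_partial 2 g (t, x))) (at (x + 0 *\<^sub>R ax i))"
    by simp
  moreover have "((\<lambda>h. x + h *\<^sub>R ax i) has_derivative (\<lambda>h. h *\<^sub>R ax i)) (at 0)"
    by (auto intro!: derivative_eq_intros)
  ultimately have "((\<lambda>h. g (t, x + h *\<^sub>R ax i)) has_derivative
     (\<lambda>h. (h *\<^sub>R ax i) $ 1 * space_partial 1 g (t, x) + (h *\<^sub>R ax i) $ 2 * space_partial 2 g (t, x))) (at 0)"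
    by (rule has_derivative_compose[rotated])
  moreover have "(\<lambda>h. (h *\<^sub>R ax i) $ 1 * space_partial 1 g (t, x) + (h *\<^sub>R ax i) $ 2 * space_partial 2 g (t, x)) =
      (\<lambda>h. h *\<^sub>R space_partial i g (t, x))"
    using exhaust_2[of i] by (auto simp: axis_def)
  ultimately show "((\<lambda>h. g (t, x + h *\<^sub>R ax i)) has_derivative (\<lambda>h. h *\<^sub>R space_partial i g (t, x))) (at 0)" by simp
qed

lemma periodic_space_partial:
  assumes g: "smooth_on ({0..T} \<times> UNIV) g" "t \<in> {0..T}" "periodic (\<lambda>x. g (t, x))"
  shows "periodic (\<lambda>x. space_partial i g (t, x))"
  unfolding periodic_def
proof (intro allI)
  fix x j
  have d: "((\<lambda>h. g (t, y + h *\<^sub>R ax i)) has_vector_derivative space_partial i g (t, y)) (at 0)" for y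
    using smooth_slice_dir_deriv[OF g(1,2), of i] by (simp add: has_dir_deriv_def)
  have "g (t, x + (2 * pi) *\<^sub>R ax j + h *\<^sub>R ax i) = g (t, x + h *\<^sub>R ax i)" for h
    using g(3)[unfolded periodic_def, rule_format, of "x + h *\<^sub>R ax i" j] by (simp add: add_ac)
  then show "space_partial i g (t, x + (2 * pi) *\<^sub>R ax j) = space_partial i g (t, x)"
    using d[of "x + (2 * pi) *\<^sub>R ax j"] d[of x] by (simp add: vector_derivative_unique_at)
qed

lemma fourier_coeff_space_partial:
  assumes g: "smooth_on ({0..T} \<times> UNIV) g" "t \<in> {0..T}" "periodic (\<lambda>x. g (t, x))"
  shows "fourier_coeff (\<lambda>x. space_partial i g (t, x)) k = \<i> * of_int (k $ i) * fourier_coeff (\<lambda>x. g (t, x)) k"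
proof -
  note c = smooth_slice_continuous[OF g(1,2)] smooth_slice_continuous[OF smooth_on_space_partial[OF g(1)] g(2)]
  show ?thesis
    unfolding fourier_coeff_eq_fcoeff[OF c(1)] fourier_coeff_eq_fcoeff[OF c(2)]
    by (rule fcoeff_dir_deriv[OF has_dir_deriv_of_real[OF smooth_slice_dir_deriv[OF g(1,2)]]])
       (use g(3) c in \<open>auto simp: periodic_def intro!: continuous_intros\<close>)
qed

text \<open>Each spatial derivative gains a factor \<open>k $ i\<close>; the bound is uniform in
  time because the time interval times the cell is compact.\<close>

lemma smooth_fourier_component_bound:
  fixes g :: "real \<times> plane \<Rightarrow> real"
  assumes g: "smooth_on ({0..T} \<times> UNIV) g" "\<And>t. t \<in> {0..T} \<Longrightarrow> periodic (\<lambda>x. g (t, x))"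
  shows "\<exists>C. \<forall>t\<in>{0..T}. \<forall>k. \<bar>real_of_int (k $ i)\<bar> ^ n * norm (fourier_coeff (\<lambda>x. g (t, x)) k) \<le> C"
  using g
proof (induction n arbitrary: g)
  case 0
  have "compact ({0..T} \<times> cell)" by (intro compact_Times compact_Icc compact_cell)
  moreover have "continuous_on ({0..T} \<times> cell) g"
    using smooth_on_continuous[OF 0(1)] by (rule continuous_on_subset) auto
  ultimately have "bounded (g ` ({0..T} \<times> cell))"
    by (intro compact_imp_bounded compact_continuous_image)
  then have "\<exists>C. \<forall>t\<in>{0..T}. \<forall>x\<in>cell. \<bar>g (t, x)\<bar> \<le> C"
    by (simp add: bounded_iff)
  then obtain C where C: "\<And>t x. t \<in> {0..T} \<Longrightarrow> x \<in> cell \<Longrightarrow> \<bar>g (t, x)\<bar> \<le> C" by blast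
  have "norm (fourier_coeff (\<lambda>x. g (t, x)) k) \<le> C" if t: "t \<in> {0..T}" for t k
    unfolding fourier_coeff_eq_fcoeff[OF smooth_slice_continuous[OF 0(1) t]]
    by (rule norm_fcoeff_le) (use C t in \<open>auto intro!: continuous_intros smooth_slice_continuous[OF 0(1)]\<close>)
  then show ?case by (intro exI[of _ C]) simp
next
  case (Suc n)
  obtain C where C: "\<And>t k. t \<in> {0..T} \<Longrightarrow> \<bar>real_of_int (k $ i)\<bar> ^ n * norm (fourier_coeff (\<lambda>x. space_partial i g (t, x)) k) \<le> C"
    using Suc.IH[OF smooth_on_space_partial[OF Suc.prems(1)] periodic_space_partial[OF Suc.prems(1) _ Suc.prems(2)]] by blast
  show ?case
    using C fourier_coeff_space_partial[OF Suc.prems(1) _ Suc.prems(2)] by (auto simp: norm_mult mult_ac intro!: exI[of _ C])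
qed

lemma smooth_fourier_decay:
  fixes g :: "real \<times> plane \<Rightarrow> real"
  assumes g: "smooth_on ({0..T} \<times> UNIV) g" "\<And>t. t \<in> {0..T} \<Longrightarrow> periodic (\<lambda>x. g (t, x))"
  shows "\<exists>C. \<forall>t\<in>{0..T}. \<forall>k. (1 + freq_norm k) ^ n * norm (fourier_coeff (\<lambda>x. g (t, x)) k) \<le> C"
proof -
  obtain C0 C1 C2 where C:
    "\<And>t k. t \<in> {0..T} \<Longrightarrow> norm (fourier_coeff (\<lambda>x. g (t, x)) k) \<le> C0"
    "\<And>t k. t \<in> {0..T} \<Longrightarrow> \<bar>real_of_int (k $ 1)\<bar> ^ n * norm (fourier_coeff (\<lambda>x. g (t, x)) k) \<le> C1"
    "\<And>t k. t \<in> {0..T} \<Longrightarrow> \<bar>real_of_int (k $ 2)\<bar> ^ n * norm (fourier_coeff (\<lambda>x. g (t, x)) k) \<le> C2"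
  proof -
    have "\<exists>C0. \<forall>t\<in>{0..T}. \<forall>k. norm (fourier_coeff (\<lambda>x. g (t, x)) k) \<le> C0"
      using smooth_fourier_component_bound[OF g, of _ 0] by simp
    then show ?thesis
      using that smooth_fourier_component_bound[OF g, of 1 n] smooth_fourier_component_bound[OF g, of 2 n] by blast
  qed
  have "(1 + freq_norm k) ^ n * norm (fourier_coeff (\<lambda>x. g (t, x)) k) \<le> 3 ^ n * (C0 + C1 + C2)" if t: "t \<in> {0..T}" for t k
  proof -
    let ?a = "\<bar>real_of_int (k $ 1)\<bar>" and ?b = "\<bar>real_of_int (k $ 2)\<bar>" and ?f = "norm (fourier_coeff (\<lambda>x. g (t, x)) k)"
    define m where "m = max 1 (max ?a ?b)"
    have m: "1 \<le> m" "?a \<le> m" "?b \<le> m" "m \<in> {1, ?a, ?b}" unfolding m_def by (auto simp: max_def)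
    have "freq_norm k \<le> ?a + ?b" using norm_le_l1_cart[of "wavevector k"] by (simp add: UNIV_2)
    then have "(1 + freq_norm k) ^ n \<le> (3 * m) ^ n" using m by (intro power_mono) auto
    also have "\<dots> \<le> 3 ^ n * (1 + ?a ^ n + ?b ^ n)"
      using m(4) by (auto simp: power_mult_distrib)
    finally have "(1 + freq_norm k) ^ n * ?f \<le> 3 ^ n * (1 + ?a ^ n + ?b ^ n) * ?f" by (rule mult_right_mono) auto
    also have "\<dots> = 3 ^ n * (?f + ?a ^ n * ?f + ?b ^ n * ?f)" by (simp add: algebra_simps)
    also have "\<dots> \<le> 3 ^ n * (C0 + C1 + C2)" using C t by (intro mult_left_mono add_mono) auto
    finally show ?thesis .
  qed
  then show ?thesis by blast
qed

text \<open>A single majorant for all times is what the M-test asks for when continuity is to hold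
  jointly in time and space.\<close>

lemma smooth_fourier_majorant:
  fixes g :: "real \<times> plane \<Rightarrow> real"
  assumes g: "smooth_on ({0..T} \<times> UNIV) g" "\<And>t. t \<in> {0..T} \<Longrightarrow> periodic (\<lambda>x. g (t, x))" and T: "0 \<le> T"
  obtains M :: "int^2 \<Rightarrow> real" where "rapid M"
    "\<And>t k. t \<in> {0..T} \<Longrightarrow> norm (fourier_coeff (\<lambda>x. g (t, x)) k) \<le> M k"
proof
  define M where "M k = (SUP t\<in>{0..T}. norm (fourier_coeff (\<lambda>x. g (t, x)) k))" for k
  obtain C0 where C0: "\<And>t k. t \<in> {0..T} \<Longrightarrow> norm (fourier_coeff (\<lambda>x. g (t, x)) k) \<le> C0"
  proof -
    have "\<exists>C0. \<forall>t\<in>{0..T}. \<forall>k. norm (fourier_coeff (\<lambda>x. g (t, x)) k) \<le> C0"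
      using smooth_fourier_decay[OF g, of 0] by simp
    then show ?thesis using that by blast
  qed
  have bdd: "bdd_above ((\<lambda>t. norm (fourier_coeff (\<lambda>x. g (t, x)) k)) ` {0..T})" for k
    using C0 by (intro bdd_aboveI2[where M = C0]) auto
  show le: "norm (fourier_coeff (\<lambda>x. g (t, x)) k) \<le> M k" if "t \<in> {0..T}" for t k
    unfolding M_def by (rule cSUP_upper[OF that bdd])
  have M0: "0 \<le> M k" for k using le[of 0 k] T norm_ge_zero order_trans by (metis atLeastAtMost_iff order_refl)
  show "rapid M"
  proof (rule rapidI)
    fix n
    obtain C where C: "\<And>t k. t \<in> {0..T} \<Longrightarrow> (1 + freq_norm k) ^ n * norm (fourier_coeff (\<lambda>x. g (t, x)) k) \<le> C"
      using smooth_fourier_decay[OF g, of n] by blast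
    have "(1 + freq_norm k) ^ n * norm (M k) \<le> C" for k
    proof -
      have p: "0 < (1 + freq_norm k) ^ n" by (intro zero_less_power add_pos_nonneg) auto
      have "M k \<le> C / (1 + freq_norm k) ^ n"
        unfolding M_def using T C p by (intro cSUP_least) (auto simp: pos_le_divide_eq mult.commute)
      then show ?thesis using p M0[of k] by (simp add: pos_le_divide_eq mult.commute)
    qed
    then show "\<exists>C. \<forall>k. (1 + freq_norm k) ^ n * norm (M k) \<le> C" by blast
  qed
qed

text \<open>Coefficients dominated uniformly in time supply all spatial derivatives, jointly
  continuous. The equation itself is kept pointwise in x, so that it can be evaluated at minimum
  points.\<close>

locale transport_solution =
  fixes s T :: real and c :: "real \<Rightarrow> int^2 \<Rightarrow> complex" and M :: "int^2 \<Rightarrow> real"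
  assumes T: "0 < T" and s: "- 1 < s" "s < 0"
    and M: "rapid M" and cM: "\<And>t k. t \<in> {0..T} \<Longrightarrow> norm (c t k) \<le> M k"
    and herm: "\<And>t. t \<in> {0..T} \<Longrightarrow> herm (c t)"
    and c_cont: "\<And>k. continuous_on {0..T} (\<lambda>t. c t k)"
    and evolution: "\<And>t x. t \<in> {0..T} \<Longrightarrow>
      ((\<lambda>\<tau>. rseries (c \<tau>) x) has_real_derivative - vel_dot_grad s (c t) (c t) x) (at t within {0..T})"

lemma smooth_solution_imp_transport_solution:
  assumes sol: "smooth_solution \<alpha> \<omega>\<^sub>0 T \<omega>" and T: "0 < T" and \<alpha>: "0 < \<alpha>" "\<alpha> < 1"
  obtains c M where "transport_solution (- 1 + \<alpha>) T c M" "\<And>t. t \<in> {0..T} \<Longrightarrow> \<omega> t = rseries (c t)" "\<omega> 0 = \<omega>\<^sub>0"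
proof -
  define g where "g = (\<lambda>(t, x). \<omega> t x)"
  have g: "smooth_on ({0..T} \<times> UNIV) g" "\<And>t. t \<in> {0..T} \<Longrightarrow> periodic (\<lambda>x. g (t, x))"
    using sol by (auto simp: g_def smooth_solution_def)
  obtain M where M: "rapid M" "\<And>t k. t \<in> {0..T} \<Longrightarrow> norm (fourier_coeff (\<omega> t) k) \<le> M k"
    using smooth_fourier_majorant[OF g less_imp_le[OF T]] unfolding g_def prod.case by blast
  define c where "c t = fourier_coeff (\<omega> t)" for t
  have rc: "rapid (c t)" if "t \<in> {0..T}" for t
    using M(2)[OF that] by (intro rapid_norm_le[OF M(1)]) (auto simp: c_def intro: order_trans[OF _ abs_ge_self])
  have cont: "continuous_on UNIV (\<omega> t)" if "t \<in> {0..T}" for t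
    using smooth_slice_continuous[OF g(1) that] by (simp add: g_def)
  have per: "periodic (\<omega> t)" if "t \<in> {0..T}" for t
    using g(2)[OF that] by (simp add: g_def)
  have inv: "herm (c t)" "\<omega> t = rseries (c t)" if "t \<in> {0..T}" for t
    using fourier_coeff_real[OF cont[OF that] per[OF that]] rc[OF that] by (auto simp: c_def)
  have ccont: "continuous_on {0..T} (\<lambda>t. c t k)" for k
  proof -
    have "continuous_on {0..T} (\<lambda>t. integral cell (\<lambda>x. of_real (\<omega> t x) * character (- k) x))"
      unfolding cell_def
    proof (rule integral_continuous_on_param)
      have "continuous_on ({0..T} \<times> cbox (\<chi> i. - pi) (\<chi> i. pi)) g"
        by (rule continuous_on_subset[OF smooth_on_continuous[OF g(1)]]) auto
      then show "continuous_on ({0..T} \<times> cbox (\<chi> i. - pi) (\<chi> i. pi)) (\<lambda>(t, x). of_real (\<omega> t x) * character (- k) x)"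
        by (auto simp: g_def case_prod_unfold intro!: continuous_intros continuous_on_compose2[OF continuous_on_character continuous_on_snd])
    qed
    then have "continuous_on {0..T} (\<lambda>t. integral cell (\<lambda>x. of_real (\<omega> t x) * character (- k) x) / (2 * pi)\<^sup>2)"
      by (intro continuous_intros) auto
    then show ?thesis
      by (rule continuous_on_eq)
         (auto simp: c_def fourier_coeff_eq_fcoeff[OF cont] fcoeff_def cell_int_def)
  qed
  have "transport_solution (- 1 + \<alpha>) T c M"
  proof
    fix t x assume t: "t \<in> {0..T}"
    obtain w where w: "((\<lambda>\<tau>. \<omega> \<tau> x) has_real_derivative w) (at t within {0..T})"
      "w + velocity \<alpha> (\<omega> t) x \<bullet> grad (\<omega> t) x = 0"
      using sol t unfolding smooth_solution_def by blast
    have "velocity \<alpha> (\<omega> t) x \<bullet> grad (\<omega> t) x = vel_dot_grad (- 1 + \<alpha>) (c t) (c t) x"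
    proof -
      have "grad (\<omega> t) x $ i = rseries (fderiv i (c t)) x" for i
        unfolding inv(2)[OF t] by (simp add: grad_def partial_rseries rc[OF t])
      then show ?thesis
        using velocity_inner[of "\<omega> t" \<alpha> x] rc[OF t] \<alpha> by (simp add: c_def[symmetric] vel_dot_grad_def)
    qed
    then have "w = - vel_dot_grad (- 1 + \<alpha>) (c t) (c t) x" using w(2) by simp
    then show "((\<lambda>\<tau>. rseries (c \<tau>) x) has_real_derivative - vel_dot_grad (- 1 + \<alpha>) (c t) (c t) x) (at t within {0..T})"
      using w(1) inv(2) t by (auto intro: has_field_derivative_transform_within[where d=1])
  qed (use T \<alpha> M(1) M(2)[folded c_def] inv(1) ccont in auto)
  moreover have "\<omega> 0 = \<omega>\<^sub>0" using sol by (simp add: smooth_solution_def)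
  ultimately show ?thesis using that inv(2) by blast
qed

section \<open>Uniqueness of smooth solutions\<close>

text \<open>Stable under multipliers of polynomial growth; so the spatial derivatives of a solution
  and of its Riesz potentials are all jointly continuous and bounded on the time interval.\<close>

definition tame :: "real \<Rightarrow> (real \<Rightarrow> int^2 \<Rightarrow> complex) \<Rightarrow> bool" where
  "tame T b \<longleftrightarrow> (\<forall>k. continuous_on {0..T} (\<lambda>t. b t k)) \<and>
     (\<exists>M :: int^2 \<Rightarrow> real. rapid M \<and> (\<forall>t\<in>{0..T}. \<forall>k. norm (b t k) \<le> M k))"

lemma tame_mult:
  fixes p :: "int^2 \<Rightarrow> complex"
  assumes b: "tame T b" and p: "\<And>k. norm (p k) \<le> C * (1 + freq_norm k) ^ m"
  shows "tame T (\<lambda>t k. p k * b t k)"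
proof -
  obtain M :: "int^2 \<Rightarrow> real" where M: "rapid M" "\<And>t k. t \<in> {0..T} \<Longrightarrow> norm (b t k) \<le> M k"
    using b unfolding tame_def by blast
  have "rapid (\<lambda>k. norm (p k) * M k)"
    by (rule rapid_mult_le[OF M(1)]) (use p in auto)
  moreover have "norm (p k * b t k) \<le> norm (p k) * M k" if "t \<in> {0..T}" for t k
    unfolding norm_mult using M(2)[OF that] by (intro mult_left_mono) auto
  moreover have "continuous_on {0..T} (\<lambda>t. p k * b t k)" for k
    using b by (intro continuous_intros) (auto simp: tame_def)
  ultimately show ?thesis unfolding tame_def by blast
qed

lemma tame_fderiv: "tame T b \<Longrightarrow> tame T (\<lambda>t. fderiv i (b t))"
  unfolding fderiv_def
proof (rule tame_mult[where C = 1 and m = 1])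
  show "norm (\<i> * of_int (k $ i) :: complex) \<le> 1 * (1 + freq_norm k) ^ 1" for k :: "int^2"
    using abs_comp_le_freq_norm[of k i] by (simp add: norm_mult)
qed

lemma tame_riesz: "tame T b \<Longrightarrow> s \<le> 0 \<Longrightarrow> tame T (\<lambda>t. riesz s (b t))"
  unfolding riesz_def[abs_def] using freq_symbol_le_1[of s]
  by (intro tame_mult[where C = 1 and m = 0]) auto

lemma tame_rapid: "tame T b \<Longrightarrow> t \<in> {0..T} \<Longrightarrow> rapid (b t)"
  unfolding tame_def by (metis abs_ge_self order_trans rapid_norm_le real_norm_def)

lemma tame_continuous:
  assumes "tame T b"
  shows "continuous_on ({0..T} \<times> S) (\<lambda>(t, x). rseries (b t) x)"
proof -
  obtain M :: "int^2 \<Rightarrow> real" where M: "rapid M" "\<And>t k. t \<in> {0..T} \<Longrightarrow> norm (b t k) \<le> M k"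
    and c: "\<And>k. continuous_on {0..T} (\<lambda>t. b t k)"
    using assms unfolding tame_def by blast
  have "continuous_on ({0..T} \<times> S) (\<lambda>p. \<Sum>\<^sub>\<infinity>k. b (fst p) k * character k (snd p))"
  proof (rule continuous_on_infsum[OF _ _ rapid_abs_summable[OF M(1)]])
    show "continuous_on ({0..T} \<times> S) (\<lambda>p. b (fst p) k * character k (snd p))" for k
      unfolding character_def by (intro continuous_intros continuous_on_compose2[OF c[of k] continuous_on_fst]) auto
    show "norm (b (fst p) k * character k (snd p)) \<le> norm (M k)" if "p \<in> {0..T} \<times> S" for k p
    proof -
      have "fst p \<in> {0..T}" using that by auto
      from M(2)[OF this, of k] show ?thesis by (simp add: norm_mult)
    qed
  qed
  then show ?thesis
    unfolding rseries_def fseries_def case_prod_unfold by (intro continuous_intros)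
qed

lemma tame_time_continuous:
  assumes "tame T b" shows "continuous_on {0..T} (\<lambda>t. rseries (b t) x)"
proof -
  have "continuous_on {0..T} (\<lambda>t. case (t, x) of (t, x) \<Rightarrow> rseries (b t) x)"
    by (rule continuous_on_compose2[OF tame_continuous[OF assms, of UNIV]])
       (auto intro!: continuous_on_Pair continuous_on_id continuous_on_const)
  then show ?thesis by simp
qed

lemma tame_bounded:
  assumes "tame T b"
  obtains B where "\<And>t x. t \<in> {0..T} \<Longrightarrow> \<bar>rseries (b t) x\<bar> \<le> B"
proof -
  obtain M :: "int^2 \<Rightarrow> real" where M: "rapid M" "\<And>t k. t \<in> {0..T} \<Longrightarrow> norm (b t k) \<le> M k"
    using assms unfolding tame_def by blast
  have "\<bar>rseries (b t) x\<bar> \<le> (\<Sum>\<^sub>\<infinity>k. norm (M k))" if t: "t \<in> {0..T}" for t x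
  proof -
    have "\<bar>rseries (b t) x\<bar> \<le> (\<Sum>\<^sub>\<infinity>k. norm (b t k))" by (intro abs_rseries_le tame_rapid[OF assms t])
    also have "\<dots> \<le> (\<Sum>\<^sub>\<infinity>k. norm (M k))"
      using order_trans[OF M(2)[OF t] abs_ge_self]
      by (intro infsum_mono rapid_abs_summable tame_rapid[OF assms t] M) auto
    finally show ?thesis .
  qed
  then show ?thesis using that by blast
qed

lemma rseries_diff: "rapid a \<Longrightarrow> rapid b \<Longrightarrow> rseries (\<lambda>k. a k - b k) x = rseries a x - rseries b x"
  by (simp add: rseries_def fseries_diff)

lemma rapid_diff: "rapid a \<Longrightarrow> rapid b \<Longrightarrow> rapid (\<lambda>k. a k - b k)"
  using rapid_add[of a "\<lambda>k. - b k"] rapid_minus[of b] by simp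

text \<open>Split so that the first term on the right is orthogonal to the difference, by
  \<open>transport_orthogonal\<close>, and the second is what \<open>stretching_bound\<close>
  controls.\<close>

lemma vel_dot_grad_diff:
  assumes "rapid a" "rapid b" "s \<le> 0"
  shows "vel_dot_grad s a a x - vel_dot_grad s b b x =
     vel_dot_grad s a (\<lambda>k. a k - b k) x + vel_dot_grad s (\<lambda>k. a k - b k) b x"
proof -
  have f: "fderiv i (\<lambda>k. a k - b k) = (\<lambda>k. fderiv i a k - fderiv i b k)" for i and a b :: "int^2 \<Rightarrow> complex"
    by (simp add: fderiv_def fun_eq_iff algebra_simps)
  have r: "riesz s (\<lambda>k. a k - b k) = (\<lambda>k. riesz s a k - riesz s b k)"
    by (simp add: riesz_def fun_eq_iff algebra_simps)
  show ?thesis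
    unfolding vel_dot_grad_def vel1_def vel2_def f r
    by (subst rseries_diff, (intro rapid_fderiv rapid_riesz assms)+)+ (simp add: algebra_simps)
qed

lemma energy_derivative:
  fixes f g :: "real \<Rightarrow> plane \<Rightarrow> real"
  assumes f: "continuous_on ({0..T} \<times> cell) (\<lambda>(t, x). f t x)"
    and g: "continuous_on ({0..T} \<times> cell) (\<lambda>(t, x). g t x)"
    and d: "\<And>t x. t \<in> {0..T} \<Longrightarrow> ((\<lambda>\<tau>. f \<tau> x) has_real_derivative g t x) (at t within {0..T})"
    and t: "t \<in> {0..T}"
  shows "((\<lambda>\<tau>. cell_int (\<lambda>x. (f \<tau> x)\<^sup>2)) has_real_derivative cell_int (\<lambda>x. 2 * (f t x * g t x))) (at t within {0..T})"
  unfolding cell_int_def cell_def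
proof (rule leibniz_rule_field_derivative)
  show "((\<lambda>\<tau>. (f \<tau> x)\<^sup>2) has_real_derivative 2 * (f t x * g t x)) (at t within {0..T})" if "t \<in> {0..T}" for t x
    using d[OF that] by (auto intro!: derivative_eq_intros simp: power2_eq_square)
  show "(\<lambda>x. (f t x)\<^sup>2) integrable_on cbox (\<chi> i. - pi) (\<chi> i. pi)" if "t \<in> {0..T}" for t
  proof -
    have "continuous_on cell (\<lambda>x. case (t, x) of (t, x) \<Rightarrow> f t x)"
      by (rule continuous_on_compose2[OF f])
         (use that in \<open>auto intro!: continuous_on_Pair continuous_on_id continuous_on_const\<close>)
    then show ?thesis unfolding cell_def by (intro integrable_continuous continuous_intros) simp
  qed
  show "continuous_on ({0..T} \<times> cbox (\<chi> i. - pi) (\<chi> i. pi)) (\<lambda>(t, x). 2 * (f t x * g t x))"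
    using f g by (auto simp: case_prod_unfold cell_def intro!: continuous_intros)
qed (use t in auto)

context transport_solution
begin

lemma tame_c: "tame T c"
  unfolding tame_def using c_cont M cM by blast

lemma rapid_c: "t \<in> {0..T} \<Longrightarrow> rapid (c t)"
  using tame_rapid[OF tame_c] .

lemma s_le_0: "s \<le> 0" using s by simp

lemma continuous_vel_dot_grad: "continuous_on ({0..T} \<times> S) (\<lambda>(t, x). vel_dot_grad s (c t) (c t) x)"
  using tame_continuous[OF tame_fderiv[OF tame_riesz[OF tame_c s_le_0]], of S]
    tame_continuous[OF tame_fderiv[OF tame_c], of S]
  unfolding vel_dot_grad_def vel1_def vel2_def case_prod_unfold by (intro continuous_intros) auto

lemma energy_conserved:
  assumes t: "t \<in> {0..T}"
  shows "cell_int (\<lambda>x. (rseries (c t) x)\<^sup>2) = cell_int (\<lambda>x. (rseries (c 0) x)\<^sup>2)"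
proof -
  have d: "((\<lambda>\<tau>. cell_int (\<lambda>x. (rseries (c \<tau>) x)\<^sup>2)) has_real_derivative 0) (at t within {0..T})" if t: "t \<in> {0..T}" for t
  proof -
    have "((\<lambda>\<tau>. cell_int (\<lambda>x. (rseries (c \<tau>) x)\<^sup>2)) has_real_derivative
        cell_int (\<lambda>x. 2 * (rseries (c t) x * - vel_dot_grad s (c t) (c t) x))) (at t within {0..T})"
      using continuous_vel_dot_grad[of cell]
      by (intro energy_derivative tame_continuous tame_c evolution t) (auto simp: case_prod_unfold intro!: continuous_intros)
    moreover have "cell_int (\<lambda>x. 2 * (rseries (c t) x * - vel_dot_grad s (c t) (c t) x)) = 0"
      using transport_orthogonal[OF rapid_c[OF t] rapid_c[OF t] s_le_0]
      by (simp add: cell_int_cmult_right_real cell_int_minus)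
    ultimately show ?thesis by simp
  qed
  show ?thesis
    by (rule has_field_derivative_zero_constant[of "{0..T}" "\<lambda>t. cell_int (\<lambda>x. (rseries (c t) x)\<^sup>2)", THEN exE])
       (use d t T in auto)
qed

end

lemma gronwall_zero:
  fixes E :: "real \<Rightarrow> real"
  assumes d: "\<And>t. t \<in> {0..T} \<Longrightarrow> (E has_real_derivative E' t) (at t within {0..T})"
    and le: "\<And>t. t \<in> {0..T} \<Longrightarrow> E' t \<le> K * E t" and E0: "E 0 = 0" and t: "t \<in> {0..T}"
  shows "E t \<le> 0"
proof (cases "t = 0")
  case False
  let ?h = "\<lambda>t. E t * exp (- K * t)"
  have dh: "(?h has_real_derivative (E' t - K * E t) * exp (- K * t)) (at t within {0..T})" if "t \<in> {0..T}" for t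
    using d[OF that] by (auto intro!: derivative_eq_intros simp: algebra_simps)
  have "?h t \<le> ?h 0"
  proof (rule DERIV_nonpos_imp_decreasing_open[of 0 t ?h])
    show "0 \<le> t" using t by auto
    show "continuous_on {0..t} ?h"
      by (rule continuous_on_subset[OF DERIV_continuous_on[of "{0..T}" ?h, OF dh]]) (use t in auto)
  next
    fix x assume x: "0 < x" "x < t"
    then have "(?h has_real_derivative (E' x - K * E x) * exp (- K * x)) (at x)"
      using dh[of x] t at_within_interior[of x "{0..T}"] by auto
    moreover have "(E' x - K * E x) * exp (- K * x) \<le> 0"
      using le[of x] x t by (intro mult_nonpos_nonneg) auto
    ultimately show "\<exists>y. (?h has_real_derivative y) (at x) \<and> y \<le> 0" by blast
  qed
  then show ?thesis by (simp add: E0 mult_le_0_iff)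
qed (use E0 in simp)

text \<open>Energy estimate for the difference. By \<open>stretching_bound\<close> no derivative
  falls on it: the growth rate \<open>2 * D\<close> depends on the second solution only, even for
  \<alpha> \<ge> 1/2, where the velocity is no smoother than the solution.\<close>

theorem transport_solution_unique:
  assumes "transport_solution s T c M" "transport_solution s T c' M'" and c0: "c 0 = c' 0" and t: "t \<in> {0..T}"
  shows "c t = c' t"
proof -
  interpret A: transport_solution s T c M by fact
  interpret B: transport_solution s T c' M' by fact
  note s0 = A.s_le_0
  define e where "e t = (\<lambda>k. c t k - c' t k)" for t
  have re: "rapid (e t)" if "t \<in> {0..T}" for t
    unfolding e_def using that by (intro rapid_diff A.rapid_c B.rapid_c)
  have he: "herm (e t)" if "t \<in> {0..T}" for t
    using A.herm[OF that] B.herm[OF that] by (simp add: herm_def e_def)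
  have e_eq: "rseries (e t) x = rseries (c t) x - rseries (c' t) x" if "t \<in> {0..T}" for t x
    unfolding e_def using that by (intro rseries_diff A.rapid_c B.rapid_c)
  define g where "g t x = - vel_dot_grad s (c t) (c t) x + vel_dot_grad s (c' t) (c' t) x" for t x
  have gcont: "continuous_on ({0..T} \<times> cell) (\<lambda>(t, x). g t x)"
    using A.continuous_vel_dot_grad[of cell] B.continuous_vel_dot_grad[of cell]
    by (auto simp: g_def case_prod_unfold intro!: continuous_intros)
  have econt: "continuous_on ({0..T} \<times> cell) (\<lambda>(t, x). rseries (e t) x)"
  proof -
    have "continuous_on ({0..T} \<times> cell) (\<lambda>(t, x). rseries (c t) x - rseries (c' t) x)"
      using tame_continuous[OF A.tame_c, of cell] tame_continuous[OF B.tame_c, of cell]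
      by (auto simp: case_prod_unfold intro!: continuous_intros)
    then show ?thesis by (rule continuous_on_eq) (auto simp: e_eq)
  qed
  have ed: "((\<lambda>\<tau>. rseries (e \<tau>) x) has_real_derivative g t x) (at t within {0..T})" if t: "t \<in> {0..T}" for t x
  proof -
    have "((\<lambda>\<tau>. rseries (c \<tau>) x - rseries (c' \<tau>) x) has_real_derivative g t x) (at t within {0..T})"
      using DERIV_diff[OF A.evolution[OF t, of x] B.evolution[OF t, of x]] by (simp add: g_def)
    then show ?thesis
      by (rule has_field_derivative_transform_within[where d = 1]) (use t e_eq in auto)
  qed
  define D where "D = (\<Sum>\<^sub>\<infinity>m. (freq_norm m)\<^sup>2 * norm (M' m))"
  have D: "(\<Sum>\<^sub>\<infinity>m. (freq_norm m)\<^sup>2 * norm (c' t m)) \<le> D" if t: "t \<in> {0..T}" for t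
    unfolding D_def using order_trans[OF B.cM[OF t] abs_ge_self]
    by (intro infsum_mono rapid_power_summable B.rapid_c t B.M mult_left_mono) auto
  let ?E = "\<lambda>t. cell_int (\<lambda>x. (rseries (e t) x)\<^sup>2)"
  have E0: "0 \<le> ?E t" if t: "t \<in> {0..T}" for t
    using parseval[OF re[OF t] he[OF t]] has_sum_nonneg by (fastforce simp: zero_le_divide_iff)
  have "?E t \<le> 0"
  proof (rule gronwall_zero[of T ?E "\<lambda>t. cell_int (\<lambda>x. 2 * (rseries (e t) x * g t x))" "2 * D"])
    show "(?E has_real_derivative cell_int (\<lambda>x. 2 * (rseries (e t) x * g t x))) (at t within {0..T})" if "t \<in> {0..T}" for t
      by (rule energy_derivative[OF econt gcont ed that])
    show "cell_int (\<lambda>x. 2 * (rseries (e t) x * g t x)) \<le> 2 * D * ?E t" if t: "t \<in> {0..T}" for t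
    proof -
      note r = re[OF t] A.rapid_c[OF t] B.rapid_c[OF t] s0
      have g: "g t x = - (vel_dot_grad s (c t) (e t) x + vel_dot_grad s (e t) (c' t) x)" for x
        using vel_dot_grad_diff[OF r(2,3) s0, of x] by (simp add: g_def e_def)
      have "cell_int (\<lambda>x. rseries (e t) x * g t x) =
        - (cell_int (\<lambda>x. rseries (e t) x * vel_dot_grad s (c t) (e t) x) + cell_int (\<lambda>x. rseries (e t) x * vel_dot_grad s (e t) (c' t) x))"
        unfolding g by (subst cell_int_add[symmetric], (intro continuous_intros r)+)
          (simp add: algebra_simps cell_int_minus[symmetric])
      also have "\<dots> = - cell_int (\<lambda>x. rseries (e t) x * vel_dot_grad s (e t) (c' t) x)"
        using transport_orthogonal[OF r(1) r(2) s0] by simp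
      also have "\<dots> \<le> \<bar>cell_int (\<lambda>x. rseries (e t) x * vel_dot_grad s (e t) (c' t) x)\<bar>" by simp
      also have "\<dots> \<le> (\<Sum>\<^sub>\<infinity>m. (freq_norm m)\<^sup>2 * norm (c' t m)) * ?E t"
        using A.s by (intro stretching_bound r he[OF t] B.herm[OF t]) auto
      also have "\<dots> \<le> D * ?E t" by (intro mult_right_mono D t E0)
      finally show ?thesis by (simp add: cell_int_cmult_right_real)
    qed
    have "e 0 = (\<lambda>k. 0)" using c0 by (simp add: e_def)
    then show "?E 0 = 0" by (simp add: rseries_def fseries_def cell_int_def)
  qed (rule t)
  then have "?E t = 0" using E0[OF t] by simp
  then have "((\<lambda>k. (norm (e t k))\<^sup>2) has_sum 0) UNIV" using parseval[OF re[OF t] he[OF t]] by simp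
  then have "(norm (e t k))\<^sup>2 = 0" for k
    by (rule nonneg_has_sum_le_0D) auto
  then show ?thesis by (auto simp: e_def)
qed


section \<open>Reflection symmetry\<close>

text \<open>Polymorphic because it acts on points as well as on frequencies.\<close>

definition flip :: "2 \<Rightarrow> 'a::group_add ^ 2 \<Rightarrow> 'a ^ 2" where
  "flip j x = (\<chi> i. if i = j then - x $ i else x $ i)"

definition reflect :: "2 \<Rightarrow> (int^2 \<Rightarrow> complex) \<Rightarrow> int^2 \<Rightarrow> complex" where
  "reflect j a k = a (flip j k)"

lemma flip_flip [simp]: "flip j (flip j x) = x"
  by (simp add: flip_def vec_eq_iff)

lemma flip_nth: "flip j x $ i = (if i = j then - x $ i else x $ i)"
  by (simp add: flip_def)

lemma bij_flip: "bij_betw (flip j) UNIV UNIV"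
  by (rule bij_betwI[where g = "flip j"]) auto

lemma wavevector_flip: "wavevector (flip j k) = flip j (wavevector k)"
  by (simp add: vec_eq_iff flip_nth)

lemma flip_inner: "flip j x \<bullet> y = x \<bullet> flip j (y :: plane)"
  using exhaust_2[of j] by (auto simp: inner_2 flip_nth)

lemma norm_flip [simp]: "norm (flip j x) = norm (x :: plane)"
  by (simp add: norm_eq_sqrt_inner flip_inner)

lemma rapid_refl: "rapid a \<Longrightarrow> rapid (reflect j a)"
proof -
  assume a: "rapid a"
  have "(\<lambda>k. (1 + freq_norm (flip j k)) ^ n * norm (a (flip j k))) summable_on UNIV" for n
    using rapid_weight_summable[OF a, of n] by (subst summable_on_reindex_bij_betw[OF bij_flip])
  then show ?thesis by (simp add: rapid_def reflect_def wavevector_flip)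
qed

lemma rseries_refl: "rseries (reflect j a) x = rseries a (flip j x)"
proof -
  have "fseries (reflect j a) x = (\<Sum>\<^sub>\<infinity>k. a (flip j k) * character (flip j k) (flip j x))"
    by (simp add: fseries_def reflect_def character_def wavevector_flip flip_inner)
  also have "\<dots> = fseries a (flip j x)"
    unfolding fseries_def by (rule infsum_reindex_bij_betw[OF bij_flip])
  finally show ?thesis by (simp add: rseries_def)
qed

lemma riesz_refl: "riesz s (reflect j a) = reflect j (riesz s a)"
  by (simp add: riesz_def reflect_def fun_eq_iff wavevector_flip)

lemma fderiv_refl: "fderiv i (reflect j a) = (\<lambda>k. (if i = j then -1 else 1) * reflect j (fderiv i a) k)"
  by (auto simp: fderiv_def reflect_def fun_eq_iff flip_nth)

lemma rseries_uminus: "rseries (\<lambda>k. - a k) x = - rseries a x"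
  by (simp add: rseries_def fseries_minus)

lemma rseries_fderiv_refl:
  "rseries (fderiv i (reflect j a)) x = (if i = j then -1 else 1) * rseries (fderiv i a) (flip j x)"
  unfolding fderiv_refl by (simp add: rseries_uminus rseries_refl)

lemma fderiv_uminus: "fderiv i (\<lambda>k. - a k) = (\<lambda>k. - fderiv i a k)"
  by (simp add: fderiv_def)

lemma riesz_uminus: "riesz s (\<lambda>k. - a k) = (\<lambda>k. - riesz s a k)"
  by (simp add: riesz_def fun_eq_iff)

text \<open>A reflection reverses the sense of rotation and with it the sign of the velocity law. It
  becomes a symmetry of the equation only when combined with a change of sign of the
  solution.\<close>

lemma vel_dot_grad_refl:
  "vel_dot_grad s (\<lambda>k. - reflect j a k) (\<lambda>k. - reflect j a k) x = - vel_dot_grad s a a (flip j x)"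
  using exhaust_2[of j]
  by (auto simp: vel_dot_grad_def vel1_def vel2_def fderiv_uminus riesz_uminus rseries_uminus riesz_refl rseries_fderiv_refl)

lemma (in transport_solution) reflected:
  "transport_solution s T (\<lambda>t k. - reflect j (c t) k) (\<lambda>k. M (flip j k))"
proof
  have "rapid (reflect j (\<lambda>k. of_real (M k)))" using M by (intro rapid_refl) (simp add: rapid_def)
  then show "rapid (\<lambda>k. M (flip j k))" by (simp add: rapid_def reflect_def)
  show "norm (- reflect j (c t) k) \<le> M (flip j k)" if "t \<in> {0..T}" for t k
    using cM[OF that] by (simp add: reflect_def)
  show "herm (\<lambda>k. - reflect j (c t) k)" if "t \<in> {0..T}" for t
  proof -
    have "flip j (- k) = - flip j k" for k :: "int^2" by (simp add: vec_eq_iff flip_nth)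
    then show ?thesis using herm[OF that] by (simp add: herm_def reflect_def)
  qed
  show "continuous_on {0..T} (\<lambda>t. - reflect j (c t) k)" for k
    unfolding reflect_def by (intro continuous_intros c_cont)
  show "((\<lambda>\<tau>. rseries (\<lambda>k. - reflect j (c \<tau>) k) x) has_real_derivative
      - vel_dot_grad s (\<lambda>k. - reflect j (c t) k) (\<lambda>k. - reflect j (c t) k) x) (at t within {0..T})" if "t \<in> {0..T}" for t x
    unfolding vel_dot_grad_refl rseries_uminus rseries_refl
    using DERIV_minus[OF evolution[OF that, of "flip j x"]] by simp
qed (use T s in auto)

definition odd_coeffs :: "(int^2 \<Rightarrow> complex) \<Rightarrow> bool" where
  "odd_coeffs a \<longleftrightarrow> (\<forall>j k. a (flip j k) = - a k)"

text \<open>The negative of the reflected solution solves the same equation with the same data, so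
  uniqueness identifies it with the solution.\<close>

lemma (in transport_solution) odd_preserved:
  assumes "odd_coeffs (c 0)" "t \<in> {0..T}"
  shows "odd_coeffs (c t)"
proof -
  have "c t = (\<lambda>k. - reflect j (c t) k)" for j
    by (rule transport_solution_unique[OF transport_solution_axioms reflected[of j] _ assms(2)])
       (use assms(1) in \<open>simp add: odd_coeffs_def reflect_def fun_eq_iff\<close>)
  then have "c t (flip j k) = - c t (flip j (flip j k))" for j k
    unfolding reflect_def by (rule fun_cong)
  then show ?thesis unfolding odd_coeffs_def flip_flip by blast
qed

lemma odd_rseries:
  assumes "odd_coeffs a" shows "rseries a (flip j x) = - rseries a x"
proof -
  have "reflect j a = (\<lambda>k. - a k)" using assms by (simp add: odd_coeffs_def reflect_def fun_eq_iff)
  then show ?thesis using rseries_refl[of j a x] by (simp add: rseries_uminus)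
qed

text \<open>On the line at pi, reflection followed by a shift by one period is the identity.\<close>

lemma odd_rseries_boundary:
  assumes "odd_coeffs a" "x $ j = 0 \<or> x $ j = pi"
  shows "rseries a x = 0"
proof -
  have "rseries a (flip j x) = rseries a x"
  proof (cases "x $ j = 0")
    case True
    then have "flip j x = x" by (auto simp: vec_eq_iff flip_nth)
    then show ?thesis by simp
  next
    case False
    then have "flip j x + (2 * pi) *\<^sub>R ax j = x" using assms(2) by (auto simp: vec_eq_iff flip_nth axis_def)
    then show ?thesis using rseries_periodic[of a "flip j x" j] by simp
  qed
  then show ?thesis using odd_rseries[OF assms(1), of j x] by simp
qed

lemma odd_coeffs_even_symbol:
  assumes "odd_coeffs a" "\<And>j k. w (flip j k) = w k"
  shows "odd_coeffs (\<lambda>k. w k * a k)"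
  using assms by (simp add: odd_coeffs_def)

lemma odd_riesz: "odd_coeffs a \<Longrightarrow> odd_coeffs (riesz s a)"
  unfolding riesz_def[abs_def] by (rule odd_coeffs_even_symbol) (simp_all add: wavevector_flip)

lemma odd_heat: "odd_coeffs a \<Longrightarrow> odd_coeffs (heat \<tau> a)"
  unfolding heat_def[abs_def] by (rule odd_coeffs_even_symbol) (simp_all add: wavevector_flip)

text \<open>For the stream function this says that no fluid crosses the axis.\<close>

lemma odd_tangential_deriv:
  assumes "rapid a" "odd_coeffs a" "x $ j = 0" "i \<noteq> j"
  shows "rseries (fderiv i a) x = 0"
proof -
  have "reflect j a = (\<lambda>k. - a k)" using assms by (simp add: odd_coeffs_def reflect_def fun_eq_iff)
  moreover have "flip j x = x" using assms by (auto simp: vec_eq_iff flip_nth)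
  ultimately show ?thesis
    using rseries_fderiv_refl[of i j a x] assms(4) by (simp add: fderiv_uminus rseries_uminus)
qed

section \<open>Odd solutions\<close>

lemma rseries_line_deriv:
  assumes "rapid a"
  shows "((\<lambda>h. rseries a (x + h *\<^sub>R ax i)) has_real_derivative rseries (fderiv i a) (x + h *\<^sub>R ax i)) (at h within S)"
  using has_dir_deriv_line[OF rseries_dir_deriv[OF assms], of x i h S]
  by (simp add: has_real_derivative_iff_has_vector_derivative)

lemma rseries_line_lipschitz:
  assumes a: "rapid a" and B: "\<And>x. \<bar>rseries (fderiv i a) x\<bar> \<le> B"
  shows "\<bar>rseries a (x + h *\<^sub>R ax i) - rseries a x\<bar> \<le> B * \<bar>h\<bar>"
proof -
  have "norm (rseries a (x + h *\<^sub>R ax i) - rseries a (x + 0 *\<^sub>R ax i)) \<le> B * norm (h - 0)"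
  proof (rule field_differentiable_bound[of UNIV _ "\<lambda>h. rseries (fderiv i a) (x + h *\<^sub>R ax i)"])
    show "((\<lambda>h. rseries a (x + h *\<^sub>R ax i)) has_real_derivative rseries (fderiv i a) (x + z *\<^sub>R ax i)) (at z within UNIV)" for z
      by (rule rseries_line_deriv[OF a])
  qed (use B in auto)
  then show ?thesis by simp
qed

lemma one_sided_deriv_nonneg:
  fixes f :: "real \<Rightarrow> real"
  assumes "(f has_real_derivative d) (at 0)" "f 0 = 0" "\<And>h. 0 < h \<Longrightarrow> h < 1 \<Longrightarrow> 0 \<le> f h"
  shows "0 \<le> d"
proof (rule ccontr)
  assume "\<not> 0 \<le> d"
  then obtain e where e: "e > 0" "\<And>h. 0 < h \<Longrightarrow> h < e \<Longrightarrow> f (0 + h) < f 0"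
    using has_real_derivative_neg_dec_right[OF assms(1)] by auto
  have "f (0 + min e 1 / 2) < f 0" using e(1) by (intro e(2)) auto
  then show False using assms(2) assms(3)[of "min e 1 / 2"] e(1) by (simp add: min_def split: if_splits)
qed

section \<open>Inequalities for sines, and sine coefficients of odd functions\<close>

lemma abs_sin_int_mult: "\<bar>sin (of_int k * y)\<bar> \<le> \<bar>of_int k\<bar> * \<bar>sin y\<bar>" for y :: real
proof -
  have n: "\<bar>sin (real n * y)\<bar> \<le> real n * \<bar>sin y\<bar>" for n
  proof (induction n)
    case (Suc n)
    have "sin (real (Suc n) * y) = sin (real n * y) * cos y + cos (real n * y) * sin y"
      by (simp add: sin_add algebra_simps)
    also have "\<bar>\<dots>\<bar> \<le> \<bar>sin (real n * y)\<bar> * \<bar>cos y\<bar> + \<bar>cos (real n * y)\<bar> * \<bar>sin y\<bar>"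
      by (metis abs_mult abs_triangle_ineq)
    also have "\<dots> \<le> \<bar>sin (real n * y)\<bar> * 1 + 1 * \<bar>sin y\<bar>"
      by (intro add_mono mult_mono) auto
    also have "\<dots> \<le> real (Suc n) * \<bar>sin y\<bar>" using Suc by (simp add: algebra_simps)
    finally show ?case .
  qed simp
  show ?thesis
  proof (cases k rule: int_cases2)
    case (nonneg m) then show ?thesis using n[of m] by simp
  next
    case (nonpos m) then show ?thesis using n[of m] by simp
  qed
qed

text \<open>Two differentiations: the derivative of the gap is sin z - z cos z, whose derivative z
  sin z is non-negative on [0, pi]. This compares the transport term with the barrier in
  \<open>w_axis_barrier\<close>.\<close>

lemma abs_mult_sin_le: "\<bar>x * sin x\<bar> \<le> 2 * (1 - cos x)" if "\<bar>x\<bar> \<le> pi" for x :: real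
proof -
  have pos: "x * sin x \<le> 2 * (1 - cos x)" if x: "0 \<le> x" "x \<le> pi" for x :: real
  proof -
    have d1: "0 \<le> sin z - z * cos z" if z: "0 \<le> z" "z \<le> pi" for z :: real
    proof -
      have "(\<lambda>z. sin z - z * cos z) 0 \<le> (\<lambda>z. sin z - z * cos z) z"
      proof (rule DERIV_nonneg_imp_nondecreasing[OF z(1)])
        fix y assume y: "0 \<le> y" "y \<le> z"
        have "((\<lambda>z. sin z - z * cos z) has_real_derivative y * sin y) (at y)"
          by (auto intro!: derivative_eq_intros)
        moreover have "0 \<le> y * sin y" using y z by (intro mult_nonneg_nonneg sin_ge_zero) auto
        ultimately show "\<exists>l. ((\<lambda>z. sin z - z * cos z) has_real_derivative l) (at y) \<and> 0 \<le> l" by blast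
      qed
      then show ?thesis by simp
    qed
    have "(\<lambda>z. 2 * (1 - cos z) - z * sin z) 0 \<le> (\<lambda>z. 2 * (1 - cos z) - z * sin z) x"
    proof (rule DERIV_nonneg_imp_nondecreasing[OF x(1)])
      fix y assume y: "0 \<le> y" "y \<le> x"
      have "((\<lambda>z. 2 * (1 - cos z) - z * sin z) has_real_derivative sin y - y * cos y) (at y)"
        by (auto intro!: derivative_eq_intros)
      moreover have "0 \<le> sin y - y * cos y" using y x by (intro d1) auto
      ultimately show "\<exists>l. ((\<lambda>z. 2 * (1 - cos z) - z * sin z) has_real_derivative l) (at y) \<and> 0 \<le> l" by blast
    qed
    then show ?thesis by simp
  qed
  have "\<bar>x * sin x\<bar> = \<bar>x\<bar> * sin \<bar>x\<bar>"
    using that sin_ge_zero[of "\<bar>x\<bar>"] by (cases "0 \<le> x") (auto simp: abs_mult)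
  also have "\<dots> \<le> 2 * (1 - cos \<bar>x\<bar>)" using that by (intro pos) auto
  finally show ?thesis by simp
qed

text \<open>Averaging a coefficient, with signs, over the four reflections of k replaces the
  character by a product of two sines; the minus sign is the square of the imaginary unit.\<close>

lemma fcoeff_odd:
  assumes a: "rapid a" "herm a" and o: "odd_coeffs a"
  shows "a k = of_real (- cell_int (\<lambda>x. rseries a x * (sin (of_int (k $ 1) * x $ 1) * sin (of_int (k $ 2) * x $ 2))) / (2 * pi)\<^sup>2)"
proof -
  define J where "J q = cell_int (\<lambda>x. of_real (rseries a x) * character (- q) x)" for q
  have jc: "continuous_on UNIV (\<lambda>x. complex_of_real (rseries a x) * character (- q) x)" for q
    by (intro continuous_intros a)
  have f: "a q = J q / (2 * pi)\<^sup>2" for q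
    using fcoeff_fseries[OF a(1), of q] fseries_herm[OF a] by (simp add: fcoeff_def J_def)
  have "4 * a k = a k - a (flip 1 k) - a (flip 2 k) + a (flip 1 (flip 2 k))"
    using o by (simp add: odd_coeffs_def)
  also have "\<dots> = (J k - J (flip 1 k) - J (flip 2 k) + J (flip 1 (flip 2 k))) / (2 * pi)\<^sup>2"
    by (simp only: f J_def diff_divide_distrib add_divide_distrib)
  also have "J k - J (flip 1 k) - J (flip 2 k) + J (flip 1 (flip 2 k)) =
     cell_int (\<lambda>x. of_real (rseries a x) * character (- k) x - of_real (rseries a x) * character (- flip 1 k) x
     - of_real (rseries a x) * character (- flip 2 k) x + of_real (rseries a x) * character (- flip 1 (flip 2 k)) x)"
    unfolding J_def
    by (simp only: cell_int_add cell_int_diff jc continuous_on_add continuous_on_diff)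
  also have "(\<lambda>x. of_real (rseries a x) * character (- k) x - of_real (rseries a x) * character (- flip 1 k) x
     - of_real (rseries a x) * character (- flip 2 k) x + of_real (rseries a x) * character (- flip 1 (flip 2 k)) x) =
     (\<lambda>x. complex_of_real (-4 * (rseries a x * (sin (of_int (k $ 1) * x $ 1) * sin (of_int (k $ 2) * x $ 2)))))"
  proof
    fix x :: plane
    have e: "character (- k) x - character (- flip 1 k) x - character (- flip 2 k) x + character (- flip 1 (flip 2 k)) x
      = complex_of_real (- 4 * (sin (of_int (k $ 1) * x $ 1) * sin (of_int (k $ 2) * x $ 2)))"
      by (simp add: character_def wavevector_flip inner_2 flip_nth complex_eq_iff cos_add cos_diff sin_add sin_diff algebra_simps)
    have "of_real (rseries a x) * (character (- k) x - character (- flip 1 k) x - character (- flip 2 k) x + character (- flip 1 (flip 2 k)) x)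
      = complex_of_real (-4 * (rseries a x * (sin (of_int (k $ 1) * x $ 1) * sin (of_int (k $ 2) * x $ 2))))"
      unfolding e by (simp add: mult_ac)
    then show "of_real (rseries a x) * character (- k) x - of_real (rseries a x) * character (- flip 1 k) x
     - of_real (rseries a x) * character (- flip 2 k) x + of_real (rseries a x) * character (- flip 1 (flip 2 k)) x =
     complex_of_real (-4 * (rseries a x * (sin (of_int (k $ 1) * x $ 1) * sin (of_int (k $ 2) * x $ 2))))"
      by (simp add: algebra_simps)
  qed
  also have "cell_int \<dots> = of_real (- 4 * cell_int (\<lambda>x. rseries a x * (sin (of_int (k $ 1) * x $ 1) * sin (of_int (k $ 2) * x $ 2))))"
    by (subst cell_int_of_real, (intro continuous_intros a)+) (simp only: cell_int_cmult_right_real)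
  finally show ?thesis by (simp add: field_simps)
qed

section \<open>The weight sin x_1 sin x_2 and the initial profile\<close>

definition ss :: "plane \<Rightarrow> real" where "ss x = sin (x $ 1) * sin (x $ 2)"

lemma continuous_on_ss [continuous_intros]: "continuous_on S ss"
  unfolding ss_def[abs_def] by (intro continuous_intros)

lemma abs_ss_le_1: "\<bar>ss x\<bar> \<le> 1"
  unfolding ss_def abs_mult by (intro mult_le_one) auto

definition profile :: "plane \<Rightarrow> real" where "profile x = sin (x $ 1) ^ 3 * sin (x $ 2)"

lemma continuous_on_profile [continuous_intros]: "continuous_on S profile"
  unfolding profile_def[abs_def] by (intro continuous_intros)

lemma profile_mass_pos: "0 < cell_int (\<lambda>x. (profile x)\<^sup>2)"
proof -
  have c: "continuous_on (cbox (\<chi> i. - pi) (\<chi> i. pi)) (\<lambda>x. (profile x)\<^sup>2)" by (intro continuous_intros)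
  have "(\<chi> i. pi / 2) \<in> (cbox (\<chi> i. - pi) (\<chi> i. pi) :: plane set)"
    using pi_gt_zero by (simp add: mem_box_cart)
  moreover have "(0 :: plane) \<in> box (\<chi> i. - pi) (\<chi> i. pi)" by (simp add: mem_box_cart)
  moreover have "(profile (\<chi> i. pi / 2))\<^sup>2 = 1" by (simp add: profile_def)
  ultimately have "integral (cbox (\<chi> i. - pi) (\<chi> i. pi)) (\<lambda>x. (profile x)\<^sup>2) \<noteq> 0"
    using integral_cbox_eq_0_iff[OF c] by fastforce
  moreover have "0 \<le> integral (cbox (\<chi> i. - pi) (\<chi> i. pi)) (\<lambda>x. (profile x)\<^sup>2)"
    by (intro Henstock_Kurzweil_Integration.integral_nonneg integrable_continuous c) auto
  ultimately show ?thesis by (simp add: cell_int_def cell_def)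
qed

text \<open>The integrand tends to the indicator of the nodal set, which in the cell lies on
  finitely many lines; dominated convergence gives the limit 0.\<close>

lemma ss_nodal_power_tendsto: "(\<lambda>n. cell_int (\<lambda>x. (1 - (ss x)\<^sup>2) ^ n)) \<longlonglongrightarrow> 0"
proof -
  define g where "g x = (if ss x = 0 then 1 else 0 :: real)" for x
  have bound: "0 \<le> 1 - (ss x)\<^sup>2" "1 - (ss x)\<^sup>2 \<le> 1" for x
    using abs_ss_le_1[of x] by (auto simp: abs_square_le_1)
  have "(\<lambda>n. integral cell (\<lambda>x. (1 - (ss x)\<^sup>2) ^ n)) \<longlonglongrightarrow> integral cell g"
  proof (rule dominated_convergence)
    show "(\<lambda>x. (1 - (ss x)\<^sup>2) ^ n) integrable_on cell" for n
      by (intro integrable_on_cell continuous_intros)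
    show "(\<lambda>x. 1::real) integrable_on cell" by (intro integrable_on_cell continuous_intros)
    show "norm ((1 - (ss x)\<^sup>2) ^ n) \<le> 1" for n x
      using bound[of x] by (simp add: power_le_one)
    show "(\<lambda>n. (1 - (ss x)\<^sup>2) ^ n) \<longlonglongrightarrow> g x" for x
    proof (cases "ss x = 0")
      case False
      then have "1 - (ss x)\<^sup>2 < 1" by simp
      then show ?thesis using False bound[of x] by (auto simp: g_def intro: LIMSEQ_realpow_zero)
    qed (simp add: g_def)
  qed
  moreover have "(g has_integral 0) cell"
  proof (rule has_integral_negligible)
    let ?H = "\<lambda>i a. {x :: plane. x \<bullet> ax i = a}"
    show "negligible (\<Union>i. \<Union>a\<in>{0, pi, - pi}. ?H i a)"
    proof (intro negligible_Union)
      have "negligible (\<Union>a\<in>{0, pi, - pi}. ?H i a)" for i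
        by (intro negligible_Union) (auto intro!: negligible_standard_hyperplane simp: Basis_vec_def)
      then show "negligible S" if "S \<in> range (\<lambda>i. \<Union>a\<in>{0, pi, - pi}. ?H i a)" for S using that by auto
    qed auto
    fix x assume x: "x \<in> cell - (\<Union>i. \<Union>a\<in>{0, pi, - pi}. ?H i a)"
    have "sin (x $ i) \<noteq> 0" for i
    proof
      assume "sin (x $ i) = 0"
      then obtain m :: int where m: "x $ i = of_int m * pi" by (auto simp: sin_zero_iff_int2)
      have "- pi \<le> x $ i" "x $ i \<le> pi" using x by (auto simp: mem_cell)
      then have "\<bar>x $ i\<bar> \<le> pi" by linarith
      then have "\<bar>real_of_int m\<bar> \<le> 1" using m by (simp add: abs_mult)
      then have "m = 0 \<or> m = 1 \<or> m = -1" by linarith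
      then have "x $ i \<in> {0, pi, - pi}" using m by auto
      then show False using x by (auto simp: inner_axis)
    qed
    then show "g x = 0" by (simp add: g_def ss_def)
  qed
  ultimately show ?thesis by (simp add: cell_int_def integral_unique)
qed

text \<open>
  A function with prescribed energy and sup norm cannot concentrate on the nodal lines of \<open>ss\<close>,
  since these are a null set.
\<close>

lemma ss_weight_lower_bound:
  "\<exists>\<kappa>>0. \<forall>f A. continuous_on UNIV f \<longrightarrow> 0 < A \<longrightarrow> (\<forall>x. \<bar>f x\<bar> \<le> A) \<longrightarrow>
       cell_int (\<lambda>x. (f x)\<^sup>2) = A\<^sup>2 * cell_int (\<lambda>x. (profile x)\<^sup>2) \<longrightarrow>
       \<kappa> * A \<le> cell_int (\<lambda>x. \<bar>f x\<bar> * \<bar>ss x\<bar>)"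
proof -
  let ?m = "cell_int (\<lambda>x. (profile x)\<^sup>2)"
  have "\<forall>\<^sub>F n in sequentially. cell_int (\<lambda>x. (1 - (ss x)\<^sup>2) ^ n) < ?m / 2"
    using profile_mass_pos by (intro order_tendstoD[OF ss_nodal_power_tendsto]) auto
  then obtain n0 where n0: "\<And>n. n \<ge> n0 \<Longrightarrow> cell_int (\<lambda>x. (1 - (ss x)\<^sup>2) ^ n) < ?m / 2"
    by (auto simp: eventually_sequentially)
  \<comment> \<open>For this \<open>n\<close> the weight (1 - ss^2)^n, which is 1 on the nodal
    lines, can absorb less than half of the energy. The successor makes \<open>n\<close>
    positive.\<close>
  define n where "n = Suc n0"
  have n: "cell_int (\<lambda>x. (1 - (ss x)\<^sup>2) ^ n) < ?m / 2" using n0[of n] by (simp add: n_def)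
  have n_pos: "0 < real n" by (simp add: n_def)
  show ?thesis
  proof (intro exI[of _ "?m / (2 * real n)"] conjI allI impI)
    show "0 < ?m / (2 * real n)" using profile_mass_pos n_pos by simp
    fix f :: "plane \<Rightarrow> real" and A :: real
    assume f: "continuous_on UNIV f" and A: "0 < A" "\<forall>x. \<bar>f x\<bar> \<le> A" and E: "cell_int (\<lambda>x. (f x)\<^sup>2) = A\<^sup>2 * ?m"
    \<comment> \<open>Splits f^2 by the weight: one part is at most A^2 times the weight; the other
      is at most A |f| times 1 minus the weight, and Bernoulli's inequality bounds the latter factor
      by n |ss|.\<close>
    have "cell_int (\<lambda>x. (f x)\<^sup>2 - A\<^sup>2 * (1 - (ss x)\<^sup>2) ^ n) \<le> cell_int (\<lambda>x. (real n * A) * (\<bar>f x\<bar> * \<bar>ss x\<bar>))"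
    proof (rule cell_int_mono)
      fix x
      have s1: "(ss x)\<^sup>2 \<le> \<bar>ss x\<bar>"
        using mult_left_mono[OF abs_ss_le_1[of x], of "\<bar>ss x\<bar>"] by (simp add: power2_eq_square flip: abs_mult)
      have s2: "(ss x)\<^sup>2 \<le> 1" using abs_ss_le_1[of x] by (simp add: abs_square_le_1)
      have "1 - real n * (ss x)\<^sup>2 \<le> (1 - (ss x)\<^sup>2) ^ n"
        using Bernoulli_inequality[of "- (ss x)\<^sup>2" n] s2 by simp
      then have 1: "1 - (1 - (ss x)\<^sup>2) ^ n \<le> real n * \<bar>ss x\<bar>"
        using mult_left_mono[OF s1, of "real n"] by simp
      have f2: "(f x)\<^sup>2 \<le> A * \<bar>f x\<bar>"
        using mult_right_mono[OF A(2)[rule_format, of x], of "\<bar>f x\<bar>"] by (simp add: power2_eq_square flip: abs_mult)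
      have f3: "(f x)\<^sup>2 \<le> A\<^sup>2" using A by (simp add: abs_le_square_iff[symmetric])
      have p0: "0 \<le> (1 - (ss x)\<^sup>2) ^ n" using s2 by simp
      have p1: "(1 - (ss x)\<^sup>2) ^ n \<le> 1" using s2 by (intro power_le_one) auto
      have "(f x)\<^sup>2 - A\<^sup>2 * (1 - (ss x)\<^sup>2) ^ n \<le> (f x)\<^sup>2 * (1 - (1 - (ss x)\<^sup>2) ^ n)"
        using mult_right_mono[OF f3 p0] by (simp add: algebra_simps)
      also have "\<dots> \<le> (A * \<bar>f x\<bar>) * (real n * \<bar>ss x\<bar>)"
        using 1 f2 p1 A by (intro mult_mono) auto
      finally show "(f x)\<^sup>2 - A\<^sup>2 * (1 - (ss x)\<^sup>2) ^ n \<le> (real n * A) * (\<bar>f x\<bar> * \<bar>ss x\<bar>)" by (simp add: mult_ac)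
    qed (intro continuous_intros f)+
    moreover have "cell_int (\<lambda>x. (f x)\<^sup>2 - A\<^sup>2 * (1 - (ss x)\<^sup>2) ^ n) = A\<^sup>2 * ?m - A\<^sup>2 * cell_int (\<lambda>x. (1 - (ss x)\<^sup>2) ^ n)"
      by (subst cell_int_diff, (intro continuous_intros f)+) (simp add: E cell_int_cmult_right_real)
    moreover have "A\<^sup>2 * cell_int (\<lambda>x. (1 - (ss x)\<^sup>2) ^ n) \<le> A\<^sup>2 * (?m / 2)"
      using n by (intro mult_left_mono) auto
    ultimately have "A\<^sup>2 * (?m / 2) \<le> (real n * A) * cell_int (\<lambda>x. \<bar>f x\<bar> * \<bar>ss x\<bar>)"
      unfolding cell_int_cmult_right_real by linarith
    then have "A * (A * (?m / 2)) \<le> A * (real n * cell_int (\<lambda>x. \<bar>f x\<bar> * \<bar>ss x\<bar>))" by (simp add: power2_eq_square mult_ac)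
    then have "A * (?m / 2) \<le> real n * cell_int (\<lambda>x. \<bar>f x\<bar> * \<bar>ss x\<bar>)" using A(1) by (simp only: mult_le_cancel_left_pos)
    then show "?m / (2 * real n) * A \<le> cell_int (\<lambda>x. \<bar>f x\<bar> * \<bar>ss x\<bar>)" using n_pos by (simp add: field_simps)
  qed
qed


section \<open>Bounds for the solution with odd data\<close>

locale odd_solution = transport_solution +
  fixes A :: real
  assumes A: "0 < A" and initial: "\<And>x. rseries (c 0) x = A * profile x"
begin

lemma initial_odd: "odd_coeffs (c 0)"
proof -
  have 0: "0 \<in> {0..T}" using T by simp
  have "reflect j (c 0) k = - c 0 k" for j k
  proof -
    have "rseries (reflect j (c 0)) x = rseries (\<lambda>k. - c 0 k) x" for x
      using exhaust_2[of j] by (auto simp: rseries_refl rseries_uminus initial profile_def flip_nth)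
    moreover have "herm (reflect j (c 0))"
    proof -
      have "flip j (- k) = - flip j k" for k :: "int^2" by (simp add: vec_eq_iff flip_nth)
      then show ?thesis using herm[OF 0] by (simp add: herm_def reflect_def)
    qed
    moreover have "herm (\<lambda>k. - c 0 k)" using herm[OF 0] by (simp add: herm_def)
    ultimately have "fseries (reflect j (c 0)) = fseries (\<lambda>k. - c 0 k)"
      by (simp add: fun_eq_iff fseries_herm rapid_refl rapid_minus rapid_c[OF 0])
    then show ?thesis
      using fcoeff_fseries[OF rapid_refl[OF rapid_c[OF 0]], of j k] fcoeff_fseries[OF rapid_minus[OF rapid_c[OF 0]], of k] by simp
  qed
  then show ?thesis by (simp add: odd_coeffs_def reflect_def)
qed

lemma odd_c: "t \<in> {0..T} \<Longrightarrow> odd_coeffs (c t)"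
  by (rule odd_preserved[OF initial_odd])

abbreviation "w \<equiv> \<lambda>t. rseries (c t)"

text \<open>First-order condition at a contact point of the solution with a barrier
  \<open>b\<close>: the gradient of the solution is determined by the barrier, and so is the
  transport term.\<close>

lemma line_min_imp_deriv_eq:
  assumes t: "t \<in> {0..T}" and e: "e > 0"
    and b: "((\<lambda>h. b (x + h *\<^sub>R ax i)) has_real_derivative d) (at 0)"
    and m: "\<And>h. \<bar>h\<bar> < e \<Longrightarrow> b x + p * w t x \<le> b (x + h *\<^sub>R ax i) + p * w t (x + h *\<^sub>R ax i)"
  shows "d + p * rseries (fderiv i (c t)) x = 0"
proof (rule DERIV_local_min[OF _ e])
  show "((\<lambda>h. b (x + h *\<^sub>R ax i) + p * w t (x + h *\<^sub>R ax i)) has_real_derivative d + p * rseries (fderiv i (c t)) x) (at 0)"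
    using rseries_line_deriv[OF rapid_c[OF t], of x i 0 UNIV] by (auto intro!: DERIV_add DERIV_cmult b)
qed (use m in auto)

text \<open>The barrier is constant, so at a contact point the gradient and with it the transport
  term vanish; \<open>p\<close> stands for the two signs.\<close>

lemma abs_w_le:
  assumes t: "t \<in> {0..T}" shows "\<bar>w t x\<bar> \<le> A"
proof -
  have "0 \<le> A + p * w t y" if p: "\<bar>p\<bar> = 1" and y: "y \<in> cell" for p y
  proof (rule minimum_principle[where K = cell and T = T and x = y and t = t])
    show "continuous_on ({0..T} \<times> cell) (\<lambda>(t, x). A + p * w t x)"
      using tame_continuous[OF tame_c, of cell] by (auto simp: case_prod_unfold intro!: continuous_intros)
    show "0 \<le> A + p * w 0 x" if "x \<in> cell" for x
    proof -
      have "\<bar>sin (x $ 1) ^ 3 * sin (x $ 2)\<bar> \<le> 1" unfolding abs_mult power_abs by (intro mult_le_one power_le_one) auto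
      then have "\<bar>p * w 0 x\<bar> \<le> A * 1" unfolding initial abs_mult p profile_def using A by (simp add: abs_mult)
      then show ?thesis by linarith
    qed
    show "\<exists>d\<ge>0. ((\<lambda>s. A + p * w s x) has_real_derivative d) (at \<tau> within {0..T})"
      if \<tau>: "0 < \<tau>" "\<tau> \<le> T" "\<And>z. z \<in> cell \<Longrightarrow> A + p * w \<tau> x \<le> A + p * w \<tau> z" for \<tau> x
    proof -
      have t': "\<tau> \<in> {0..T}" using \<tau> by simp
      have glob: "A + p * w \<tau> x \<le> A + p * w \<tau> z" for z
        using \<tau>(3)[of "torus_rep z"] torus_subset_cell torus_rep_in_torus[of z] periodic_torus_rep[OF periodic_rseries, of "c \<tau>" z] by auto
      have g: "0 + p * rseries (fderiv i (c \<tau>)) x = 0" for i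
        by (rule line_min_imp_deriv_eq[OF t' zero_less_one, of "\<lambda>_. A"]) (use glob in auto)
      have "rseries (fderiv i (c \<tau>)) x = 0" for i using g[of i] p by (cases "p = 0") auto
      then have "((\<lambda>s. A + p * w s x) has_real_derivative 0 + p * - 0) (at \<tau> within {0..T})"
        using evolution[OF t', of x] by (intro DERIV_add DERIV_const DERIV_cmult) (simp add: vel_dot_grad_def)
      then show ?thesis by (intro exI[of _ 0]) simp
    qed
  qed (use t y in auto)
  from this[of 1 "torus_rep x"] this[of "-1" "torus_rep x"] show ?thesis
    using torus_subset_cell torus_rep_in_torus[of x] periodic_torus_rep[OF periodic_rseries, of "c t" x] by (auto simp: abs_le_iff)
qed

text \<open>A negative minimum over the quadrant is interior, because odd solutions vanish on its
  sides.\<close>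

lemma w_nonneg:
  assumes t: "t \<in> {0..T}" and y: "y \<in> quadrant" shows "0 \<le> w t y"
proof (rule minimum_principle[where K = quadrant and T = T and x = y and t = t])
  show "continuous_on ({0..T} \<times> quadrant) (\<lambda>(t, x). w t x)"
    by (rule tame_continuous[OF tame_c])
  show "0 \<le> w 0 x" if "x \<in> quadrant" for x
    using that A unfolding initial profile_def
    by (intro mult_nonneg_nonneg zero_le_power sin_ge_zero) (auto simp: mem_quadrant)
  show "\<exists>d\<ge>0. ((\<lambda>s. w s x) has_real_derivative d) (at \<tau> within {0..T})"
    if \<tau>: "0 < \<tau>" "\<tau> \<le> T" "x \<in> quadrant" "w \<tau> x < 0" "\<And>z. z \<in> quadrant \<Longrightarrow> w \<tau> x \<le> w \<tau> z" for \<tau> x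
  proof -
    have t': "\<tau> \<in> {0..T}" using \<tau> by simp
    have "x $ i \<noteq> 0 \<and> x $ i \<noteq> pi" for i using odd_rseries_boundary[OF odd_c[OF t'], of x i] \<tau>(4) by auto
    then obtain e where e: "e > 0" "\<And>s i. \<bar>s\<bar> < e \<Longrightarrow> x + s *\<^sub>R ax i \<in> quadrant"
      using quadrant_interior_step[OF \<tau>(3)] by metis
    have "0 + 1 * rseries (fderiv i (c \<tau>)) x = 0" for i
      by (rule line_min_imp_deriv_eq[OF t' e(1), of "\<lambda>_. 0"]) (use e(2) \<tau>(5) in auto)
    then show ?thesis
      using evolution[OF t', of x] by (intro exI[of _ 0]) (simp add: vel_dot_grad_def)
  qed
qed (use t y compact_quadrant in auto)

text \<open>
  The barrier \<open>exp (L t) (1 - cos x\<^sub>1)\<close> is a supersolution because \<open>u\<^sub>1\<close> vanishes on the axis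
  \<open>x\<^sub>1 = 0\<close>; its constants depend on the solution, but it forces \<open>w\<close> to vanish to second order there.
\<close>

lemma w_axis_barrier:
  "\<exists>C\<ge>0. \<forall>t\<in>{0..T}. \<forall>x\<in>cell. \<bar>w t x\<bar> \<le> C * (1 - cos (x $ 1))"
proof -
  obtain B where B: "\<And>t x. t \<in> {0..T} \<Longrightarrow> \<bar>rseries (fderiv 1 (fderiv 2 (riesz s (c t)))) x\<bar> \<le> B"
    using tame_bounded[OF tame_fderiv[OF tame_fderiv[OF tame_riesz[OF tame_c s_le_0]]], of 1 2] by metis
  have B0: "0 \<le> B" using order_trans[OF abs_ge_zero B[of 0 0]] T by simp
  have u1: "\<bar>vel1 s (c t) x\<bar> \<le> B * \<bar>x $ 1\<bar>" if t: "t \<in> {0..T}" for t x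
  proof -
    let ?y = "x - (x $ 1) *\<^sub>R ax 1"
    have "rseries (fderiv 2 (riesz s (c t))) ?y = 0"
      by (rule odd_tangential_deriv[of _ _ 1]) (auto intro!: rapid_riesz rapid_c t s_le_0 odd_riesz odd_c simp: axis_def)
    moreover have "\<bar>rseries (fderiv 2 (riesz s (c t))) (?y + (x $ 1) *\<^sub>R ax 1) - rseries (fderiv 2 (riesz s (c t))) ?y\<bar> \<le> B * \<bar>x $ 1\<bar>"
      by (intro rseries_line_lipschitz rapid_fderiv rapid_riesz rapid_c t s_le_0 B)
    ultimately show ?thesis by (simp add: vel1_def)
  qed
  \<comment> \<open>At time 0 the cube of the sine is at most sin^2 = (1 + cos)(1 - cos), hence the
    factor 2 A. The rate 2 B absorbs the transport term, as |u_1 sin x_1| \<le> B |x_1 sin x_1|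
    \<le> 2 B (1 - cos x_1).\<close>
  let ?b = "\<lambda>t x. 2 * A * exp (2 * B * t) * (1 - cos (x $ 1))"
  have "0 \<le> ?b t y + p * w t y" if t: "t \<in> {0..T}" and p: "\<bar>p\<bar> = 1" and y: "y \<in> cell" for t p and y :: plane
  proof (rule minimum_principle[where K = cell and T = T and x = y and t = t])
    show "continuous_on ({0..T} \<times> cell) (\<lambda>(t, x). ?b t x + p * w t x)"
      using tame_continuous[OF tame_c, of cell] by (auto simp: case_prod_unfold intro!: continuous_intros)
    show "0 \<le> ?b 0 x + p * w 0 x" if "x \<in> cell" for x
    proof -
      have "\<bar>sin (x $ 1) ^ 3 * sin (x $ 2)\<bar> \<le> (sin (x $ 1))\<^sup>2 * 1"
      proof -
        have "\<bar>sin (x $ 1)\<bar> ^ 3 * \<bar>sin (x $ 2)\<bar> \<le> \<bar>sin (x $ 1)\<bar>\<^sup>2 * 1"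
          by (intro mult_mono power_decreasing) auto
        then show ?thesis by (simp add: abs_mult power_abs)
      qed
      also have "\<dots> = (1 + cos (x $ 1)) * (1 - cos (x $ 1))"
        by (simp add: sin_squared_eq algebra_simps power2_eq_square)
      also have "\<dots> \<le> 2 * (1 - cos (x $ 1))"
        using cos_le_one[of "x $ 1"] by (intro mult_right_mono) auto
      finally have "A * \<bar>sin (x $ 1) ^ 3 * sin (x $ 2)\<bar> \<le> A * (2 * (1 - cos (x $ 1)))" using A by (intro mult_left_mono) auto
      then have "\<bar>p * w 0 x\<bar> \<le> ?b 0 x" using A by (simp add: initial abs_mult p profile_def)
      then show ?thesis by linarith
    qed
    show "\<exists>d\<ge>0. ((\<lambda>s. ?b s x + p * w s x) has_real_derivative d) (at \<tau> within {0..T})"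
      if \<tau>: "0 < \<tau>" "\<tau> \<le> T" "x \<in> cell" "\<And>z. z \<in> cell \<Longrightarrow> ?b \<tau> x + p * w \<tau> x \<le> ?b \<tau> z + p * w \<tau> z" for \<tau> x
    proof -
      have t': "\<tau> \<in> {0..T}" using \<tau> by simp
      \<comment> \<open>Periodicity turns a minimum over the cell into one over the plane, so the
        first-order conditions hold at boundary points of the cell as well.\<close>
      have "periodic (\<lambda>z :: plane. cos (z $ 1))"
        by (simp add: periodic_def axis_def)
      from periodic_torus_rep[OF this] have pc: "cos (torus_rep z $ 1) = cos (z $ 1)" for z by simp
      have glob: "?b \<tau> x + p * w \<tau> x \<le> ?b \<tau> z + p * w \<tau> z" for z
        using \<tau>(4)[of "torus_rep z"] torus_subset_cell torus_rep_in_torus[of z] periodic_torus_rep[OF periodic_rseries, of "c \<tau>" z] pc[of z] by auto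
      let ?E = "2 * A * exp (2 * B * \<tau>)"
      have g1: "?E * sin (x $ 1) + p * rseries (fderiv 1 (c \<tau>)) x = 0"
      proof (rule line_min_imp_deriv_eq[OF t' zero_less_one, of "?b \<tau>"])
        show "((\<lambda>h. ?b \<tau> (x + h *\<^sub>R ax 1)) has_real_derivative ?E * sin (x $ 1)) (at 0)"
          by (auto intro!: derivative_eq_intros)
      qed (rule glob)
      have g2: "0 + p * rseries (fderiv 2 (c \<tau>)) x = 0"
      proof (rule line_min_imp_deriv_eq[OF t' zero_less_one, of "?b \<tau>"])
        show "((\<lambda>h. ?b \<tau> (x + h *\<^sub>R ax 2)) has_real_derivative 0) (at 0)"
          by (auto simp: axis_def intro!: derivative_eq_intros)
      qed (rule glob)
      have pv: "p * vel_dot_grad s (c \<tau>) (c \<tau>) x = - vel1 s (c \<tau>) x * (?E * sin (x $ 1))"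
      proof -
        have "p * vel_dot_grad s (c \<tau>) (c \<tau>) x = vel1 s (c \<tau>) x * (p * rseries (fderiv 1 (c \<tau>)) x) + vel2 s (c \<tau>) x * (p * rseries (fderiv 2 (c \<tau>)) x)"
          by (simp add: vel_dot_grad_def algebra_simps)
        moreover have "p * rseries (fderiv 1 (c \<tau>)) x = - (?E * sin (x $ 1))" using g1 by linarith
        ultimately show ?thesis using g2 by simp
      qed
      have "((\<lambda>s. ?b s x + p * w s x) has_real_derivative
          (?E * (2 * B)) * (1 - cos (x $ 1)) + p * - vel_dot_grad s (c \<tau>) (c \<tau>) x) (at \<tau> within {0..T})"
        by (intro DERIV_add DERIV_cmult evolution t') (auto intro!: derivative_eq_intros)
      moreover have "0 \<le> (?E * (2 * B)) * (1 - cos (x $ 1)) + p * - vel_dot_grad s (c \<tau>) (c \<tau>) x"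
      proof -
        have "\<bar>vel1 s (c \<tau>) x * sin (x $ 1)\<bar> \<le> B * \<bar>x $ 1\<bar> * \<bar>sin (x $ 1)\<bar>"
          unfolding abs_mult by (intro mult_right_mono u1 t') auto
        also have "\<dots> = B * \<bar>x $ 1 * sin (x $ 1)\<bar>" by (simp add: abs_mult)
        also have "\<dots> \<le> B * (2 * (1 - cos (x $ 1)))"
          using \<tau>(3) B0 by (intro mult_left_mono abs_mult_sin_le) (auto simp: mem_cell abs_le_iff minus_le_iff)
        finally have "0 \<le> B * (2 * (1 - cos (x $ 1))) + vel1 s (c \<tau>) x * sin (x $ 1)" by linarith
        then have "0 \<le> ?E * (B * (2 * (1 - cos (x $ 1))) + vel1 s (c \<tau>) x * sin (x $ 1))"
          using A by (intro mult_nonneg_nonneg) auto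
        then show ?thesis using pv by (simp add: algebra_simps)
      qed
      ultimately show ?thesis by blast
    qed
  qed (use t y in auto)
  from this[of _ 1] this[of _ "-1"] have 1: "\<bar>w t x\<bar> \<le> ?b t x" if "t \<in> {0..T}" "x \<in> cell" for t x
    using that by (fastforce simp: abs_le_iff)
  have 2: "?b t x \<le> (2 * A * exp (2 * B * T)) * (1 - cos (x $ 1))" if "t \<in> {0..T}" for t and x :: plane
    using that B0 A by (intro mult_right_mono mult_left_mono) (auto intro: mult_left_mono)
  show ?thesis
    using A order_trans[OF 1 2] by (intro exI[of _ "2 * A * exp (2 * B * T)"] conjI ballI) auto
qed

text \<open>The barrier shows that the solution and its normal derivative vanish on the axis. Two
  applications of the mean value inequality with \<open>N\<close> then give an estimate free of the
  barrier's constant.\<close>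

lemma w_quadratic:
  assumes t: "t \<in> {0..T}" and N: "\<And>x. \<bar>rseries (fderiv 1 (fderiv 1 (c t))) x\<bar> \<le> N" and x: "x \<in> cell"
  shows "\<bar>w t x\<bar> \<le> N * (x $ 1)\<^sup>2"
proof -
  obtain C where C: "C \<ge> 0" "\<And>y. y \<in> cell \<Longrightarrow> \<bar>w t y\<bar> \<le> C * (1 - cos (y $ 1))"
    using w_axis_barrier t by blast
  have N0: "0 \<le> N" using order_trans[OF abs_ge_zero N] .
  let ?y = "x - (x $ 1) *\<^sub>R ax 1"
  have y0: "?y $ 1 = 0" by (simp add: axis_def)
  have w0: "w t ?y = 0" by (rule odd_rseries_boundary[OF odd_c[OF t], of _ 1]) (simp add: y0)
  have d0: "rseries (fderiv 1 (c t)) ?y = 0"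
  proof -
    have line: "((\<lambda>h. w t (?y + h *\<^sub>R ax 1)) has_real_derivative rseries (fderiv 1 (c t)) ?y) (at 0)"
      using rseries_line_deriv[OF rapid_c[OF t], of ?y 1 0 UNIV] by simp
    have inc: "?y + h *\<^sub>R ax 1 \<in> cell" if "\<bar>h\<bar> < pi" for h
      using that x by (auto simp: mem_cell forall_2 axis_def abs_less_iff)
    have bd: "\<bar>w t (?y + h *\<^sub>R ax 1)\<bar> \<le> C * (1 - cos h)" if "\<bar>h\<bar> < pi" for h
      using C(2)[OF inc[OF that]] by (simp add: axis_def)
    have "C * 0 - rseries (fderiv 1 (c t)) ?y = 0"
    proof (rule DERIV_local_min[of "\<lambda>h. C * (1 - cos h) - w t (?y + h *\<^sub>R ax 1)" _ 0 pi])
      show "((\<lambda>h. C * (1 - cos h) - w t (?y + h *\<^sub>R ax 1)) has_real_derivative C * 0 - rseries (fderiv 1 (c t)) ?y) (at 0)"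
        by (intro DERIV_diff DERIV_cmult line) (auto intro!: derivative_eq_intros)
      show "\<forall>h. \<bar>0 - h\<bar> < pi \<longrightarrow> C * (1 - cos 0) - w t (?y + 0 *\<^sub>R ax 1) \<le> C * (1 - cos h) - w t (?y + h *\<^sub>R ax 1)"
        using bd w0 by (auto simp: abs_le_iff)
    qed auto
    then show ?thesis by simp
  qed
  have d1: "\<bar>rseries (fderiv 1 (c t)) (?y + h *\<^sub>R ax 1)\<bar> \<le> N * \<bar>h\<bar>" for h
    using rseries_line_lipschitz[OF rapid_fderiv[OF rapid_c[OF t]] N, of ?y h] d0 by simp
  have "norm (w t (?y + (x $ 1) *\<^sub>R ax 1) - w t (?y + 0 *\<^sub>R ax 1)) \<le> (N * \<bar>x $ 1\<bar>) * norm (x $ 1 - 0)"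
  proof (rule field_differentiable_bound[of "closed_segment 0 (x $ 1)" _ "\<lambda>h. rseries (fderiv 1 (c t)) (?y + h *\<^sub>R ax 1)"])
    show "((\<lambda>h. w t (?y + h *\<^sub>R ax 1)) has_real_derivative rseries (fderiv 1 (c t)) (?y + z *\<^sub>R ax 1)) (at z within closed_segment 0 (x $ 1))" for z
      by (rule rseries_line_deriv[OF rapid_c[OF t]])
    show "norm (rseries (fderiv 1 (c t)) (?y + z *\<^sub>R ax 1)) \<le> N * \<bar>x $ 1\<bar>" if "z \<in> closed_segment 0 (x $ 1)" for z
    proof -
      have "\<bar>z\<bar> \<le> \<bar>x $ 1\<bar>" using that by (auto simp: closed_segment_eq_real_ivl split: if_splits)
      then show ?thesis using order_trans[OF d1 mult_left_mono[OF _ N0]] by simp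
    qed
  qed auto
  then show ?thesis using w0 by (simp add: power2_eq_square abs_mult mult.assoc)
qed

end

section \<open>The strain at the origin\<close>

text \<open>This is the x_2-derivative of u_2 and minus the x_1-derivative of u_1. The Riesz
  potential stands outermost so that the potential estimates apply to the mixed derivative of the
  solution.\<close>

definition strain :: "real \<Rightarrow> (int^2 \<Rightarrow> complex) \<Rightarrow> plane \<Rightarrow> real" where
  "strain s a x = rseries (riesz s (fderiv 1 (fderiv 2 a))) x"

context odd_solution
begin

lemma w_flip: "t \<in> {0..T} \<Longrightarrow> w t (flip j x) = - w t x"
  by (rule odd_rseries[OF odd_c])

text \<open>Both factors are odd in each variable and non-negative on the quadrant.\<close>

lemma w_ss_nonneg:
  assumes t: "t \<in> {0..T}" and x: "x \<in> cell"
  shows "w t x * ss x = \<bar>w t x\<bar> * \<bar>ss x\<bar>"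
proof -
  have q: "0 \<le> w t y * ss y" if "y \<in> quadrant" for y
    using w_nonneg[OF t that] that
    by (auto simp: ss_def mem_quadrant intro!: mult_nonneg_nonneg sin_ge_zero)
  have f: "w t (flip j y) * ss (flip j y) = w t y * ss y" for j y
    using exhaust_2[of j] by (auto simp: w_flip[OF t] ss_def flip_nth)
  define y where "y = (if x $ 1 < 0 then flip 1 x else x)"
  define z where "z = (if y $ 2 < 0 then flip 2 y else y)"
  have "z \<in> quadrant"
    using x by (auto simp: z_def y_def mem_quadrant mem_cell forall_2 flip_nth)
  moreover have "w t z * ss z = w t x * ss x" by (simp add: z_def y_def f)
  ultimately have "0 \<le> w t x * ss x" using q[of z] by simp
  then show ?thesis by (metis abs_mult abs_of_nonneg)
qed

text \<open>By \<open>mode_corner\<close> this is the coefficient of the mixed derivative at every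
  corner frequency; by \<open>mode_eq\<close> it is also a weighted L^1 norm of the solution, which
  is what keeps it away from 0.\<close>

definition "mode t = cell_int (\<lambda>x. w t x * ss x) / (2 * pi)\<^sup>2"

lemma strain_coeff:
  assumes t: "t \<in> {0..T}"
  shows "fderiv 1 (fderiv 2 (c t)) k = of_real (of_int (k $ 1) * of_int (k $ 2) *
     cell_int (\<lambda>x. w t x * (sin (of_int (k $ 1) * x $ 1) * sin (of_int (k $ 2) * x $ 2))) / (2 * pi)\<^sup>2)"
  using fcoeff_odd[OF rapid_c[OF t] herm[OF t] odd_c[OF t], of k] by (simp add: fderiv_def mult_ac)

lemma mode_corner:
  assumes t: "t \<in> {0..T}" and k: "k \<in> corner_modes"
  shows "fderiv 1 (fderiv 2 (c t)) k = of_real (mode t)"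
proof -
  have i: "sin (of_int j * y) = of_int j * sin y" "real_of_int j * of_int j = 1" if "\<bar>j\<bar> = 1" for j :: int and y :: real
    using that by (auto simp: abs_if split: if_splits)
  have k12: "\<bar>k $ 1\<bar> = 1" "\<bar>k $ 2\<bar> = 1" using k by (auto simp: corner_modes_def)
  have "cell_int (\<lambda>x. w t x * (sin (of_int (k $ 1) * x $ 1) * sin (of_int (k $ 2) * x $ 2))) =
     cell_int (\<lambda>x. (of_int (k $ 1) * of_int (k $ 2)) * (w t x * ss x))"
    unfolding i(1)[OF k12(1)] i(1)[OF k12(2)] ss_def by (simp add: mult_ac)
  also have "\<dots> = (of_int (k $ 1) * of_int (k $ 2)) * cell_int (\<lambda>x. w t x * ss x)"
    by (rule cell_int_cmult_right_real)
  finally have "of_int (k $ 1) * of_int (k $ 2) *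
     cell_int (\<lambda>x. w t x * (sin (of_int (k $ 1) * x $ 1) * sin (of_int (k $ 2) * x $ 2)))
    = (real_of_int (k $ 1) * of_int (k $ 1)) * (real_of_int (k $ 2) * of_int (k $ 2)) * cell_int (\<lambda>x. w t x * ss x)"
    by (simp add: mult_ac)
  then show ?thesis unfolding strain_coeff[OF t] i(2)[OF k12(1)] i(2)[OF k12(2)] by (simp add: mode_def)
qed

lemma mode_eq: "t \<in> {0..T} \<Longrightarrow> mode t = cell_int (\<lambda>x. \<bar>w t x\<bar> * \<bar>ss x\<bar>) / (2 * pi)\<^sup>2"
  unfolding mode_def cell_int_def by (simp cong: Henstock_Kurzweil_Integration.integral_cong add: w_ss_nonneg)

text \<open>One factor |k_1 k_2| comes from the two derivatives, the other from
  \<open>abs_sin_int_mult\<close>. Every coefficient is thus controlled by the corner ones, as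
  \<open>heat_corner_lower_bound\<close> demands.\<close>

lemma strain_coeff_bound:
  assumes t: "t \<in> {0..T}"
  shows "norm (fderiv 1 (fderiv 2 (c t)) k) \<le> mode t * (real_of_int (k $ 1))\<^sup>2 * (real_of_int (k $ 2))\<^sup>2"
proof -
  let ?I = "cell_int (\<lambda>x. w t x * (sin (of_int (k $ 1) * x $ 1) * sin (of_int (k $ 2) * x $ 2)))"
  let ?p = "\<bar>real_of_int (k $ 1)\<bar> * \<bar>real_of_int (k $ 2)\<bar>"
  note ct = rapid_c[OF t]
  have le: "\<bar>w t x * (sin (of_int (k $ 1) * x $ 1) * sin (of_int (k $ 2) * x $ 2))\<bar> \<le> ?p * (\<bar>w t x\<bar> * \<bar>ss x\<bar>)" for x
  proof -
    have "\<bar>sin (of_int (k $ 1) * x $ 1)\<bar> * \<bar>sin (of_int (k $ 2) * x $ 2)\<bar> \<le>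
       (\<bar>real_of_int (k $ 1)\<bar> * \<bar>sin (x $ 1)\<bar>) * (\<bar>real_of_int (k $ 2)\<bar> * \<bar>sin (x $ 2)\<bar>)"
      using abs_sin_int_mult by (intro mult_mono) auto
    then have "\<bar>w t x\<bar> * (\<bar>sin (of_int (k $ 1) * x $ 1)\<bar> * \<bar>sin (of_int (k $ 2) * x $ 2)\<bar>) \<le>
       \<bar>w t x\<bar> * ((\<bar>real_of_int (k $ 1)\<bar> * \<bar>sin (x $ 1)\<bar>) * (\<bar>real_of_int (k $ 2)\<bar> * \<bar>sin (x $ 2)\<bar>))"
      by (intro mult_left_mono) auto
    then show ?thesis by (simp add: abs_mult ss_def mult_ac)
  qed
  have "?I \<le> cell_int (\<lambda>x. ?p * (\<bar>w t x\<bar> * \<bar>ss x\<bar>))"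
    using le by (intro cell_int_mono continuous_intros ct) (auto simp: abs_le_iff)
  moreover have "cell_int (\<lambda>x. - (?p * (\<bar>w t x\<bar> * \<bar>ss x\<bar>))) \<le> ?I"
    using le by (intro cell_int_mono continuous_intros ct) (auto simp: abs_le_iff minus_le_iff)
  ultimately have "\<bar>?I\<bar> \<le> ?p * cell_int (\<lambda>x. \<bar>w t x\<bar> * \<bar>ss x\<bar>)"
    unfolding cell_int_minus cell_int_cmult_right_real by (simp add: abs_le_iff)
  then have "?p * \<bar>?I\<bar> \<le> ?p * (?p * cell_int (\<lambda>x. \<bar>w t x\<bar> * \<bar>ss x\<bar>))" by (intro mult_left_mono) auto
  also have "\<dots> = (real_of_int (k $ 1))\<^sup>2 * (real_of_int (k $ 2))\<^sup>2 * cell_int (\<lambda>x. \<bar>w t x\<bar> * \<bar>ss x\<bar>)"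
    by (simp add: power2_eq_square mult_ac flip: abs_mult)
  finally have "?p * \<bar>?I\<bar> / (2 * pi)\<^sup>2 \<le> mode t * (real_of_int (k $ 1))\<^sup>2 * (real_of_int (k $ 2))\<^sup>2"
    unfolding mode_eq[OF t] by (simp add: divide_right_mono mult_ac)
  then show ?thesis unfolding strain_coeff[OF t] norm_of_real by (simp add: abs_mult)
qed

text \<open>The heat flow stays non-negative on the quadrant and zero on the axes; its mixed
  derivative at the corner, read off by two successive one-sided derivatives, is therefore
  non-negative.\<close>

lemma heat_strain_nonneg:
  assumes t: "t \<in> {0..T}" and \<tau>: "0 \<le> \<tau>"
  shows "0 \<le> rseries (heat \<tau> (fderiv 1 (fderiv 2 (c t)))) 0"
proof -
  let ?V = "heat \<tau> (c t)"
  have r: "rapid ?V" by (intro rapid_heat rapid_c t \<tau>)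
  have o: "odd_coeffs ?V" by (intro odd_heat odd_c t)
  have V: "0 \<le> rseries ?V x" if "x \<in> quadrant" for x
    unfolding rseries_def
  proof (rule heat_nonneg_quadrant[OF rapid_c[OF t] _ _ \<tau> that])
    show "0 \<le> Re (fseries (c t) x)" if "x \<in> quadrant" for x
      using w_nonneg[OF t that] by (simp add: rseries_def)
    show "Re (fseries (heat \<sigma> (c t)) x) = 0" if "x $ i = 0 \<or> x $ i = pi" for \<sigma> i and x :: plane
      using odd_rseries_boundary[OF odd_heat[OF odd_c[OF t]] that] by (simp add: rseries_def)
  qed
  have d1: "0 \<le> rseries (fderiv 1 ?V) (h *\<^sub>R ax 2)" if h: "0 < h" "h < 1" for h
  proof (rule one_sided_deriv_nonneg[of "\<lambda>k. rseries ?V (h *\<^sub>R ax 2 + k *\<^sub>R ax 1)"])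
    show "((\<lambda>k. rseries ?V (h *\<^sub>R ax 2 + k *\<^sub>R ax 1)) has_real_derivative rseries (fderiv 1 ?V) (h *\<^sub>R ax 2)) (at 0)"
      using rseries_line_deriv[OF r, of "h *\<^sub>R ax 2" 1 0 UNIV] by simp
    show "rseries ?V (h *\<^sub>R ax 2 + 0 *\<^sub>R ax 1) = 0"
      by (rule odd_rseries_boundary[OF o, of _ 1]) (simp add: axis_def)
    show "0 \<le> rseries ?V (h *\<^sub>R ax 2 + k *\<^sub>R ax 1)" if "0 < k" "k < 1" for k
      using that h pi_gt3 by (intro V) (auto simp: mem_quadrant forall_2 axis_def)
  qed
  have "0 \<le> rseries (fderiv 2 (fderiv 1 ?V)) 0"
  proof (rule one_sided_deriv_nonneg[of "\<lambda>h. rseries (fderiv 1 ?V) (0 + h *\<^sub>R ax 2)"])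
    show "((\<lambda>h. rseries (fderiv 1 ?V) (0 + h *\<^sub>R ax 2)) has_real_derivative rseries (fderiv 2 (fderiv 1 ?V)) 0) (at 0)"
      using rseries_line_deriv[OF rapid_fderiv[OF r], of 1 0 2 0 UNIV] by simp
    show "rseries (fderiv 1 ?V) (0 + 0 *\<^sub>R ax 2) = 0"
      by (rule odd_tangential_deriv[OF r o, of _ 2]) auto
  qed (use d1 in auto)
  then show ?thesis by (simp add: fderiv_heat fderiv_commute[of 1 2])
qed

lemma norm_c_le: "t \<in> {0..T} \<Longrightarrow> norm (c t k) \<le> A"
proof -
  assume t: "t \<in> {0..T}"
  have "c t k = fcoeff (\<lambda>x. of_real (w t x)) k"
    using fcoeff_fseries[OF rapid_c[OF t], of k] fseries_herm[OF rapid_c[OF t] herm[OF t]] by (simp add: fcoeff_def)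
  also have "norm \<dots> \<le> A"
    by (rule norm_fcoeff_le) (use abs_w_le[OF t] in \<open>auto intro!: continuous_intros rapid_c t\<close>)
  finally show ?thesis .
qed

lemma strain_coeff_norm_le:
  assumes t: "t \<in> {0..T}"
  shows "norm (fderiv 1 (fderiv 2 (c t)) k) \<le> A * (freq_norm k)\<^sup>2"
proof -
  have "norm (fderiv 1 (fderiv 2 (c t)) k) = (\<bar>real_of_int (k $ 1)\<bar> * \<bar>real_of_int (k $ 2)\<bar>) * norm (c t k)"
    by (simp add: fderiv_def norm_mult)
  also have "\<dots> \<le> (freq_norm k * freq_norm k) * A"
    by (intro mult_mono abs_comp_le_freq_norm norm_c_le t) auto
  finally show ?thesis by (simp add: power2_eq_square mult_ac)
qed

end

text \<open>Conserved energy and the sup bound keep \<open>mode\<close> above a multiple of A;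
  positivity of the heat flow at all times and the corner modes at late times then feed
  \<open>riesz_lower_bound\<close>. As \<Lambda> depends on s alone, the bound is uniform in time
  and linear in A.\<close>

lemma strain_lower_bound:
  assumes s: "- 1 < s" "s < 0"
  shows "\<exists>\<Lambda>>0. \<forall>T c M A t. odd_solution s T c M A \<longrightarrow> t \<in> {0..T} \<longrightarrow> \<Lambda> * A \<le> strain s (c t) 0"
proof -
  obtain \<kappa> where \<kappa>: "\<kappa> > 0"
    "\<And>f A. continuous_on UNIV f \<Longrightarrow> 0 < A \<Longrightarrow> (\<And>x. \<bar>f x\<bar> \<le> A) \<Longrightarrow>
       cell_int (\<lambda>x. (f x)\<^sup>2) = A\<^sup>2 * cell_int (\<lambda>x. (profile x)\<^sup>2) \<Longrightarrow>
       \<kappa> * A \<le> cell_int (\<lambda>x. \<bar>f x\<bar> * \<bar>ss x\<bar>)"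
    using ss_weight_lower_bound by blast
  define \<tau>0 where "\<tau>0 = max 1 (65536 * lattice_sum / 2)"
  define g where "g = exp (- 2 * (\<tau>0 + 1)) * (\<tau>0 + 1) powr (- s - 1)"
  have \<tau>0: "1 \<le> \<tau>0" "65536 * lattice_sum \<le> 2 * \<tau>0" by (auto simp: \<tau>0_def)
  have g: "g > 0" using \<tau>0 by (simp add: g_def)
  have G: "Gamma (- s) > 0" using s by (intro Gamma_real_pos) auto
  show ?thesis
  proof (intro exI[of _ "2 * (\<kappa> / (2 * pi)\<^sup>2) * g / Gamma (- s)"] conjI allI impI)
    show "2 * (\<kappa> / (2 * pi)\<^sup>2) * g / Gamma (- s) > 0" using \<kappa> g G by simp
    fix T c M A t assume "odd_solution s T c M A" and t: "t \<in> {0..T}"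
    then interpret odd_solution s T c M A by simp
    let ?a = "fderiv 1 (fderiv 2 (c t))"
    have ra: "rapid ?a" by (intro rapid_fderiv rapid_c t)
    have "\<kappa> * A \<le> cell_int (\<lambda>x. \<bar>w t x\<bar> * \<bar>ss x\<bar>)"
    proof (rule \<kappa>(2)[OF _ A abs_w_le[OF t]])
      show "continuous_on UNIV (w t)" by (intro continuous_intros rapid_c t)
      show "cell_int (\<lambda>x. (w t x)\<^sup>2) = A\<^sup>2 * cell_int (\<lambda>x. (profile x)\<^sup>2)"
        unfolding energy_conserved[OF t] initial by (simp add: power_mult_distrib cell_int_cmult_right_real)
    qed
    then have mode: "\<kappa> / (2 * pi)\<^sup>2 * A \<le> mode t" unfolding mode_eq[OF t] by (simp add: divide_right_mono)
    then have m0: "0 \<le> mode t" using \<kappa>(1) A by (auto intro: order_trans[rotated])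
    have "(2 * mode t) * exp (- 2 * (\<tau>0 + 1)) * (\<tau>0 + 1) powr (- s - 1) \<le> Gamma (- s) * Re (fseries (riesz (- (- s)) ?a) 0)"
    proof (rule riesz_lower_bound[OF ra])
      show "?a 0 = 0" by (simp add: fderiv_def)
      show "0 \<le> Re (fseries (heat \<tau> ?a) 0)" if "0 \<le> \<tau>" for \<tau>
        using heat_strain_nonneg[OF t that] by (simp add: rseries_def)
      show "2 * mode t * exp (- 2 * \<tau>) \<le> Re (fseries (heat \<tau> ?a) 0)" if "\<tau>0 \<le> \<tau>" for \<tau>
        by (rule heat_corner_lower_bound[OF ra m0 mode_corner[OF t] strain_coeff_bound[OF t]]) (use that \<tau>0 in auto)
    qed (use s m0 \<tau>0 in auto)
    then have "2 * mode t * g \<le> Gamma (- s) * strain s (c t) 0"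
      by (simp add: g_def strain_def rseries_def mult_ac)
    moreover have "2 * (\<kappa> / (2 * pi)\<^sup>2 * A) * g \<le> 2 * mode t * g"
      using mode g by (intro mult_right_mono mult_left_mono) auto
    ultimately have "2 * (\<kappa> / (2 * pi)\<^sup>2 * A) * g \<le> strain s (c t) 0 * Gamma (- s)"
      unfolding mult.commute[of "strain s (c t) 0"] by (rule order_trans[rotated])
    then have "2 * (\<kappa> / (2 * pi)\<^sup>2 * A) * g / Gamma (- s) \<le> strain s (c t) 0"
      by (simp only: pos_divide_le_eq[OF G])
    then show "2 * (\<kappa> / (2 * pi)\<^sup>2) * g / Gamma (- s) * A \<le> strain s (c t) 0"
      by (simp only: mult_ac times_divide_eq_left times_divide_eq_right)
  qed
qed

text \<open>Each of the two terms of \<open>riesz_oscillation\<close> is allotted half of \<eta> A.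
  The first forces \<delta> to be of order B^(1/s), the second |x| to be of order
  \<delta>^4.\<close>

lemma strain_oscillation:
  assumes s: "- 1 < s" "s < 0" and \<eta>: "0 < \<eta>"
  shows "\<exists>C>0. C \<le> 1 \<and> (\<forall>T c M A t B x. odd_solution s T c M A \<longrightarrow> t \<in> {0..T} \<longrightarrow> 1 \<le> B \<longrightarrow>
       (\<forall>y. \<bar>rseries (fderiv 1 (fderiv 2 (c t))) y\<bar> \<le> A * B) \<longrightarrow> norm x \<le> C * B powr (4 / s) \<longrightarrow>
       \<bar>strain s (c t) x - strain s (c t) 0\<bar> \<le> \<eta> * A)"
proof -
  define \<sigma> where "\<sigma> = - s"
  have \<sigma>: "0 < \<sigma>" "\<sigma> < 1" using s by (auto simp: \<sigma>_def)
  have G: "Gamma \<sigma> > 0" using \<sigma> by (intro Gamma_real_pos) auto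
  \<comment> \<open>The value of \<delta> at B = 1, from the equation \<open>2 * B * \<delta> powr
    \<sigma> / \<sigma> = Gamma \<sigma> * \<eta> / 2\<close>.\<close>
  define d0 where "d0 = (Gamma \<sigma> * \<eta> * \<sigma> / 4) powr (1 / \<sigma>)"
  have d0: "d0 > 0" using G \<eta> \<sigma> by (simp add: d0_def less_imp_neq[OF G, symmetric])
  \<comment> \<open>The summand 1 makes \<open>L\<close> positive, so that one may divide by
    it.\<close>
  define L where "L = 65536 * lattice_sum * (Gamma \<sigma> * 2 powr \<sigma>) + 1"
  have L: "L \<ge> 1" using lattice_sum_nonneg G by (simp add: L_def)
  define C where "C = min 1 (\<eta> * Gamma \<sigma> * d0 ^ 4 / (2 * L))"
  show ?thesis
  proof (intro exI[of _ C] conjI allI impI)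
    show "0 < C" using \<eta> G d0 L by (simp add: C_def)
    show "C \<le> 1" by (simp add: C_def)
    fix T c M A t B and x :: plane
    assume "odd_solution s T c M A" and t: "t \<in> {0..T}" and B: "1 \<le> B"
      and N: "\<forall>y. \<bar>rseries (fderiv 1 (fderiv 2 (c t))) y\<bar> \<le> A * B" and x: "norm x \<le> C * B powr (4 / s)"
    then interpret odd_solution s T c M A by simp
    let ?a = "fderiv 1 (fderiv 2 (c t))"
    have ra: "rapid ?a" by (intro rapid_fderiv rapid_c t)
    define \<delta> where "\<delta> = d0 * B powr (- 1 / \<sigma>)"
    have \<delta>: "0 < \<delta>" using d0 B by (simp add: \<delta>_def)
    have \<delta>\<sigma>: "\<delta> powr \<sigma> = Gamma \<sigma> * \<eta> * \<sigma> / 4 / B"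
    proof -
      have "0 < Gamma \<sigma> * \<eta> * \<sigma> / 4" using G \<eta> \<sigma> by (intro divide_pos_pos mult_pos_pos) auto
      then have 1: "d0 powr \<sigma> = Gamma \<sigma> * \<eta> * \<sigma> / 4" using \<sigma> unfolding d0_def powr_powr by simp
      have 2: "(B powr (- 1 / \<sigma>)) powr \<sigma> = 1 / B" using B \<sigma> unfolding powr_powr by (simp add: powr_minus_divide)
      have "\<delta> powr \<sigma> = d0 powr \<sigma> * (B powr (- 1 / \<sigma>)) powr \<sigma>"
        unfolding \<delta>_def by (rule powr_mult)
      then show ?thesis unfolding 1 2 by simp
    qed
    have \<delta>4: "\<delta> ^ 4 = d0 ^ 4 * B powr (4 / s)"
    proof -
      have "(B powr (- 1 / \<sigma>)) ^ 4 = (B powr (- 1 / \<sigma>)) powr (real 4)" using B by (simp add: powr_realpow)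
      also have "\<dots> = B powr (4 / s)" by (simp add: powr_powr \<sigma>_def)
      finally show ?thesis by (simp add: \<delta>_def power_mult_distrib)
    qed
    have "Gamma \<sigma> * \<bar>Re (fseries (riesz (- \<sigma>) ?a) x) - Re (fseries (riesz (- \<sigma>) ?a) 0)\<bar>
     \<le> 2 * (A * B) * (\<delta> powr \<sigma> / \<sigma>) + A * norm x * (65536 / \<delta> ^ 4) * lattice_sum * (Gamma \<sigma> * 2 powr \<sigma>)"
      by (rule riesz_oscillation[OF ra \<sigma>(1) \<delta>]) (use N strain_coeff_norm_le[OF t] in \<open>auto simp: rseries_def\<close>)
    also have "2 * (A * B) * (\<delta> powr \<sigma> / \<sigma>) = Gamma \<sigma> * (\<eta> * A) / 2"
      unfolding \<delta>\<sigma> using B \<sigma> by (simp add: field_simps)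
    also have "A * norm x * (65536 / \<delta> ^ 4) * lattice_sum * (Gamma \<sigma> * 2 powr \<sigma>) \<le> Gamma \<sigma> * (\<eta> * A) / 2"
    proof -
      have "norm x * L \<le> (C * B powr (4 / s)) * L" using x L by (intro mult_right_mono) auto
      also have "\<dots> \<le> (\<eta> * Gamma \<sigma> * d0 ^ 4 / (2 * L) * B powr (4 / s)) * L"
        using L by (intro mult_right_mono) (auto simp: C_def)
      also have "\<dots> = \<eta> * Gamma \<sigma> / 2 * \<delta> ^ 4" using L unfolding \<delta>4 by simp
      finally have 1: "norm x * L \<le> \<eta> * Gamma \<sigma> / 2 * \<delta> ^ 4" .
      have "norm x * (65536 * lattice_sum * (Gamma \<sigma> * 2 powr \<sigma>)) \<le> norm x * L"
        by (intro mult_left_mono) (auto simp: L_def)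
      then have "norm x * (65536 * lattice_sum * (Gamma \<sigma> * 2 powr \<sigma>)) / \<delta> ^ 4 \<le> \<eta> * Gamma \<sigma> / 2"
        using 1 \<delta> by (simp add: pos_divide_le_eq)
      then have "A * (norm x * (65536 * lattice_sum * (Gamma \<sigma> * 2 powr \<sigma>)) / \<delta> ^ 4) \<le> A * (\<eta> * Gamma \<sigma> / 2)"
        using A by (intro mult_left_mono) auto
      then show ?thesis by (simp add: mult_ac)
    qed
    finally have "Gamma \<sigma> * \<bar>Re (fseries (riesz (- \<sigma>) ?a) x) - Re (fseries (riesz (- \<sigma>) ?a) 0)\<bar> \<le> Gamma \<sigma> * (\<eta> * A)" by linarith
    then have "\<bar>Re (fseries (riesz (- \<sigma>) ?a) x) - Re (fseries (riesz (- \<sigma>) ?a) 0)\<bar> \<le> \<eta> * A"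
      by (simp only: mult_le_cancel_left_pos[OF G])
    then show "\<bar>strain s (c t) x - strain s (c t) 0\<bar> \<le> \<eta> * A" by (simp add: strain_def rseries_def \<sigma>_def)
  qed
qed

section \<open>Transport into the corner\<close>

lemma sin_ge_half: "y / 2 \<le> sin y" if "0 \<le> y" "y \<le> 1" for y :: real
proof -
  have "(\<lambda>y. sin y - y / 2) 0 \<le> (\<lambda>y. sin y - y / 2) y"
  proof (rule DERIV_nonneg_imp_nondecreasing[OF that(1)])
    fix z assume z: "0 \<le> z" "z \<le> y"
    have "((\<lambda>y. sin y - y / 2) has_real_derivative cos z - 1 / 2) (at z)"
      by (auto intro!: derivative_eq_intros)
    moreover have "cos (pi / 3) \<le> cos z"
      using z that pi_gt3 by (intro cos_monotone_0_pi_le) auto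
    then have "0 \<le> cos z - 1 / 2" by (simp add: cos_60)
    ultimately show "\<exists>l. ((\<lambda>y. sin y - y / 2) has_real_derivative l) (at z) \<and> 0 \<le> l" by blast
  qed
  then show ?thesis by simp
qed

lemma corner_profile_deriv_P:
  "((\<lambda>h. D * ((p + h * E) ^ 3 * q * (1 - (p + h * E) - q))) has_real_derivative
     D * (q * (3 * p ^ 2 * (1 - p - q) - p ^ 3)) * E) (at 0)" for p q :: real
  by (rule derivative_eq_intros refl | simp)+ (simp add: algebra_simps power2_eq_square power3_eq_cube)

lemma corner_profile_deriv_Q:
  "((\<lambda>h. D * (p ^ 3 * (q + h * E) * (1 - p - (q + h * E)))) has_real_derivative
     D * (p ^ 3 * (1 - p - 2 * q)) * E) (at 0)" for p q :: real
  by (rule derivative_eq_intros refl | simp)+ (simp add: algebra_simps)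

text \<open>Arranged so that \<open>a\<close> and \<open>b\<close>, the relative growth rates of P
  and Q, multiply the same polynomials as the velocity components do in the transport term.\<close>

lemma corner_profile_deriv_time:
  fixes P Q :: "real \<Rightarrow> real"
  assumes "(P has_real_derivative a * P t) (at t within S)" "(Q has_real_derivative b * Q t) (at t within S)"
  shows "((\<lambda>t. C * exp (k * t) * (P t ^ 3 * Q t * (1 - P t - Q t))) has_real_derivative
     k * (C * exp (k * t) * (P t ^ 3 * Q t * (1 - P t - Q t)))
     + C * exp (k * t) * (a * (Q t * (3 * P t ^ 3 * (1 - P t - Q t) - P t ^ 4)) + b * (P t ^ 3 * (Q t * (1 - P t - 2 * Q t))))) (at t within S)"
proof -
  have e: "((\<lambda>t. C * exp (k * t)) has_real_derivative k * (C * exp (k * t))) (at t within S)"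
    by (auto intro!: derivative_eq_intros)
  have p: "((\<lambda>t. P t ^ 3 * Q t * (1 - P t - Q t)) has_real_derivative
      (3 * P t ^ 2 * (a * P t) * Q t + P t ^ 3 * (b * Q t)) * (1 - P t - Q t) + P t ^ 3 * Q t * (- (a * P t) - b * Q t)) (at t within S)"
    by (rule derivative_eq_intros assms refl | simp)+
  show ?thesis
    by (rule DERIV_cong[OF DERIV_mult[OF e p]])
       (simp add: algebra_simps power2_eq_square power3_eq_cube power4_eq_xxxx)
qed

context odd_solution
begin

abbreviation "lam \<equiv> \<lambda>t. strain s (c t) 0"

lemma lam_continuous: "continuous_on {0..T} lam"
  unfolding strain_def
  using tame_time_continuous[OF tame_riesz[OF tame_fderiv[OF tame_fderiv[OF tame_c]] s_le_0]] .

text \<open>Each velocity component vanishes on one axis, and its derivative away from that axis is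
  the strain up to sign. The mean value inequality on the perpendicular segment makes the error
  relative to the distance from the axis, as comparison with a linear flow requires.\<close>

lemma velocity_near_origin:
  assumes t: "t \<in> {0..T}" and osc: "\<And>y. norm y \<le> \<rho> \<Longrightarrow> \<bar>strain s (c t) y - lam t\<bar> \<le> \<epsilon>"
    and x: "0 \<le> x $ 1" "0 \<le> x $ 2" "norm x \<le> \<rho>"
  shows "\<bar>vel1 s (c t) x + lam t * x $ 1\<bar> \<le> \<epsilon> * x $ 1" "\<bar>vel2 s (c t) x - lam t * x $ 2\<bar> \<le> \<epsilon> * x $ 2"
proof -
  have rr: "rapid (riesz s (c t))" by (intro rapid_riesz rapid_c t s_le_0)
  have oo: "odd_coeffs (riesz s (c t))" by (intro odd_riesz odd_c t)
  have key: "\<bar>rseries (fderiv j (riesz s (c t))) x - lam t * x $ i\<bar> \<le> \<epsilon> * x $ i" if ij: "i \<noteq> j" for i j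
  proof -
    let ?y = "x - (x $ i) *\<^sub>R ax i"
    let ?f = "\<lambda>h. rseries (fderiv j (riesz s (c t))) (?y + h *\<^sub>R ax i) - lam t * h"
    have xi: "0 \<le> x $ i" using x exhaust_2[of i] by auto
    have "rseries (fderiv j (riesz s (c t))) ?y = 0"
      by (rule odd_tangential_deriv[OF rr oo, of _ i]) (use ij in \<open>auto simp: axis_def\<close>)
    moreover have "norm (?f (x $ i) - ?f 0) \<le> \<epsilon> * norm (x $ i - 0)"
    proof (rule field_differentiable_bound[of "{0..x $ i}" _ "\<lambda>h. strain s (c t) (?y + h *\<^sub>R ax i) - lam t"])
      fix h assume h: "h \<in> {0..x $ i}"
      have "fderiv i (fderiv j (riesz s (c t))) = riesz s (fderiv 1 (fderiv 2 (c t)))"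
        using ij exhaust_2[of i] exhaust_2[of j] by (auto simp: fderiv_riesz fderiv_commute[of 2 1])
      then have "((\<lambda>h. rseries (fderiv j (riesz s (c t))) (?y + h *\<^sub>R ax i)) has_real_derivative strain s (c t) (?y + h *\<^sub>R ax i)) (at h within {0..x $ i})"
        using rseries_line_deriv[OF rapid_fderiv[OF rr], of j ?y i h] by (simp add: strain_def)
      from DERIV_diff[OF this DERIV_cmult_Id[of "lam t"]]
      show "(?f has_real_derivative strain s (c t) (?y + h *\<^sub>R ax i) - lam t) (at h within {0..x $ i})" .
      have "(norm (?y + h *\<^sub>R ax i))\<^sup>2 \<le> (norm x)\<^sup>2"
        unfolding norm_2_sq using h exhaust_2[of i] by (auto simp: axis_def intro!: power_mono)
      then have "norm (?y + h *\<^sub>R ax i) \<le> norm x" by (simp add: abs_le_square_iff[symmetric])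
      then show "norm (strain s (c t) (?y + h *\<^sub>R ax i) - lam t) \<le> \<epsilon>" using x(3) osc by simp
    qed (use xi in auto)
    ultimately show ?thesis using xi by simp
  qed
  from key[of 1 2] show "\<bar>vel1 s (c t) x + lam t * x $ 1\<bar> \<le> \<epsilon> * x $ 1"
    unfolding vel1_def by (simp add: abs_le_iff)
  from key[of 2 1] show "\<bar>vel2 s (c t) x - lam t * x $ 2\<bar> \<le> \<epsilon> * x $ 2"
    by (simp add: vel2_def)
qed

text \<open>
  In the linearised flow the point (x1, x2) comes from \<open>(exp L * x1, exp (- L) * x2)\<close>. The profile
  \<open>P\<^sup>3 Q (1 - P - Q)\<close> of these coordinates, damped in time and with P, Q inflated by \<open>exp (\<epsilon> t)\<close>, is a
  subsolution; it is positive only where P + Q < 1, so no information crosses the sides of the box.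
\<close>

lemma corner_subsolution:
  assumes \<epsilon>: "0 \<le> \<epsilon>" and r: "0 < r" "r \<le> 1" and lam0: "\<And>t. t \<in> {0..T} \<Longrightarrow> 0 \<le> lam t"
    and osc: "\<And>t y. t \<in> {0..T} \<Longrightarrow> norm y \<le> 2 * r \<Longrightarrow> \<bar>strain s (c t) y - lam t\<bar> \<le> \<epsilon>"
  defines "L \<equiv> \<lambda>t. integral {0..t} lam"
  defines "x \<equiv> (\<chi> i. if i = 1 then r * exp (- L T - \<epsilon> * T) / 3 else r * exp (- \<epsilon> * T) / 3) :: plane"
  shows "A * r ^ 4 * exp (- L T - 8 * \<epsilon> * T) / 3888 \<le> w T x" "x \<in> cell"
proof -
  have TT: "T \<in> {0..T}" "0 \<in> {0..T}" using T by auto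
  have Ld: "(L has_real_derivative lam t) (at t within {0..T})" if "t \<in> {0..T}" for t
    unfolding L_def by (rule integral_has_real_derivative[OF lam_continuous that])
  have Lcont: "continuous_on {0..T} L" using Ld by (rule DERIV_continuous_on)
  have L0: "L 0 = 0" by (simp add: L_def)
  have lam_int: "lam integrable_on {0..t}" if "t \<in> {0..T}" for t
    by (rule integrable_continuous_real, rule continuous_on_subset[OF lam_continuous]) (use that in auto)
  have Lle: "L t \<le> L T" if "t \<in> {0..T}" for t
    unfolding L_def using that lam0 by (intro integral_subset_le lam_int TT) auto
  have Lnn: "0 \<le> L T" using Lle[OF TT(2)] L0 by simp
  \<comment> \<open>Width of the profile in x_2 at time 0. Stretching by at most exp(L T) keeps the
    region Q < 1 inside the box up to time T.\<close>
  define b where "b = r * exp (- L T)"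
  have b: "0 < b" "b \<le> r" using r Lnn by (auto simp: b_def)
  \<comment> \<open>16 = 2 ^ 4, from sin y \<ge> y / 2 in each of the four sine factors of the
    data.\<close>
  define C where "C = A * r ^ 3 * b / 16"
  have C: "0 < C" using A r b by (simp add: C_def)
  define P where "P t y = y $ 1 * exp (L t + \<epsilon> * t) / r" for t and y :: plane
  define Q where "Q t y = y $ 2 * exp (- L t + \<epsilon> * t) / b" for t and y :: plane
  define \<Phi> where "\<Phi> t y = C * exp (- 8 * \<epsilon> * t) * (P t y ^ 3 * Q t y * (1 - P t y - Q t y))" for t and y :: plane
  define K where "K = (cbox 0 (\<chi> i. r) :: plane set)"
  have mK: "y \<in> K \<longleftrightarrow> (\<forall>i. 0 \<le> y $ i \<and> y $ i \<le> r)" for y by (simp add: K_def mem_box_cart)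
  have Kq: "y \<in> quadrant" if "y \<in> K" for y
    using that r pi_gt3 by (auto simp: mK mem_quadrant intro: order_trans)
  have Kn: "norm y \<le> 2 * r" if "y \<in> K" for y
  proof -
    have "norm y \<le> \<bar>y $ 1\<bar> + \<bar>y $ 2\<bar>" using norm_le_l1_cart[of y] by (simp add: UNIV_2)
    moreover have "0 \<le> y $ 1" "y $ 1 \<le> r" "0 \<le> y $ 2" "y $ 2 \<le> r" using that by (auto simp: mK)
    ultimately show ?thesis by linarith
  qed
  have main: "0 \<le> w t y - \<Phi> t y" if t: "t \<in> {0..T}" and y: "y \<in> K" for t y
  proof (rule minimum_principle[where K = K and T = T and x = y and t = t])
    show "compact K" by (simp add: K_def compact_cbox)
    have Lc2: "continuous_on ({0..T} \<times> K) (\<lambda>p. L (fst p))"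
      by (rule continuous_on_compose2[OF Lcont continuous_on_fst[OF continuous_on_id]]) auto
    show "continuous_on ({0..T} \<times> K) (\<lambda>(t, y). w t y - \<Phi> t y)"
      using tame_continuous[OF tame_c, of K] Lc2 unfolding \<Phi>_def P_def Q_def case_prod_unfold
      by (intro continuous_intros) (use r b in auto)
    show "0 \<le> w 0 y - \<Phi> 0 y" if y: "y \<in> K" for y
    proof -
      have yy: "0 \<le> y $ i" "y $ i \<le> 1" for i using y r by (auto simp: mK intro: order_trans)
      have PQ: "P 0 y = y $ 1 / r" "Q 0 y = y $ 2 / b" by (simp_all add: P_def Q_def L0)
      have PQ0: "0 \<le> P 0 y" "0 \<le> Q 0 y" using yy r b by (simp_all add: PQ)
      then have "P 0 y ^ 3 * Q 0 y * (1 - P 0 y - Q 0 y) \<le> P 0 y ^ 3 * Q 0 y * 1"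
        by (intro mult_left_mono) auto
      then have "\<Phi> 0 y \<le> C * (P 0 y ^ 3 * Q 0 y)" using C by (simp add: \<Phi>_def)
      also have "\<dots> = A * ((y $ 1 / 2) ^ 3 * (y $ 2 / 2))"
        using r b by (simp add: PQ C_def power_divide)
      also have "\<dots> \<le> A * (sin (y $ 1) ^ 3 * sin (y $ 2))"
        using yy A sin_ge_half by (intro mult_left_mono mult_mono power_mono) (auto intro!: sin_ge_zero order_trans[OF yy(2)] simp: pi_ge_two order_trans[OF _ pi_ge_two])
      finally show ?thesis by (simp add: initial profile_def)
    qed
    show "\<exists>d\<ge>0. ((\<lambda>s. w s y - \<Phi> s y) has_real_derivative d) (at \<tau> within {0..T})"
      if \<tau>: "0 < \<tau>" "\<tau> \<le> T" and y: "y \<in> K" and neg: "w \<tau> y - \<Phi> \<tau> y < 0"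
        and min: "\<And>z. z \<in> K \<Longrightarrow> w \<tau> y - \<Phi> \<tau> y \<le> w \<tau> z - \<Phi> \<tau> z" for \<tau> y
    proof -
      have t': "\<tau> \<in> {0..T}" using \<tau> by simp
      let ?p = "P \<tau> y" and ?q = "Q \<tau> y" and ?D = "C * exp (- 8 * \<epsilon> * \<tau>)"
      have yy: "0 \<le> y $ i" "y $ i \<le> r" for i using y by (auto simp: mK)
      have D: "0 < ?D" using C by simp
      have pq0: "0 \<le> ?p" "0 \<le> ?q" using yy r b by (auto simp: P_def Q_def)
      \<comment> \<open>Where the difference is negative the profile exceeds the non-negative
        solution, so P, Q and 1 - P - Q are positive and the point lies in the interior of the
        box.\<close>
      have "0 < \<Phi> \<tau> y" using neg w_nonneg[OF t' Kq[OF y]] by linarith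
      then have pos: "0 < ?p ^ 3 * ?q * (1 - ?p - ?q)" unfolding \<Phi>_def by (rule zero_less_mult_pos[OF _ D])
      then have nz: "?p \<noteq> 0" "?q \<noteq> 0" by auto
      then have pq: "0 < ?p" "0 < ?q" using pq0 by auto
      have "0 < 1 - ?p - ?q" by (rule zero_less_mult_pos[OF pos]) (intro mult_pos_pos zero_less_power pq)
      then have lt: "?p + ?q < 1" by simp
      have y1: "0 < y $ 1" "0 < y $ 2" using nz yy[of 1] yy[of 2] by (auto simp: P_def Q_def less_le)
      have y2: "y $ 1 < r"
      proof -
        have "0 \<le> L \<tau>" unfolding L_def using t' lam0 by (intro integral_nonneg lam_int) auto
        then have "1 \<le> exp (L \<tau> + \<epsilon> * \<tau>)" using \<epsilon> \<tau> by simp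
        then have "y $ 1 * 1 \<le> y $ 1 * exp (L \<tau> + \<epsilon> * \<tau>)" using yy by (intro mult_left_mono) auto
        also have "\<dots> < r"
        proof -
          have "?p < 1" using lt pq by linarith
          then show ?thesis using r by (simp add: P_def)
        qed
        finally show ?thesis by simp
      qed
      have y3: "y $ 2 < r"
      proof -
        have "y $ 2 * exp (- L \<tau> + \<epsilon> * \<tau>) < b"
        proof -
          have "?q < 1" using lt pq by linarith
          then show ?thesis using b by (simp add: Q_def)
        qed
        moreover have "0 \<le> \<epsilon> * \<tau>" using \<epsilon> \<tau> by simp
        then have "exp (- L T) \<le> exp (- L \<tau> + \<epsilon> * \<tau>)" using Lle[OF t'] by simp
        then have "y $ 2 * exp (- L T) \<le> y $ 2 * exp (- L \<tau> + \<epsilon> * \<tau>)" using yy by (intro mult_left_mono) auto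
        ultimately have "y $ 2 * exp (- L T) < r * exp (- L T)" unfolding b_def by linarith
        then show ?thesis by (simp only: mult_less_cancel_right_pos[OF exp_gt_zero])
      qed
      define e where "e = Min {y $ 1, y $ 2, r - y $ 1, r - y $ 2}"
      have e: "0 < e" "e \<le> y $ 1" "e \<le> y $ 2" "e \<le> r - y $ 1" "e \<le> r - y $ 2" using y1 y2 y3 by (auto simp: e_def)
      have stay: "y + h *\<^sub>R ax i \<in> K" if "\<bar>h\<bar> < e" for h i
        using that e exhaust_2[of i] by (auto simp: mK forall_2 axis_def abs_less_iff)
      have g1: "- (?D * (?q * (3 * ?p ^ 2 * (1 - ?p - ?q) - ?p ^ 3)) * (exp (L \<tau> + \<epsilon> * \<tau>) / r)) + 1 * rseries (fderiv 1 (c \<tau>)) y = 0"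
      proof (rule line_min_imp_deriv_eq[OF t' e(1), of "\<lambda>y. - \<Phi> \<tau> y"])
        show "((\<lambda>h. - \<Phi> \<tau> (y + h *\<^sub>R ax 1)) has_real_derivative
          - (?D * (?q * (3 * ?p ^ 2 * (1 - ?p - ?q) - ?p ^ 3)) * (exp (L \<tau> + \<epsilon> * \<tau>) / r))) (at 0)"
        proof -
          have "\<Phi> \<tau> (y + h *\<^sub>R ax 1) = ?D * ((?p + h * (exp (L \<tau> + \<epsilon> * \<tau>) / r)) ^ 3 * ?q * (1 - (?p + h * (exp (L \<tau> + \<epsilon> * \<tau>) / r)) - ?q))" for h
            by (simp add: \<Phi>_def P_def Q_def axis_def add_divide_distrib distrib_right)
          then show ?thesis by (simp only:) (intro DERIV_minus corner_profile_deriv_P)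
        qed
      qed (use min[OF stay] in auto)
      have g2: "- (?D * (?p ^ 3 * (1 - ?p - 2 * ?q)) * (exp (- L \<tau> + \<epsilon> * \<tau>) / b)) + 1 * rseries (fderiv 2 (c \<tau>)) y = 0"
      proof (rule line_min_imp_deriv_eq[OF t' e(1), of "\<lambda>y. - \<Phi> \<tau> y"])
        show "((\<lambda>h. - \<Phi> \<tau> (y + h *\<^sub>R ax 2)) has_real_derivative
          - (?D * (?p ^ 3 * (1 - ?p - 2 * ?q)) * (exp (- L \<tau> + \<epsilon> * \<tau>) / b))) (at 0)"
        proof -
          have "\<Phi> \<tau> (y + h *\<^sub>R ax 2) = ?D * (?p ^ 3 * (?q + h * (exp (- L \<tau> + \<epsilon> * \<tau>) / b)) * (1 - ?p - (?q + h * (exp (- L \<tau> + \<epsilon> * \<tau>) / b))))" for h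
            by (simp add: \<Phi>_def P_def Q_def axis_def add_divide_distrib distrib_right)
          then show ?thesis by (simp only:) (intro DERIV_minus corner_profile_deriv_Q)
        qed
      qed (use min[OF stay] in auto)
      have Pd: "((\<lambda>s. P s y) has_real_derivative (lam \<tau> + \<epsilon>) * ?p) (at \<tau> within {0..T})"
        unfolding P_def using Ld[OF t'] r by (auto intro!: derivative_eq_intros simp: field_simps)
      have Qd: "((\<lambda>s. Q s y) has_real_derivative (- lam \<tau> + \<epsilon>) * ?q) (at \<tau> within {0..T})"
        unfolding Q_def using Ld[OF t'] b by (auto intro!: derivative_eq_intros simp: field_simps)
      let ?\<Phi>t = "- 8 * \<epsilon> * \<Phi> \<tau> y + ?D * ((lam \<tau> + \<epsilon>) * (?q * (3 * ?p ^ 3 * (1 - ?p - ?q) - ?p ^ 4))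
          + (- lam \<tau> + \<epsilon>) * (?p ^ 3 * (?q * (1 - ?p - 2 * ?q))))"
      have \<Phi>d: "((\<lambda>s. \<Phi> s y) has_real_derivative ?\<Phi>t) (at \<tau> within {0..T})"
        unfolding \<Phi>_def by (rule corner_profile_deriv_time[OF Pd Qd])
      have "((\<lambda>s. w s y - \<Phi> s y) has_real_derivative - vel_dot_grad s (c \<tau>) (c \<tau>) y - ?\<Phi>t) (at \<tau> within {0..T})"
        by (rule DERIV_diff[OF evolution[OF t'] \<Phi>d])
      moreover have "0 \<le> - vel_dot_grad s (c \<tau>) (c \<tau>) y - ?\<Phi>t"
      proof -
        have u: "\<bar>vel1 s (c \<tau>) y + lam \<tau> * y $ 1\<bar> \<le> \<epsilon> * y $ 1" "\<bar>vel2 s (c \<tau>) y - lam \<tau> * y $ 2\<bar> \<le> \<epsilon> * y $ 2"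
          using velocity_near_origin[OF t' osc[OF t'] yy(1) yy(1) Kn[OF y]] by auto
        \<comment> \<open>Inflating P and Q by exp(\<epsilon> t) shifts the relative velocity errors
          from [-\<epsilon>, \<epsilon>] to [0, 2 \<epsilon>]. The sign matters because
          \<open>?X\<close> and \<open>?Y\<close> are controlled by \<open>?F\<close> only from
          above. The damping rate 8 \<epsilon> is 2 \<epsilon> (3 + 1).\<close>
        define c1 where "c1 = vel1 s (c \<tau>) y / y $ 1 + lam \<tau> + \<epsilon>"
        define c2 where "c2 = vel2 s (c \<tau>) y / y $ 2 - lam \<tau> + \<epsilon>"
        have v1: "vel1 s (c \<tau>) y = (c1 - lam \<tau> - \<epsilon>) * y $ 1" using y1 by (simp add: c1_def)
        have v2: "vel2 s (c \<tau>) y = (c2 + lam \<tau> - \<epsilon>) * y $ 2" using y1 by (simp add: c2_def)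
        have c1: "0 \<le> c1" "c1 \<le> 2 * \<epsilon>"
        proof -
          have "\<bar>(c1 - \<epsilon>) * y $ 1\<bar> \<le> \<epsilon> * y $ 1" using u(1) by (simp add: v1 algebra_simps)
          then have "\<bar>c1 - \<epsilon>\<bar> \<le> \<epsilon>" using y1 by (simp add: abs_mult)
          then show "0 \<le> c1" "c1 \<le> 2 * \<epsilon>" by linarith+
        qed
        have c2: "0 \<le> c2" "c2 \<le> 2 * \<epsilon>"
        proof -
          have "\<bar>(c2 - \<epsilon>) * y $ 2\<bar> \<le> \<epsilon> * y $ 2" using u(2) by (simp add: v2 algebra_simps)
          then have "\<bar>c2 - \<epsilon>\<bar> \<le> \<epsilon>" using y1 by (simp add: abs_mult)
          then show "0 \<le> c2" "c2 \<le> 2 * \<epsilon>" by linarith+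
        qed
        let ?F = "?p ^ 3 * ?q * (1 - ?p - ?q)"
        let ?X = "?q * (3 * ?p ^ 3 * (1 - ?p - ?q) - ?p ^ 4)" and ?Y = "?p ^ 3 * (?q * (1 - ?p - 2 * ?q))"
        have X: "?X \<le> 3 * ?F" using pq by (simp add: algebra_simps)
        have Y: "?Y \<le> ?F" using pq by (simp add: algebra_simps)
        have swap: "a * (m * (e / d)) = m * (a * e / d)" for a m e d :: real by simp
        have w1: "y $ 1 * rseries (fderiv 1 (c \<tau>)) y = ?D * ?X"
        proof -
          have "y $ 1 * rseries (fderiv 1 (c \<tau>)) y = ?D * (?q * (3 * ?p ^ 2 * (1 - ?p - ?q) - ?p ^ 3)) * (y $ 1 * exp (L \<tau> + \<epsilon> * \<tau>) / r)"
          proof -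
            have "rseries (fderiv 1 (c \<tau>)) y = ?D * (?q * (3 * ?p ^ 2 * (1 - ?p - ?q) - ?p ^ 3)) * (exp (L \<tau> + \<epsilon> * \<tau>) / r)"
              using g1 by linarith
            then show ?thesis by (simp only: swap)
          qed
          also have "y $ 1 * exp (L \<tau> + \<epsilon> * \<tau>) / r = ?p" by (simp add: P_def)
          finally show ?thesis by (simp add: algebra_simps power2_eq_square power3_eq_cube power4_eq_xxxx)
        qed
        have w2: "y $ 2 * rseries (fderiv 2 (c \<tau>)) y = ?D * ?Y"
        proof -
          have "y $ 2 * rseries (fderiv 2 (c \<tau>)) y = ?D * (?p ^ 3 * (1 - ?p - 2 * ?q)) * (y $ 2 * exp (- L \<tau> + \<epsilon> * \<tau>) / b)"
          proof -
            have "rseries (fderiv 2 (c \<tau>)) y = ?D * (?p ^ 3 * (1 - ?p - 2 * ?q)) * (exp (- L \<tau> + \<epsilon> * \<tau>) / b)"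
              using g2 by linarith
            then show ?thesis by (simp only: swap)
          qed
          also have "y $ 2 * exp (- L \<tau> + \<epsilon> * \<tau>) / b = ?q" by (simp add: Q_def)
          finally show ?thesis by (simp add: algebra_simps)
        qed
        have "vel_dot_grad s (c \<tau>) (c \<tau>) y = (c1 - lam \<tau> - \<epsilon>) * (?D * ?X) + (c2 + lam \<tau> - \<epsilon>) * (?D * ?Y)"
          unfolding vel_dot_grad_def v1 v2 w1[symmetric] w2[symmetric] by simp
        then have v: "- vel_dot_grad s (c \<tau>) (c \<tau>) y - ?\<Phi>t = ?D * (8 * \<epsilon> * ?F - c1 * ?X - c2 * ?Y)"
          by (simp add: \<Phi>_def algebra_simps)
        have "c1 * ?X + c2 * ?Y \<le> 2 * \<epsilon> * (3 * ?F) + 2 * \<epsilon> * ?F"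
        proof -
          have "c1 * ?X \<le> c1 * (3 * ?F)" by (rule mult_left_mono[OF X c1(1)])
          also have "\<dots> \<le> 2 * \<epsilon> * (3 * ?F)" using c1 pos by (intro mult_right_mono) auto
          finally have 1: "c1 * ?X \<le> 2 * \<epsilon> * (3 * ?F)" .
          have "c2 * ?Y \<le> c2 * ?F" by (rule mult_left_mono[OF Y c2(1)])
          also have "\<dots> \<le> 2 * \<epsilon> * ?F" using c2 pos by (intro mult_right_mono) auto
          finally show ?thesis using 1 by linarith
        qed
        then have "0 \<le> 8 * \<epsilon> * ?F - c1 * ?X - c2 * ?Y" by linarith
        then show ?thesis unfolding v by (intro mult_nonneg_nonneg less_imp_le[OF D])
      qed
      ultimately show ?thesis by blast
    qed
  qed (use t y in auto)
  have x1: "x $ 1 = r * exp (- L T - \<epsilon> * T) / 3" "x $ 2 = r * exp (- \<epsilon> * T) / 3" by (simp_all add: x_def)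
  have xK: "x \<in> K"
  proof -
    have "0 \<le> \<epsilon> * T" using \<epsilon> T by simp
    then have "exp (- L T - \<epsilon> * T) \<le> 1" "exp (- \<epsilon> * T) \<le> 1" using Lnn by auto
    then have "r * exp (- L T - \<epsilon> * T) \<le> r * 1" "r * exp (- \<epsilon> * T) \<le> r * 1" using r by (auto intro!: mult_left_mono)
    then have "x $ 1 \<le> r" "x $ 2 \<le> r" using r unfolding x1 by linarith+
    moreover have "0 \<le> x $ 1" "0 \<le> x $ 2" using r by (simp_all add: x1)
    ultimately show ?thesis by (simp add: mK forall_2)
  qed
  show "x \<in> cell" using Kq[OF xK] by (auto simp: mem_quadrant mem_cell intro: order_trans[of _ 0])
  \<comment> \<open>At P = Q = 1/3 the polynomial has the value 1/243, and 3888 = 16 * 243.\<close>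
  have P: "P T x = 1 / 3" using r by (simp add: P_def x1 flip: exp_add)
  have Q: "Q T x = 1 / 3" using r by (simp add: Q_def x1 b_def flip: exp_add)
  have "\<Phi> T x = C * exp (- 8 * \<epsilon> * T) * (1 / 243)"
    unfolding \<Phi>_def P Q by (simp add: power3_eq_cube)
  also have "\<dots> = A * r ^ 4 * exp (- L T - 8 * \<epsilon> * T) / 3888"
    by (simp add: C_def b_def power4_eq_xxxx power3_eq_cube exp_diff exp_minus field_simps)
  finally show "A * r ^ 4 * exp (- L T - 8 * \<epsilon> * T) / 3888 \<le> w T x" using main[OF TT(1) xK] by simp
qed

end

section \<open>Exponential growth\<close>

text \<open>At the point supplied by \<open>corner_subsolution\<close>, a lower bound of order r^4
  exp(-L - 8 \<epsilon> T) meets the bound of order B r^2 exp(-2 L - 2 \<epsilon> T) from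
  \<open>w_quadratic\<close>. Hence r^2 exp(L - 6 \<epsilon> T) is at most a multiple of B, and r^2
  of order B^(8/s) explains the exponent.\<close>

lemma growth_estimate:
  assumes s: "- 1 < s" "s < 0"
  shows "\<exists>\<Lambda>>0. \<exists>C>0. \<forall>T c M A B. odd_solution s T c M A \<longrightarrow> 1 \<le> B \<longrightarrow>
    (\<forall>t\<in>{0..T}. \<forall>x. \<bar>rseries (fderiv 1 (fderiv 1 (c t))) x\<bar> \<le> A * B \<and> \<bar>rseries (fderiv 1 (fderiv 2 (c t))) x\<bar> \<le> A * B) \<longrightarrow>
    C * exp (\<Lambda> * A * T / 2) \<le> B powr (1 - 8 / s)"
proof -
  obtain \<Lambda> where \<Lambda>: "\<Lambda> > 0"
    "\<And>T c M A t. odd_solution s T c M A \<Longrightarrow> t \<in> {0..T} \<Longrightarrow> \<Lambda> * A \<le> strain s (c t) 0"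
    using strain_lower_bound[OF s] by blast
  obtain D where D: "D > 0" "D \<le> 1"
    "\<And>T c M A t B x. odd_solution s T c M A \<Longrightarrow> t \<in> {0..T} \<Longrightarrow> 1 \<le> B \<Longrightarrow>
       (\<forall>y. \<bar>rseries (fderiv 1 (fderiv 2 (c t))) y\<bar> \<le> A * B) \<Longrightarrow> norm x \<le> D * B powr (4 / s) \<Longrightarrow>
       \<bar>strain s (c t) x - strain s (c t) 0\<bar> \<le> \<Lambda> / 12 * A"
    using strain_oscillation[OF s, of "\<Lambda> / 12"] \<Lambda>(1) by auto
  show ?thesis
  proof (rule exI[of _ \<Lambda>], rule conjI, rule \<Lambda>(1), rule exI[of _ "D\<^sup>2 / 1728"], intro conjI allI impI)
    fix T c M A B
    assume os: "odd_solution s T c M A" and B: "1 \<le> B"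
      and N: "\<forall>t\<in>{0..T}. \<forall>x. \<bar>rseries (fderiv 1 (fderiv 1 (c t))) x\<bar> \<le> A * B \<and> \<bar>rseries (fderiv 1 (fderiv 2 (c t))) x\<bar> \<le> A * B"
    interpret odd_solution s T c M A by (rule os)
    \<comment> \<open>Points of the box have norm at most 2 r, so r is half of the radius allowed by
      the oscillation bound.\<close>
    define r where "r = D / 2 * B powr (4 / s)"
    have B4: "0 < B powr (4 / s)" "B powr (4 / s) \<le> 1"
      using B s powr_mono[of "4 / s" 0 B] by (auto simp: divide_le_0_iff)
    have r: "0 < r" "r \<le> 1"
      using D B4 mult_mono[of "D / 2" 1 "B powr (4 / s)" 1] by (auto simp: r_def)
    \<comment> \<open>Chosen so that the loss 6 \<epsilon> T is half of \<Lambda> A T, the lower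
      bound for the integrated strain.\<close>
    define \<epsilon> where "\<epsilon> = \<Lambda> / 12 * A"
    have \<epsilon>: "0 \<le> \<epsilon>" using \<Lambda>(1) A by (simp add: \<epsilon>_def)
    have lam0: "0 \<le> lam t" if "t \<in> {0..T}" for t
      using \<Lambda>(2)[OF os that] \<Lambda>(1) A by (auto intro: order_trans[rotated])
    have osc: "\<bar>strain s (c t) y - lam t\<bar> \<le> \<epsilon>" if "t \<in> {0..T}" "norm y \<le> 2 * r" for t y
      unfolding \<epsilon>_def using N that by (intro D(3)[OF os _ B]) (auto simp: r_def)
    define L where "L = integral {0..T} lam"
    define x :: plane where "x = (\<chi> i. if i = 1 then r * exp (- L - \<epsilon> * T) / 3 else r * exp (- \<epsilon> * T) / 3)"
    have TT: "T \<in> {0..T}" using T by auto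
    have low: "A * r ^ 4 * exp (- L - 8 * \<epsilon> * T) / 3888 \<le> w T x" and xc: "x \<in> cell"
      using corner_subsolution[OF \<epsilon> r lam0 osc] unfolding L_def x_def by auto
    have "\<bar>w T x\<bar> \<le> (A * B) * (x $ 1)\<^sup>2"
      using N TT by (intro w_quadratic[OF TT _ xc]) auto
    then have up: "w T x \<le> A * B * (r * exp (- L - \<epsilon> * T) / 3)\<^sup>2" by (simp add: x_def)
    have "\<Lambda> * A * T \<le> L"
    proof -
      have "integral {0..T} (\<lambda>_. \<Lambda> * A) \<le> L"
        unfolding L_def using \<Lambda>(2)[OF os]
        by (intro integral_le integrable_const_ivl integrable_continuous_real lam_continuous) auto
      then show ?thesis using T by (simp add: mult_ac)
    qed
    moreover have "6 * \<epsilon> * T = \<Lambda> * A * T / 2" by (simp add: \<epsilon>_def)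
    ultimately have "\<Lambda> * A * T / 2 \<le> L - 6 * \<epsilon> * T" by linarith
    then have eL: "exp (\<Lambda> * A * T / 2) \<le> exp (L - 6 * \<epsilon> * T)" by (simp only: exp_le_cancel_iff)
    have "A * r ^ 4 * exp (- L - 8 * \<epsilon> * T) / 3888 \<le> A * B * (r * exp (- L - \<epsilon> * T) / 3)\<^sup>2"
      using low up by linarith
    also have "\<dots> = A * r\<^sup>2 * (B * exp (- 2 * L - 2 * \<epsilon> * T) / 9)"
      by (simp add: power_mult_distrib power_divide exp_double[symmetric] algebra_simps)
    finally have "A * r\<^sup>2 * (r\<^sup>2 * exp (- L - 8 * \<epsilon> * T) / 3888) \<le> A * r\<^sup>2 * (B * exp (- 2 * L - 2 * \<epsilon> * T) / 9)"
      by (simp add: power4_eq_xxxx power2_eq_square mult_ac)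
    then have "r\<^sup>2 * exp (- L - 8 * \<epsilon> * T) / 3888 \<le> B * exp (- 2 * L - 2 * \<epsilon> * T) / 9"
      using A r by (simp only: mult_le_cancel_left_pos mult_pos_pos zero_less_power)
    then have "exp (2 * L + 2 * \<epsilon> * T) * (r\<^sup>2 * exp (- L - 8 * \<epsilon> * T)) \<le> exp (2 * L + 2 * \<epsilon> * T) * (432 * (B * exp (- 2 * L - 2 * \<epsilon> * T)))"
      by (intro mult_left_mono) auto
    also have "exp (2 * L + 2 * \<epsilon> * T) * (432 * (B * exp (- 2 * L - 2 * \<epsilon> * T))) = 432 * B * (exp (2 * L + 2 * \<epsilon> * T) * exp (- 2 * L - 2 * \<epsilon> * T))"
      by (simp only: mult_ac)
    also have "exp (2 * L + 2 * \<epsilon> * T) * exp (- 2 * L - 2 * \<epsilon> * T) = 1" by (simp flip: exp_add)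
    also have "exp (2 * L + 2 * \<epsilon> * T) * (r\<^sup>2 * exp (- L - 8 * \<epsilon> * T)) = r\<^sup>2 * (exp (2 * L + 2 * \<epsilon> * T) * exp (- L - 8 * \<epsilon> * T))"
      by (simp only: mult_ac)
    also have "exp (2 * L + 2 * \<epsilon> * T) * exp (- L - 8 * \<epsilon> * T) = exp (L - 6 * \<epsilon> * T)" by (simp add: algebra_simps flip: exp_add)
    finally have 1: "r\<^sup>2 * exp (L - 6 * \<epsilon> * T) \<le> 432 * B" by simp
    have "r\<^sup>2 * exp (\<Lambda> * A * T / 2) \<le> r\<^sup>2 * exp (L - 6 * \<epsilon> * T)" by (intro mult_left_mono eL) auto
    then have 2: "r\<^sup>2 * exp (\<Lambda> * A * T / 2) \<le> 432 * B" using 1 by linarith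
    have r2: "r\<^sup>2 = D\<^sup>2 / 4 * B powr (8 / s)"
    proof -
      have "(B powr (4 / s))\<^sup>2 = B powr (8 / s)" by (simp add: power2_eq_square flip: powr_add)
      then show ?thesis by (simp add: r_def power_mult_distrib power_divide)
    qed
    have "B powr (8 / s) * (D\<^sup>2 / 1728 * exp (\<Lambda> * A * T / 2)) = D\<^sup>2 / 4 * B powr (8 / s) * exp (\<Lambda> * A * T / 2) / 432"
      by simp
    also have "\<dots> \<le> B" using 2 unfolding r2 by simp
    finally have "B powr (- 8 / s) * (B powr (8 / s) * (D\<^sup>2 / 1728 * exp (\<Lambda> * A * T / 2))) \<le> B powr (- 8 / s) * B"
      by (intro mult_left_mono) auto
    moreover have "B powr (- 8 / s) * B powr (8 / s) = 1" using B by (simp flip: powr_add)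
    moreover have "B powr (- 8 / s) * B = B powr (1 - 8 / s)"
      using B powr_add[of B "- 8 / s" 1] by (simp add: algebra_simps)
    ultimately show "D\<^sup>2 / 1728 * exp (\<Lambda> * A * T / 2) \<le> B powr (1 - 8 / s)"
      by (simp only: mult.assoc[symmetric] mult_1_left)
  qed (use D in auto)
qed

section \<open>Smoothness of the data\<close>

inductive trig_function :: "(plane \<Rightarrow> real) \<Rightarrow> bool" where
  const: "trig_function (\<lambda>x. a)"
| sin: "trig_function (\<lambda>x. sin (x $ i))"
| cos: "trig_function (\<lambda>x. cos (x $ i))"
| add: "trig_function f \<Longrightarrow> trig_function g \<Longrightarrow> trig_function (\<lambda>x. f x + g x)"
| mult: "trig_function f \<Longrightarrow> trig_function g \<Longrightarrow> trig_function (\<lambda>x. f x * g x)"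

text \<open>The class is closed under directional derivatives, so the recursion of
  \<open>Ck_on\<close> can be followed by induction.\<close>

lemma trig_function_derivative:
  assumes "trig_function f"
  shows "\<exists>D. \<forall>x. (f has_derivative D x) (at x) \<and> (\<forall>b. trig_function (\<lambda>x. D x b))"
  using assms
proof induction
  case (const a)
  show ?case by (intro exI[of _ "\<lambda>x h. 0"]) (auto intro: trig_function.const)
next
  case (sin i)
  have "((\<lambda>x. sin (x $ i)) has_derivative (\<lambda>h. cos (x $ i) * h $ i)) (at x)" for x :: plane
    by (auto intro!: derivative_eq_intros bounded_linear_imp_has_derivative bounded_linear_vec_nth simp: mult.commute)
  then show ?case by (intro exI[of _ "\<lambda>x h. cos (x $ i) * h $ i"]) (auto intro: trig_function.intros)
next
  case (cos i)
  have "((\<lambda>x. cos (x $ i)) has_derivative (\<lambda>h. sin (x $ i) * - h $ i)) (at x)" for x :: plane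
    by (auto intro!: derivative_eq_intros bounded_linear_imp_has_derivative bounded_linear_vec_nth simp: mult.commute)
  then show ?case
    by (intro exI[of _ "\<lambda>x h. sin (x $ i) * - h $ i"] allI conjI trig_function.intros)
next
  case (add f g)
  then obtain F G where "\<And>x. (f has_derivative F x) (at x)" "\<And>b. trig_function (\<lambda>x. F x b)"
    "\<And>x. (g has_derivative G x) (at x)" "\<And>b. trig_function (\<lambda>x. G x b)" by metis
  then show ?case
    by (intro exI[of _ "\<lambda>x h. F x h + G x h"]) (auto intro!: trig_function.add derivative_intros)
next
  case (mult f g)
  then obtain F G where "\<And>x. (f has_derivative F x) (at x)" "\<And>b. trig_function (\<lambda>x. F x b)"
    "\<And>x. (g has_derivative G x) (at x)" "\<And>b. trig_function (\<lambda>x. G x b)" by metis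
  with mult.hyps show ?case
    by (intro exI[of _ "\<lambda>x h. f x * G x h + F x h * g x"])
       (auto intro!: trig_function.add trig_function.mult has_derivative_mult)
qed

lemma trig_function_smooth:
  assumes "trig_function f" shows "smooth_on UNIV f"
proof -
  have "Ck_on k UNIV f" for k
    using assms
  proof (induction k arbitrary: f)
    case 0
    from trig_function_derivative[OF this] show ?case
      by (auto intro: has_derivative_continuous_on has_derivative_at_withinI)
  next
    case (Suc k)
    obtain D where "\<And>x. (f has_derivative D x) (at x)" "\<And>b. trig_function (\<lambda>x. D x b)"
      using trig_function_derivative[OF Suc.prems] by blast
    then show ?case using Suc.IH by auto
  qed
  then show ?thesis by (simp add: smooth_on_def)
qed

lemma profile_data: "smooth_periodic_data (\<lambda>x. A * profile x)"
  unfolding smooth_periodic_data_def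
proof (intro conjI)
  have "trig_function (\<lambda>x. A * ((sin (x $ 1) * (sin (x $ 1) * sin (x $ 1))) * sin (x $ 2)))"
    by (intro trig_function.intros)
  then show "smooth_on UNIV (\<lambda>x. A * profile x)"
    using trig_function_smooth by (simp add: profile_def power3_eq_cube mult.assoc)
  show "periodic (\<lambda>x. A * profile x)"
    unfolding periodic_def
  proof (intro allI)
    fix x :: plane and i :: 2
    show "A * profile (x + (2 * pi) *\<^sub>R ax i) = A * profile x"
      using exhaust_2[of i] by (auto simp: profile_def axis_def)
  qed
  \<comment> \<open>The mean vanishes because the data are an x_2-derivative of a periodic
    function.\<close>
  have "has_dir_deriv 2 (\<lambda>x. - A * (sin (x $ 1) ^ 3 * cos (x $ 2))) (\<lambda>x. A * profile x)"
    unfolding has_dir_deriv_def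
    by (auto simp: axis_def profile_def has_real_derivative_iff_has_vector_derivative[symmetric] intro!: derivative_eq_intros)
  then have "cell_int (\<lambda>x. A * profile x) = 0"
    by (rule cell_int_dir_deriv_eq_0) (auto intro!: continuous_intros simp: axis_def)
  then show "mean_zero (\<lambda>x. A * profile x)"
    unfolding mean_zero_def by (subst LINT_torus_eq_cell_int) (auto intro!: continuous_intros)
qed

text \<open>Where a continuous function exceeds an essential bound, the set is open and null in the
  open square, hence empty. Closure and periodicity carry the bound to the plane.\<close>

lemma Linf_norm_bound:
  fixes F :: "plane \<Rightarrow> 'b::real_normed_vector"
  assumes c: "continuous_on UNIV (\<lambda>x. norm (F x))" and p: "periodic (\<lambda>x. norm (F x))"
    and le: "Linf_norm F \<le> ereal N"
  shows "norm (F x) \<le> N"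
proof -
  have "AE x in restrict_space lborel torus. ereal (norm (F x)) \<le> esssup (restrict_space lborel torus) (\<lambda>x. ereal (norm (F x)))"
    by (rule esssup_AE)
  then have "AE x in restrict_space lborel torus. norm (F x) \<le> N"
    using le unfolding Linf_norm_def by (elim eventually_mono) (metis ereal_less_eq(3) order_trans)
  then have ae: "AE x in lborel. x \<in> torus \<longrightarrow> norm (F x) \<le> N"
    by (subst (asm) AE_restrict_space_iff) auto
  let ?B = "box (\<chi> i. - pi) (\<chi> i. pi) :: plane set"
  define U where "U = ?B \<inter> {x. N < norm (F x)}"
  have "open U" unfolding U_def by (intro open_Int open_box open_Collect_less c continuous_intros)
  have "AE x in lborel. x \<notin> U"
    using ae by (elim eventually_mono) (use interior_cell_subset_torus in \<open>auto simp: U_def\<close>)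
  then have "U \<in> null_sets lborel" using \<open>open U\<close> by (subst AE_iff_null_sets) auto
  then have "negligible U" by (simp add: negligible_iff_null_sets null_sets_completionI)
  then have "U = {}" using open_not_negligible[OF \<open>open U\<close>] by blast
  then have "?B \<subseteq> {x. norm (F x) \<le> N}" by (auto simp: U_def)
  moreover have "closed {x. norm (F x) \<le> N}" by (intro closed_Collect_le c continuous_intros)
  ultimately have "closure ?B \<subseteq> {x. norm (F x) \<le> N}" by (rule closure_minimal)
  moreover have "closure ?B = cell"
    unfolding cell_def by (rule closure_box) (use pi_gt_zero in \<open>simp add: box_ne_empty Basis_vec_def inner_axis\<close>)
  ultimately show ?thesis
    using torus_rep_in_torus[of x] torus_subset_cell periodic_torus_rep[OF p, of x] by auto
qed

lemma hessian_rseries: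
  assumes "rapid a"
  shows "hessian (rseries a) = (\<lambda>x. \<chi> i j. rseries (fderiv i (fderiv j a)) x)"
  using assms by (simp add: hessian_def fun_eq_iff partial_rseries rapid_fderiv)

lemma hessian_bound:
  assumes a: "rapid a" and N: "Linf_norm (hessian (rseries a)) \<le> ereal N"
  shows "\<bar>rseries (fderiv i (fderiv j a)) x\<bar> \<le> N"
proof -
  have "\<bar>hessian (rseries a) x $ i $ j\<bar> \<le> norm (hessian (rseries a) x $ i)" by (rule component_le_norm_cart)
  also have "\<dots> \<le> norm (hessian (rseries a) x)" by (rule Finite_Cartesian_Product.norm_nth_le)
  also have "\<dots> \<le> N"
  proof (rule Linf_norm_bound[OF _ _ N])
    show "continuous_on UNIV (\<lambda>x. norm (hessian (rseries a) x))"
      unfolding hessian_rseries[OF a] by (intro continuous_intros rapid_fderiv a)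
    show "periodic (\<lambda>x. norm (hessian (rseries a) x))"
      unfolding hessian_rseries[OF a] by (simp add: periodic_def rseries_periodic)
  qed
  finally show ?thesis by (simp add: hessian_rseries[OF a])
qed

text \<open>The point is a maximum of the profile. A Hessian entry of size 3 A at time 0 settles
  small T in \<open>hessian_growth\<close> and leaves only the case \<gamma> A T \<ge> 1.\<close>

lemma (in odd_solution) initial_hessian: "rseries (fderiv 1 (fderiv 1 (c 0))) (\<chi> i. pi / 2) = - 3 * A"
proof -
  have 0: "rapid (c 0)" using T by (intro rapid_c) auto
  have 1: "rseries (fderiv 1 (c 0)) x = A * (3 * sin (x $ 1) ^ 2 * cos (x $ 1) * sin (x $ 2))" for x
  proof (rule DERIV_unique)
    show "((\<lambda>h. rseries (c 0) (x + h *\<^sub>R ax 1)) has_real_derivative rseries (fderiv 1 (c 0)) x) (at 0)"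
      using rseries_line_deriv[OF 0, of x 1 0 UNIV] by simp
    show "((\<lambda>h. rseries (c 0) (x + h *\<^sub>R ax 1)) has_real_derivative A * (3 * sin (x $ 1) ^ 2 * cos (x $ 1) * sin (x $ 2))) (at 0)"
      unfolding initial profile_def by (auto simp: axis_def intro!: derivative_eq_intros)
  qed
  have "rseries (fderiv 1 (fderiv 1 (c 0))) (\<chi> i. pi / 2) = A * (3 * (- 1))"
  proof (rule DERIV_unique)
    show "((\<lambda>h. rseries (fderiv 1 (c 0)) ((\<chi> i. pi / 2) + h *\<^sub>R ax 1)) has_real_derivative rseries (fderiv 1 (fderiv 1 (c 0))) (\<chi> i. pi / 2)) (at 0)"
      using rseries_line_deriv[OF rapid_fderiv[OF 0], of 1 "\<chi> i. pi / 2" 1 0 UNIV] by simp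
    show "((\<lambda>h. rseries (fderiv 1 (c 0)) ((\<chi> i. pi / 2) + h *\<^sub>R ax 1)) has_real_derivative A * (3 * (- 1))) (at 0)"
      unfolding 1 by (auto simp: axis_def intro!: derivative_eq_intros)
  qed
  then show ?thesis by simp
qed

text \<open>By contradiction, with exp(\<gamma> A T) in the role of B in
  \<open>growth_estimate\<close>. The condition \<open>A \<ge> 1\<close> lets B be weakened to A B
  and makes the initial Hessian at least 3.\<close>

lemma hessian_growth:
  fixes \<alpha> :: real
  assumes \<alpha>: "0 < \<alpha>" "\<alpha> < 1"
  shows "\<exists>\<gamma>>0. \<forall>A\<ge>1. \<forall>T>0. \<forall>\<omega>. smooth_solution \<alpha> (\<lambda>x. A * profile x) T \<omega> \<longrightarrow>
    ereal (exp (\<gamma> * A * T)) \<le> (SUP t\<in>{0..T}. Linf_norm (hessian (\<omega> t)))"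
proof -
  define s where "s = - 1 + \<alpha>"
  have s: "- 1 < s" "s < 0" using \<alpha> by (auto simp: s_def)
  obtain \<Lambda> C where \<Lambda>: "\<Lambda> > 0" and C: "C > 0"
    and growth: "\<And>T c M A B. odd_solution s T c M A \<Longrightarrow> 1 \<le> B \<Longrightarrow>
      (\<forall>t\<in>{0..T}. \<forall>x. \<bar>rseries (fderiv 1 (fderiv 1 (c t))) x\<bar> \<le> A * B \<and> \<bar>rseries (fderiv 1 (fderiv 2 (c t))) x\<bar> \<le> A * B) \<Longrightarrow>
      C * exp (\<Lambda> * A * T / 2) \<le> B powr (1 - 8 / s)"
    using growth_estimate[OF s] by blast
  define K where "K = 1 - 8 / s"
  have K: "1 \<le> K" using s by (simp add: K_def divide_le_0_iff)
  \<comment> \<open>The first bound makes \<open>?B powr K\<close> at most exp(\<Lambda> A T / 4),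
    half of the exponent gained; the second lets the other half beat the constant \<open>C\<close>
    once \<gamma> A T \<ge> 1.\<close>
  define \<gamma> where "\<gamma> = min (\<Lambda> / (4 * K)) (\<Lambda> / (4 * (1 + \<bar>ln C\<bar>)))"
  have \<gamma>: "0 < \<gamma>" using \<Lambda> K by (simp add: \<gamma>_def add_pos_nonneg)
  show ?thesis
  proof (intro exI[of _ \<gamma>] conjI \<gamma> allI impI, rule ccontr)
    fix A T :: real and \<omega>
    assume A1: "1 \<le> A" and T: "0 < T" and sol: "smooth_solution \<alpha> (\<lambda>x. A * profile x) T \<omega>"
      and "\<not> ereal (exp (\<gamma> * A * T)) \<le> (SUP t\<in>{0..T}. Linf_norm (hessian (\<omega> t)))"
    then have lt: "(SUP t\<in>{0..T}. Linf_norm (hessian (\<omega> t))) < ereal (exp (\<gamma> * A * T))" by simp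
    obtain c M where tr: "transport_solution (- 1 + \<alpha>) T c M" and w: "\<And>t. t \<in> {0..T} \<Longrightarrow> \<omega> t = rseries (c t)"
      and w0: "\<omega> 0 = (\<lambda>x. A * profile x)"
      by (rule smooth_solution_imp_transport_solution[OF sol T \<alpha>]) blast
    interpret transport_solution s T c M using tr by (simp add: s_def)
    have 0: "0 \<in> {0..T}" using T by simp
    have os: "odd_solution s T c M A"
    proof
      show "0 < A" using A1 by simp
      show "rseries (c 0) x = A * profile x" for x using w[OF 0] w0 by (metis (no_types))
    qed
    interpret odd_solution s T c M A by (rule os)
    let ?B = "exp (\<gamma> * A * T)"
    have B: "1 \<le> ?B" using \<gamma> A T by simp
    have N: "\<bar>rseries (fderiv i (fderiv j (c t))) x\<bar> \<le> ?B" if t: "t \<in> {0..T}" for t i j x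
    proof (rule hessian_bound[OF rapid_c[OF t]])
      have "Linf_norm (hessian (\<omega> t)) \<le> (SUP t\<in>{0..T}. Linf_norm (hessian (\<omega> t)))" by (rule SUP_upper[OF t])
      then show "Linf_norm (hessian (rseries (c t))) \<le> ereal ?B" using lt w[OF t] by simp
    qed
    have "3 * A \<le> ?B" using N[OF 0, of 1 1 "\<chi> i. pi / 2"] unfolding initial_hessian using A by simp
    then have "3 \<le> ?B" using A1 by linarith
    \<comment> \<open>As exp 1 \<le> 3, a value of at least 3 excludes \<gamma> A T < 1.\<close>
    then have g1: "1 \<le> \<gamma> * A * T" using exp_le exp_less_cancel_iff[of "\<gamma> * A * T" 1] by linarith
    have "?B \<le> A * ?B" using mult_right_mono[OF A1, of ?B] by simp
    note AB = order_trans[OF N this]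
    have "C * exp (\<Lambda> * A * T / 2) \<le> ?B powr K"
      unfolding K_def using AB by (intro growth[OF os B]) auto
    also have "\<dots> = exp (K * \<gamma> * A * T)" by (simp add: powr_def mult_ac)
    also have "\<dots> \<le> exp (\<Lambda> * A * T / 4)"
    proof -
      have "\<gamma> \<le> \<Lambda> / (4 * K)" by (simp add: \<gamma>_def)
      then have "\<gamma> * (4 * K) \<le> \<Lambda>" using K by (subst (asm) pos_le_divide_eq) auto
      then have "K * \<gamma> \<le> \<Lambda> / 4" by (simp add: mult_ac)
      then have "(K * \<gamma>) * (A * T) \<le> (\<Lambda> / 4) * (A * T)" using A T by (intro mult_right_mono) auto
      then show ?thesis by (simp add: mult_ac)
    qed
    finally have "C * exp (\<Lambda> * A * T / 2) \<le> 1 * exp (\<Lambda> * A * T / 4)" by simp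
    moreover have "exp (\<Lambda> * A * T / 2) = exp (\<Lambda> * A * T / 4) * exp (\<Lambda> * A * T / 4)"
      by (simp flip: exp_add)
    ultimately have "C * exp (\<Lambda> * A * T / 4) * exp (\<Lambda> * A * T / 4) \<le> 1 * exp (\<Lambda> * A * T / 4)"
      by (simp only: mult.assoc)
    then have C1: "C * exp (\<Lambda> * A * T / 4) \<le> 1" by (simp only: mult_le_cancel_right_pos[OF exp_gt_zero])
    have "\<gamma> * (1 + \<bar>ln C\<bar>) \<le> \<Lambda> / 4"
    proof -
      have "\<gamma> \<le> \<Lambda> / (4 * (1 + \<bar>ln C\<bar>))" by (simp add: \<gamma>_def)
      then have "\<gamma> * (4 * (1 + \<bar>ln C\<bar>)) \<le> \<Lambda>" by (subst (asm) pos_le_divide_eq) auto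
      then show ?thesis by (simp add: algebra_simps)
    qed
    then have le: "(\<gamma> * (1 + \<bar>ln C\<bar>)) * (A * T) \<le> (\<Lambda> / 4) * (A * T)" using A T by (intro mult_right_mono) auto
    have "1 * (1 + \<bar>ln C\<bar>) \<le> (\<gamma> * A * T) * (1 + \<bar>ln C\<bar>)" using g1 by (intro mult_right_mono) auto
    also have "\<dots> = (\<gamma> * (1 + \<bar>ln C\<bar>)) * (A * T)" by (simp only: mult_ac)
    also note le
    finally have "1 + \<bar>ln C\<bar> \<le> \<Lambda> * A * T / 4" by simp
    then have "0 < ln C + \<Lambda> * A * T / 4" by linarith
    then have "1 < exp (ln C + \<Lambda> * A * T / 4)" by simp
    also have "\<dots> = C * exp (\<Lambda> * A * T / 4)" using C by (simp add: exp_add)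
    finally show False using C1 by simp
  qed
qed

theorem theorem1p1:
  fixes \<alpha> :: real
  assumes "0 < \<alpha>" and "\<alpha> < 1"
  shows "(\<exists>\<omega>\<^sub>0 \<gamma>. smooth_periodic_data \<omega>\<^sub>0 \<and> \<gamma> > 0 \<and>
            (\<forall>T>0. \<forall>\<omega>. smooth_solution \<alpha> \<omega>\<^sub>0 T \<omega> \<longrightarrow>
               (SUP t\<in>{0..T}. Linf_norm (hessian (\<omega> t))) \<ge> ereal (exp (\<gamma> * T)))) \<and>
         (\<forall>\<Gamma>>0. \<exists>\<omega>\<^sub>0 \<gamma>. smooth_periodic_data \<omega>\<^sub>0 \<and> \<gamma> \<ge> \<Gamma> \<and>
            (\<forall>T>0. \<forall>\<omega>. smooth_solution \<alpha> \<omega>\<^sub>0 T \<omega> \<longrightarrow>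
               (SUP t\<in>{0..T}. Linf_norm (hessian (\<omega> t))) \<ge> ereal (exp (\<gamma> * T))))"
proof -
  obtain \<gamma> where \<gamma>: "\<gamma> > 0"
    and growth: "\<And>A T \<omega>. 1 \<le> A \<Longrightarrow> 0 < T \<Longrightarrow> smooth_solution \<alpha> (\<lambda>x. A * profile x) T \<omega> \<Longrightarrow>
      ereal (exp (\<gamma> * A * T)) \<le> (SUP t\<in>{0..T}. Linf_norm (hessian (\<omega> t)))"
    using hessian_growth[OF assms] by blast
  show ?thesis
  proof (intro conjI allI impI)
    show "\<exists>\<omega>\<^sub>0 \<gamma>. smooth_periodic_data \<omega>\<^sub>0 \<and> \<gamma> > 0 \<and>
            (\<forall>T>0. \<forall>\<omega>. smooth_solution \<alpha> \<omega>\<^sub>0 T \<omega> \<longrightarrow>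
               (SUP t\<in>{0..T}. Linf_norm (hessian (\<omega> t))) \<ge> ereal (exp (\<gamma> * T)))"
      using growth[of 1] \<gamma> profile_data[of 1] by (intro exI[of _ "\<lambda>x. 1 * profile x"] exI[of _ \<gamma>]) auto
    fix \<Gamma> :: real assume "\<Gamma> > 0"
    \<comment> \<open>The growth rate for amplitude A is \<gamma> A; the maximum with 1 meets the
      condition of \<open>hessian_growth\<close>.\<close>
    define A where "A = max 1 (\<Gamma> / \<gamma>)"
    have "\<Gamma> / \<gamma> \<le> A" by (simp add: A_def)
    then have "\<Gamma> \<le> \<gamma> * A" using \<gamma> by (simp add: pos_divide_le_eq mult.commute)
    moreover have "1 \<le> A" by (simp add: A_def)
    ultimately show "\<exists>\<omega>\<^sub>0 \<gamma>. smooth_periodic_data \<omega>\<^sub>0 \<and> \<gamma> \<ge> \<Gamma> \<and>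
            (\<forall>T>0. \<forall>\<omega>. smooth_solution \<alpha> \<omega>\<^sub>0 T \<omega> \<longrightarrow>
               (SUP t\<in>{0..T}. Linf_norm (hessian (\<omega> t))) \<ge> ereal (exp (\<gamma> * T)))"
      using growth[of A] profile_data[of A] by (intro exI[of _ "\<lambda>x. A * profile x"] exI[of _ "\<gamma> * A"]) auto
  qed
qed

end
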